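(* Let $n\ge 2$, let $\rho$ be a conformal density on $\mathbb{B}^n$ and let $\psi$ be a growth function. Then the following are equivalent: (1) $\rho\in H^\psi$; (2) $\psi(\delta_1|\omega|_\rho)\in L^1(\mathbb{S}^{n-1})$ (as a function of $\omega$, with respect to $\sigma$) for some $\delta_1>0$; (3) $\psi(\delta_2\rho^*(\omega))\in L^1(\mathbb{S}^{n-1})$ for some $\delta_2>0$; (4) $(1-r)^{n-2}\psi(\delta_3M(r,\rho))\in L^1((0,1))$ (as a function of $r$, with respect to Lebesgue measure) for some $\delta_3>0$.
   Context: Notation: $\mathbb{B}^n=\{x\in\mathbb{R}^n:|x|<1\}$, $\mathbb{S}^{n-1}=\{x\in\mathbb{R}^n:|x|=1\}$, $\sigma$ is the $(n-1)$-dimensional surface measure on $\mathbb{S}^{n-1}$, and $B_x=B(x,(1-|x|)/2)$ (Euclidean ball) for $x\in\mathbb{B}^n$. For a continuous function $\rho:\mathbb{B}^n\to(0,\infty)$, put $\mathrm{length}_\rho(\gamma)=\int_\gamma\rho\,ds$ (arc length integration) for a curve $\gamma$. For $x,y\in\mathbb{B}^n$ let $d_\rho(x,y)=\inf\mathrm{length}_\rho(\gamma)$, the infimum over all curves $\gamma\subset\mathbb{B}^n$ with endpoints $x$ and $y$. For $\omega\in\mathbb{S}^{n-1}$ and $x\in\mathbb{B}^n$, $d_\rho(\omega,x)\in[0,\infty]$ is defined likewise, the infimum being over all curves in $\mathbb{B}^n$ (apart from the endpoint $\omega$) with endpoints $\omega$ and $x$. Write $|x|_\rho=d_\rho(x,0)$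 for $x\in\mathbb{B}^n$ and $|\omega|_\rho=d_\rho(\omega,0)$ for $\omega\in\mathbb{S}^{n-1}$. Let $B_\rho(x,r)=\{y\in\mathbb{B}^n:d_\rho(x,y)<r\}$. $\rho$ satisfies HI$(A)$, $A\ge1$, if for every $z\in\mathbb{B}^n$: $1/A\le\rho(x)/\rho(y)\le A$ for all $x,y\in B_z$. $\rho$ satisfies VG$(B)$, $B>0$, if $\int_{B_\rho(x,r)}\rho^n\,dx\le Br^n$ for all $x\in\mathbb{B}^n$, $r>0$. A conformal density on $\mathbb{B}^n$ is a continuous $\rho:\mathbb{B}^n\to(0,\infty)$ satisfying HI$(A)$ and VG$(B)$ for some $A\ge 1$, $B>0$. A growth function is a strictly increasing, differentiable function $\psi:[0,\infty]\to[0,\infty]$ with $\psi(0)=0$; differentiability is understood on $(0,\infty)$, with $\psi$ continuous on $[0,\infty]$ (so $\psi(t)=t^p$ is a growth function for every $0<p<\infty$). $\rho\in H^\psi$ means that there is $\delta>0$ with $\sup_{0<r<1}\int_{\mathbb{S}^{n-1}}\psi(\delta|r\omega|_\rho)\,d\sigma(\omega)<\infty$. For $\omega\in\mathbb{S}^{n-1}$ let $\Gamma(\omega)=\bigcup\{B_{t\omega}:0\le t<1\}$; the non-tangential maximal function is $\rho^*(\omega)=\sup_{x\in\Gamma(\omega)}|x|_\rho$. The maximum modulus is $M(r,\rho)=\sup_{|x|\le r}|x|_\rho$ for $r\in[0,1)$. *)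

theory Defs
  imports "HOL-Analysis.Analysis"
begin

text \<open>The surface measure is given by polar coordinates: a Borel set \<open>A\<close> of the unit sphere of
  an \<open>n\<close>-dimensional space has measure \<open>n\<close> times the volume of the cone
  \<open>{t *\<^sub>R \<omega> | 0 < t < 1, \<omega> \<in> A}\<close>.  As with Lebesgue measure, it is completed.\<close>

definition surface_measure :: "'a::euclidean_space measure" where
  "surface_measure =
     completion (scale_measure (of_nat DIM('a))
       (distr (restrict_space lborel (ball 0 1 - {0})) (restrict_space borel (sphere 0 1))
          (\<lambda>x. x /\<^sub>R norm x)))"

lemma space_surface_measure: "space surface_measure = sphere 0 1"
  by (simp add: surface_measure_def space_scale_measure space_restrict_space)

lemma emeasure_surface_measure:
  fixes A :: "'a::euclidean_space set"
  assumes A: "A \<in> sets borel" "A \<subseteq> sphere 0 1"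
  shows "emeasure surface_measure A =
    of_nat DIM('a) * emeasure lborel {t *\<^sub>R \<omega> | t \<omega>. 0 < t \<and> t < 1 \<and> \<omega> \<in> A}"
proof -
  let ?B = "ball 0 1 - {0} :: 'a set"
  let ?L = "restrict_space lborel ?B"
  let ?S = "restrict_space borel (sphere 0 1) :: 'a measure"
  let ?f = "\<lambda>x::'a. x /\<^sub>R norm x"
  have AS: "A \<in> sets ?S"
    using A by (auto simp: sets_restrict_space)
  have f: "?f \<in> measurable ?L ?S"
    by (rule measurable_restrict_space2)
      (auto simp: space_restrict_space intro!: measurable_restrict_space1)
  have cone: "?f -` A \<inter> space ?L = {t *\<^sub>R \<omega> | t \<omega>. 0 < t \<and> t < 1 \<and> \<omega> \<in> A}" (is "?l = ?r")
  proof (intro equalityI subsetI)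
    fix x assume x: "x \<in> ?l"
    then have "x = norm x *\<^sub>R ?f x" "0 < norm x" "norm x < 1" "?f x \<in> A"
      by (auto simp: space_restrict_space)
    then show "x \<in> ?r" by blast
  next
    fix x assume "x \<in> ?r"
    then obtain t \<omega> where *: "x = t *\<^sub>R \<omega>" "0 < t" "t < 1" "\<omega> \<in> A" by blast
    with A have "norm \<omega> = 1" by auto
    with * show "x \<in> ?l"
      by (auto simp: space_restrict_space)
  qed
  have "emeasure surface_measure A = of_nat DIM('a) * emeasure (distr ?L ?S ?f) A"
    unfolding surface_measure_def using AS by (subst emeasure_completion) (auto simp: ennreal_of_nat_eq_real_of_nat)
  also have "emeasure (distr ?L ?S ?f) A = emeasure ?L ?r"
    by (simp only: emeasure_distr[OF f AS] cone)
  also have "\<dots> = emeasure lborel ?r"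
    by (rule emeasure_restrict_space) (use cone in \<open>auto simp: space_restrict_space\<close>)
  finally show ?thesis .
qed

definition arc_length :: "(real \<Rightarrow> 'a::metric_space) \<Rightarrow> real \<Rightarrow> real \<Rightarrow> ennreal" where
  "arc_length \<gamma> a b =
     Sup {(\<Sum>i<m. ennreal (dist (\<gamma> (t i)) (\<gamma> (t (Suc i))))) | m t. mono t \<and> range t \<subseteq> {a..b}}"

text \<open>The parametrization of \<open>\<gamma>\<close>, started at time \<open>a\<close>, by arc length: the point at which the
  length \<open>u\<close> has been run through.\<close>

definition arc_length_param ::
    "(real \<Rightarrow> 'a::metric_space) \<Rightarrow> real \<Rightarrow> real \<Rightarrow> real \<Rightarrow> 'a" where
  "arc_length_param \<gamma> a b u = \<gamma> (Inf {t \<in> {a..b}. ennreal u \<le> arc_length \<gamma> a t})"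

text \<open>The integral of \<open>\<rho>\<close> with respect to arc length over a compact subcurve; non-rectifiable
  subcurves get the value \<open>\<infinity>\<close>.\<close>

definition arc_integral ::
    "('a::metric_space \<Rightarrow> real) \<Rightarrow> (real \<Rightarrow> 'a) \<Rightarrow> real \<Rightarrow> real \<Rightarrow> ennreal" where
  "arc_integral \<rho> \<gamma> a b =
     (if arc_length \<gamma> a b = \<infinity> then \<infinity>
      else \<integral>\<^sup>+u\<in>{0..enn2real (arc_length \<gamma> a b)}. ennreal (\<rho> (arc_length_param \<gamma> a b u)) \<partial>lborel)"

text \<open>The supremum over compact subcurves makes sense also of curves with an endpoint on the unit
  sphere, where \<open>\<rho>\<close> is not defined.\<close>

definition rho_length :: "('a::metric_space \<Rightarrow> real) \<Rightarrow> (real \<Rightarrow> 'a) \<Rightarrow> ennreal" where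
  "rho_length \<rho> \<gamma> = Sup {arc_integral \<rho> \<gamma> a b | a b. 0 < a \<and> a \<le> b \<and> b < 1}"

text \<open>Curves in the open unit ball, except that endpoints may lie on the unit sphere.\<close>

definition ball_curves :: "'a::euclidean_space \<Rightarrow> 'a \<Rightarrow> (real \<Rightarrow> 'a) set" where
  "ball_curves x y =
     {\<gamma>. path \<gamma> \<and> pathstart \<gamma> = x \<and> pathfinish \<gamma> = y \<and> \<gamma> ` {0<..<1} \<subseteq> ball 0 1}"

definition rho_dist :: "('a::euclidean_space \<Rightarrow> real) \<Rightarrow> 'a \<Rightarrow> 'a \<Rightarrow> ennreal" where
  "rho_dist \<rho> x y = (INF \<gamma>\<in>ball_curves x y. rho_length \<rho> \<gamma>)"

definition rho_norm :: "('a::euclidean_space \<Rightarrow> real) \<Rightarrow> 'a \<Rightarrow> ennreal" where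
  "rho_norm \<rho> x = rho_dist \<rho> x 0"

definition rho_ball :: "('a::euclidean_space \<Rightarrow> real) \<Rightarrow> 'a \<Rightarrow> real \<Rightarrow> 'a set" where
  "rho_ball \<rho> x r = {y \<in> ball 0 1. rho_dist \<rho> x y < ennreal r}"

definition whitney_ball :: "'a::euclidean_space \<Rightarrow> 'a set" where
  "whitney_ball x = ball x ((1 - norm x) / 2)"

definition harnack :: "real \<Rightarrow> ('a::euclidean_space \<Rightarrow> real) \<Rightarrow> bool" where
  "harnack A \<rho> \<longleftrightarrow>
     (\<forall>z\<in>ball 0 1. \<forall>x\<in>whitney_ball z. \<forall>y\<in>whitney_ball z. 1 / A \<le> \<rho> x / \<rho> y \<and> \<rho> x / \<rho> y \<le> A)"

definition volume_growth :: "real \<Rightarrow> ('a::euclidean_space \<Rightarrow> real) \<Rightarrow> bool" where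
  "volume_growth B \<rho> \<longleftrightarrow>
     (\<forall>x\<in>ball 0 1. \<forall>r>0.
        (\<integral>\<^sup>+y\<in>rho_ball \<rho> x r. ennreal (\<rho> y ^ DIM('a)) \<partial>lborel) \<le> ennreal (B * r ^ DIM('a)))"

definition conformal_density :: "('a::euclidean_space \<Rightarrow> real) \<Rightarrow> bool" where
  "conformal_density \<rho> \<longleftrightarrow>
     continuous_on (ball 0 1) \<rho> \<and> (\<forall>x\<in>ball 0 1. 0 < \<rho> x) \<and>
     (\<exists>A\<ge>1. harnack A \<rho>) \<and> (\<exists>B>0. volume_growth B \<rho>)"

text \<open>Strict monotonicity on \<open>[0,\<infinity>]\<close> makes \<open>\<psi> t\<close> finite for finite \<open>t\<close>, so that
  \<open>enn2real\<close> loses nothing.\<close>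

definition growth_function :: "(ennreal \<Rightarrow> ennreal) \<Rightarrow> bool" where
  "growth_function \<psi> \<longleftrightarrow>
     strict_mono \<psi> \<and> \<psi> 0 = 0 \<and> continuous_on UNIV \<psi> \<and>
     (\<forall>t>0. (\<lambda>s. enn2real (\<psi> (ennreal s))) differentiable (at t))"

definition L1 :: "'a measure \<Rightarrow> ('a \<Rightarrow> ennreal) \<Rightarrow> bool" where
  "L1 M f \<longleftrightarrow> f \<in> borel_measurable M \<and> (\<integral>\<^sup>+x. f x \<partial>M) < \<infinity>"

definition hardy :: "(ennreal \<Rightarrow> ennreal) \<Rightarrow> ('a::euclidean_space \<Rightarrow> real) set" where
  "hardy \<psi> =
     {\<rho>. \<exists>\<delta>>0. (SUP r\<in>{0<..<1}.
          \<integral>\<^sup>+\<omega>. \<psi> (ennreal \<delta> * rho_norm \<rho> (r *\<^sub>R \<omega>)) \<partial>surface_measure) < \<infinity>}"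

definition approach_region :: "'a::euclidean_space \<Rightarrow> 'a set" where
  "approach_region \<omega> = (\<Union>t\<in>{0..<1}. whitney_ball (t *\<^sub>R \<omega>))"

definition nt_maximal :: "('a::euclidean_space \<Rightarrow> real) \<Rightarrow> 'a \<Rightarrow> ennreal" where
  "nt_maximal \<rho> \<omega> = (SUP x\<in>approach_region \<omega>. rho_norm \<rho> x)"

definition max_modulus :: "real \<Rightarrow> ('a::euclidean_space \<Rightarrow> real) \<Rightarrow> ennreal" where
  "max_modulus r \<rho> = (SUP x\<in>cball 0 r. rho_norm \<rho> x)"

end

theory Submission
  imports Defs
begin

text \<open>Write \<open>u x = |x|\<^sub>\<rho>\<close> on the open ball; volume growth is used only for \<open>\<rho>\<close>-balls centred at 0.
  The \<open>\<rho>\<close>-length of a path on which \<open>u\<close> runs through a band \<open>{\<alpha> < u < \<beta>}\<close> is at least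
  \<open>\<beta> - \<alpha>\<close>, while the integral of \<open>\<rho>\<^sup>n\<close> over the band is at most \<open>B \<beta>\<^sup>n\<close>. Along radii this yields
  two distributional inequalities. If \<open>M(r) \<le> \<lambda>\<close>, then \<open>u\<close> exceeds \<open>2\<lambda>\<close> only on radii over a set of
  measure \<open>O((1 - r)\<^sup>n\<^sup>-\<^sup>1)\<close>, which gives (4) \<open>\<Longrightarrow>\<close> (3). If \<open>M(r) > \<lambda>\<close>, then, since crossing many dyadic
  bands is unlikely when \<open>n \<ge> 2\<close>, \<open>u\<close> stays above \<open>c\<lambda>\<close> on the outer part of the radii over a set of
  measure at least \<open>c'(1 - r)\<^sup>n\<^sup>-\<^sup>1\<close>, which gives (1) \<open>\<Longrightarrow>\<close> (4) and, for radial limits in place of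
  \<open>|\<omega>|\<^sub>\<rho>\<close>, (2) \<open>\<Longrightarrow>\<close> (4). Finally \<open>|\<omega>|\<^sub>\<rho>\<close> dominates the upper radial limit of \<open>u\<close> at every \<open>\<omega>\<close>: the
  finite energy of a band tends to 0 near \<open>\<omega>\<close>, whereas a curve ending at \<open>\<omega>\<close> with \<open>u \<le> \<mu>\<close> and balls
  nearby with \<open>u > \<mu> + \<epsilon>\<close> would force a definite energy at every scale. Equality holds almost
  everywhere because almost every radius on which \<open>u\<close> is bounded has finite \<open>\<rho>\<close>-length.\<close>

section \<open>Arc length and arc integrals\<close>

text \<open>No doubling condition is imposed on the growth function, so a constant factor in front
  of |x|_\<rho> can only be moved into the scale \<delta>. Every estimate is therefore an inequality
  between measures of superlevel sets, with one factor on the level and another on the measure,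
  valid beyond some level \<open>l0\<close>; lower levels contribute at most a finite value of
  \<psi> times the total mass. The weight in (4) gives the interval from r to 1 a mass comparable to
  (1 - r)^(n-1), the size of a cap of radius 1 - r, which links (4) to the sphere. Two obstacles
  remain at the boundary. Measurability of |\<omega>|_\<rho>, an infimum over uncountably many
  curves, is not evident; it is obtained from a Borel function, the upper limit along a fixed
  sequence of radii, and completeness of the measure. And a curve may reach \<omega> tangentially,
  out of reach of estimates along radii; but it meets all hyperplanes orthogonal to a suitable axis
  between two of its points, and segments inside them form the family for the energy estimate. The
  pointwise bound g <= \<theta> + g^n / \<theta>^(n-1) plays the part of Hoelder's
  inequality.\<close>

lemma ennreal_Sup_add_le:
  fixes A B :: "ennreal set"
  assumes "A \<noteq> {}" "B \<noteq> {}" "\<And>x y. x \<in> A \<Longrightarrow> y \<in> B \<Longrightarrow> x + y \<le> c"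
  shows "Sup A + Sup B \<le> c"
proof -
  have *: "Sup A + y \<le> c" if "y \<in> B" for y
  proof -
    have "(SUP x\<in>A. x) + y = (SUP x\<in>A. x + y)"
      by (rule ennreal_SUP_add_left[symmetric, OF assms(1)])
    also have "\<dots> \<le> c" by (rule SUP_least) (use assms(3) that in auto)
    finally show ?thesis by simp
  qed
  have "Sup A + (SUP y\<in>B. y) = (SUP y\<in>B. Sup A + y)"
    by (subst (1 2) add.commute) (rule ennreal_SUP_add_left[symmetric, OF assms(2)])
  also have "\<dots> \<le> c" by (rule SUP_least) (use * in auto)
  finally show ?thesis by simp
qed

lemma arc_length_sum_le:
  assumes "mono t" "range t \<subseteq> {a..b}"
  shows "(\<Sum>i<m. ennreal (dist (\<gamma> (t i)) (\<gamma> (t (Suc i))))) \<le> arc_length \<gamma> a b"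
  unfolding arc_length_def using assms by (intro Sup_upper) blast

lemma arc_length_leI:
  assumes "\<And>m t. mono t \<Longrightarrow> range t \<subseteq> {a..b} \<Longrightarrow>
    (\<Sum>i<m::nat. ennreal (dist (\<gamma> (t i)) (\<gamma> (t (Suc i))))) \<le> c"
  shows "arc_length \<gamma> a b \<le> c"
  unfolding arc_length_def using assms by (intro Sup_least) blast

lemma arc_length_cong:
  assumes "\<And>t. a \<le> t \<Longrightarrow> t \<le> b \<Longrightarrow> \<gamma> t = \<gamma>' t"
  shows "arc_length \<gamma> a b = arc_length \<gamma>' a b"
proof -
  have *: "arc_length \<gamma> a b \<le> arc_length \<gamma>' a b"
    if "\<And>t. a \<le> t \<Longrightarrow> t \<le> b \<Longrightarrow> \<gamma> t = \<gamma>' t" for \<gamma> \<gamma>' :: "real \<Rightarrow> 'a"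
  proof (rule arc_length_leI)
    fix m and t :: "nat \<Rightarrow> real" assume t: "mono t" "range t \<subseteq> {a..b}"
    have "\<gamma> (t i) = \<gamma>' (t i)" for i using that t(2) by (auto simp: image_subset_iff)
    with arc_length_sum_le[OF t, where \<gamma>=\<gamma>' and m=m]
    show "(\<Sum>i<m. ennreal (dist (\<gamma> (t i)) (\<gamma> (t (Suc i))))) \<le> arc_length \<gamma>' a b" by simp
  qed
  show ?thesis using assms by (intro antisym *) auto
qed

lemma dist_le_arc_length:
  assumes "a \<le> b"
  shows "ennreal (dist (\<gamma> a) (\<gamma> b)) \<le> arc_length \<gamma> a b"
proof -
  have "range (\<lambda>i::nat. if i = 0 then a else b) \<subseteq> {a..b}" using assms by auto
  moreover have "mono (\<lambda>i::nat. if i = 0 then a else b)" using assms by (auto simp: mono_def)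
  ultimately show ?thesis
    using arc_length_sum_le[of "\<lambda>i. if i = 0 then a else b" a b \<gamma> 1] by simp
qed

lemma arc_length_add:
  assumes "a \<le> b" "b \<le> c"
  shows "arc_length \<gamma> a c = arc_length \<gamma> a b + arc_length \<gamma> b c"
proof (rule antisym)
  show "arc_length \<gamma> a c \<le> arc_length \<gamma> a b + arc_length \<gamma> b c"
  proof (rule arc_length_leI)
    fix m and t :: "nat \<Rightarrow> real" assume t: "mono t" "range t \<subseteq> {a..c}"
    \<comment> \<open>Clamping a partition at \<open>b\<close> from above and from below yields
      partitions of the two halves; only a step that straddles \<open>b\<close> needs the triangle
      inequality, through \<open>\<gamma> b\<close>.\<close>
    let ?s = "\<lambda>i. min (t i) b" and ?v = "\<lambda>i. max (t i) b"
    have step: "t i \<le> t (Suc i)" for i using t(1) by (simp add: mono_def)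
    have "dist (\<gamma> (t i)) (\<gamma> (t (Suc i)))
        \<le> dist (\<gamma> (?s i)) (\<gamma> (?s (Suc i))) + dist (\<gamma> (?v i)) (\<gamma> (?v (Suc i)))" for i
      using step[of i] dist_triangle[of "\<gamma> (t i)" "\<gamma> (t (Suc i))" "\<gamma> b"]
      by (auto simp: min_def max_def)
    then have "ennreal (dist (\<gamma> (t i)) (\<gamma> (t (Suc i))))
        \<le> ennreal (dist (\<gamma> (?s i)) (\<gamma> (?s (Suc i)))) + ennreal (dist (\<gamma> (?v i)) (\<gamma> (?v (Suc i))))" for i
      by (metis ennreal_leI ennreal_plus zero_le_dist)
    then have "(\<Sum>i<m. ennreal (dist (\<gamma> (t i)) (\<gamma> (t (Suc i)))))
        \<le> (\<Sum>i<m. ennreal (dist (\<gamma> (?s i)) (\<gamma> (?s (Suc i))))) + (\<Sum>i<m. ennreal (dist (\<gamma> (?v i)) (\<gamma> (?v (Suc i)))))"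
      unfolding sum.distrib[symmetric] by (intro sum_mono)
    also have "\<dots> \<le> arc_length \<gamma> a b + arc_length \<gamma> b c"
    proof (intro add_mono arc_length_sum_le)
      show "mono ?s" "mono ?v"
        using monoD[OF t(1)] by (auto intro!: monoI min.mono max.mono)
      show "range ?s \<subseteq> {a..b}" "range ?v \<subseteq> {b..c}"
        using t(2) assms by (auto simp: image_subset_iff min_le_iff_disj le_max_iff_disj)
    qed
    finally show "(\<Sum>i<m. ennreal (dist (\<gamma> (t i)) (\<gamma> (t (Suc i))))) \<le> arc_length \<gamma> a b + arc_length \<gamma> b c" .
  qed
  let ?A = "\<lambda>a b. {(\<Sum>i<m. ennreal (dist (\<gamma> (t i)) (\<gamma> (t (Suc i))))) | m t. mono t \<and> range t \<subseteq> {a..b}}"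
  have ne: "?A a b \<noteq> {}" if "a \<le> b" for a b
  proof -
    have "(\<Sum>i<0. ennreal (dist (\<gamma> ((\<lambda>_. a) i)) (\<gamma> ((\<lambda>_. a) (Suc i))))) \<in> ?A a b"
      using that by (intro CollectI exI[of _ 0] exI[of _ "\<lambda>_. a"]) (auto simp: mono_def)
    then show ?thesis by blast
  qed
  have "Sup (?A a b) + Sup (?A b c) \<le> arc_length \<gamma> a c"
  proof (rule ennreal_Sup_add_le[OF ne[OF assms(1)] ne[OF assms(2)]])
    fix x y assume "x \<in> ?A a b" "y \<in> ?A b c"
    then obtain m t n s where t: "mono t" "range t \<subseteq> {a..b}" and s: "mono s" "range s \<subseteq> {b..c}"
      and x: "x = (\<Sum>i<m. ennreal (dist (\<gamma> (t i)) (\<gamma> (t (Suc i)))))"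
      and y: "y = (\<Sum>i<n. ennreal (dist (\<gamma> (s i)) (\<gamma> (s (Suc i)))))" by blast
    \<comment> \<open>The two partitions are joined with a shift by \<open>Suc m\<close>, so index
      \<open>m\<close> carries an extra step from \<open>t m\<close> to \<open>s 0\<close>. That
      step is left out of the sum below, which therefore is at most the full sum.\<close>
    define w where "w i = (if i \<le> m then t i else s (i - Suc m))" for i
    have bnd: "a \<le> t k" "t k \<le> b" "b \<le> s k" "s k \<le> c" for k
      using t(2) s(2) by (auto simp: image_subset_iff)
    have ts: "t i \<le> s j" for i j using bnd(2)[of i] bnd(3)[of j] by simp
    have "w i \<le> w j" if "i \<le> j" for i j
      using monoD[OF t(1) that] monoD[OF s(1), of "i - Suc m" "j - Suc m"] ts that
      by (auto simp: w_def diff_le_mono)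
    then have "mono w" by (rule monoI)
    moreover have "w i \<in> {a..c}" for i
      using bnd[of i] bnd[of "i - Suc m"] assms by (auto simp: w_def)
    ultimately have w: "mono w" "range w \<subseteq> {a..c}" by auto
    have "x = (\<Sum>i<m. ennreal (dist (\<gamma> (w i)) (\<gamma> (w (Suc i)))))"
      unfolding x by (intro sum.cong) (auto simp: w_def)
    moreover have "y = (\<Sum>i\<in>{Suc m..<Suc m + n}. ennreal (dist (\<gamma> (w i)) (\<gamma> (w (Suc i)))))"
      unfolding y by (rule sum.reindex_bij_witness[of _ "\<lambda>i. i - Suc m" "\<lambda>i. i + Suc m"]) (auto simp: w_def)
    ultimately have "x + y = (\<Sum>i\<in>{..<m} \<union> {Suc m..<Suc m + n}. ennreal (dist (\<gamma> (w i)) (\<gamma> (w (Suc i)))))"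
      by (subst sum.union_disjoint) auto
    also have "\<dots> \<le> (\<Sum>i<Suc m + n. ennreal (dist (\<gamma> (w i)) (\<gamma> (w (Suc i)))))"
      by (intro sum_mono2) auto
    also have "\<dots> \<le> arc_length \<gamma> a c" by (rule arc_length_sum_le[OF w])
    finally show "x + y \<le> arc_length \<gamma> a c" .
  qed
  then show "arc_length \<gamma> a b + arc_length \<gamma> b c \<le> arc_length \<gamma> a c"
    by (simp add: arc_length_def)
qed

text \<open>One inequality holds because partitions are carried to partitions; the other is the same
  inequality for the inverse affine map.\<close>

lemma arc_length_affine:
  assumes "\<alpha> > 0"
  shows "arc_length (\<lambda>t. \<gamma> (\<alpha> * t + \<beta>)) a b = arc_length \<gamma> (\<alpha> * a + \<beta>) (\<alpha> * b + \<beta>)"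
proof -
  have *: "arc_length (\<lambda>t. \<gamma> (\<alpha> * t + \<beta>)) a b \<le> arc_length \<gamma> (\<alpha> * a + \<beta>) (\<alpha> * b + \<beta>)"
    if "\<alpha> > 0" for \<gamma> :: "real \<Rightarrow> 'a" and \<alpha> \<beta> a b
  proof (rule arc_length_leI)
    fix m and t :: "nat \<Rightarrow> real" assume t: "mono t" "range t \<subseteq> {a..b}"
    show "(\<Sum>i<m. ennreal (dist (\<gamma> (\<alpha> * t i + \<beta>)) (\<gamma> (\<alpha> * t (Suc i) + \<beta>)))) \<le> arc_length \<gamma> (\<alpha> * a + \<beta>) (\<alpha> * b + \<beta>)"
      by (rule arc_length_sum_le) (use t that in \<open>auto simp: mono_def image_subset_iff\<close>)
  qed
  have e: "\<alpha> * ((1/\<alpha>) * t + (-\<beta>/\<alpha>)) + \<beta> = t" "(1/\<alpha>) * (\<alpha> * t + \<beta>) + (-\<beta>/\<alpha>) = t" for t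
    using assms by (auto simp: field_simps)
  have "arc_length (\<lambda>t. \<gamma> (\<alpha> * ((1/\<alpha>) * t + (-\<beta>/\<alpha>)) + \<beta>)) (\<alpha> * a + \<beta>) (\<alpha> * b + \<beta>)
      \<le> arc_length (\<lambda>t. \<gamma> (\<alpha> * t + \<beta>)) ((1/\<alpha>) * (\<alpha> * a + \<beta>) + (-\<beta>/\<alpha>)) ((1/\<alpha>) * (\<alpha> * b + \<beta>) + (-\<beta>/\<alpha>))"
    using assms by (intro *[where \<gamma>="\<lambda>t. \<gamma> (\<alpha> * t + \<beta>)"]) auto
  then show ?thesis unfolding e using *[OF assms] by (intro antisym) auto
qed

lemma arc_length_mono:
  assumes "a \<le> b" "b \<le> c"
  shows "arc_length \<gamma> a b \<le> arc_length \<gamma> a c"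
  using arc_length_add[OF assms, of \<gamma>] by (simp add: add_increasing2)

text \<open>This is the time inside \<open>arc_length_param\<close>. It is isolated because it is
  monotone in \<open>u\<close>, and measurability follows from that alone.\<close>

definition arc_time :: "(real \<Rightarrow> 'a::metric_space) \<Rightarrow> real \<Rightarrow> real \<Rightarrow> real \<Rightarrow> real" where
  "arc_time \<gamma> a b u = Inf {t \<in> {a..b}. ennreal u \<le> arc_length \<gamma> a t}"

lemma arc_time_mem:
  assumes "a \<le> b" "ennreal u \<le> arc_length \<gamma> a b"
  shows "arc_time \<gamma> a b u \<in> {a..b}"
proof -
  let ?S = "{t \<in> {a..b}. ennreal u \<le> arc_length \<gamma> a t}"
  have "b \<in> ?S" using assms by auto
  then have "?S \<noteq> {}" by blast
  moreover have "bdd_below ?S" by (rule bdd_belowI[of _ a]) auto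
  ultimately have "a \<le> Inf ?S" "Inf ?S \<le> b"
    using \<open>b \<in> ?S\<close> by (auto intro!: cInf_greatest cInf_lower)
  then show ?thesis by (simp add: arc_time_def)
qed

lemma arc_time_le:
  assumes "a \<le> b" "u \<le> v" "ennreal v \<le> arc_length \<gamma> a b"
  shows "arc_time \<gamma> a b u \<le> arc_time \<gamma> a b v"
  unfolding arc_time_def
proof (rule cInf_superset_mono)
  show "{t \<in> {a..b}. ennreal v \<le> arc_length \<gamma> a t} \<noteq> {}" using assms by auto
  show "bdd_below {t \<in> {a..b}. ennreal u \<le> arc_length \<gamma> a t}" by (rule bdd_belowI[of _ a]) auto
  show "{t \<in> {a..b}. ennreal v \<le> arc_length \<gamma> a t} \<subseteq> {t \<in> {a..b}. ennreal u \<le> arc_length \<gamma> a t}"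
    using assms(2) by (auto intro: order_trans ennreal_leI)
qed

lemma arc_length_param_alt: "arc_length_param \<gamma> a b u = \<gamma> (arc_time \<gamma> a b u)"
  by (simp add: arc_length_param_def arc_time_def)

text \<open>A monotone function of \<open>u\<close> is Borel and \<rho> is continuous along the
  curve, so the integrand of \<open>arc_integral\<close> agrees on its interval with a Borel
  function. Additivity of the integral rests on this.\<close>

lemma arc_length_param_measurable:
  fixes \<rho> :: "'a::metric_space \<Rightarrow> real"
  assumes ab: "a \<le> b" and cont: "continuous_on {a..b} (\<lambda>t. \<rho> (\<gamma> t))" and fin: "arc_length \<gamma> a b \<noteq> \<infinity>"
  obtains k :: "real \<Rightarrow> ennreal" where "k \<in> borel_measurable borel"
    "\<And>u. 0 \<le> u \<Longrightarrow> u \<le> enn2real (arc_length \<gamma> a b) \<Longrightarrow> ennreal (\<rho> (arc_length_param \<gamma> a b u)) = k u"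
proof -
  let ?l = "enn2real (arc_length \<gamma> a b)"
  have l: "ennreal ?l = arc_length \<gamma> a b" using fin by (simp add: less_top)
  \<comment> \<open>Constant values outside the interval from 0 to \<open>?l\<close> keep \<tau>
    monotone on the whole line.\<close>
  define \<tau> where "\<tau> u = (if u < 0 then a else if u > ?l then b else arc_time \<gamma> a b u)" for u
  have mem: "arc_time \<gamma> a b u \<in> {a..b}" if "u \<le> ?l" for u
    using that l by (intro arc_time_mem[OF ab]) (metis ennreal_leI)
  have "mono \<tau>"
  proof (rule monoI)
    fix u v :: real assume "u \<le> v"
    then show "\<tau> u \<le> \<tau> v"
      using mem[of u] mem[of v] arc_time_le[OF ab, of u v \<gamma>] ab l unfolding \<tau>_def
      by (auto) (metis ennreal_leI linorder_not_less)
  qed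
  then have m: "\<tau> \<in> borel_measurable borel" by (rule borel_measurable_mono)
  define h where "h t = \<rho> (\<gamma> (max a (min b t)))" for t
  have "continuous_on UNIV ((\<lambda>t. \<rho> (\<gamma> t)) \<circ> (\<lambda>t. max a (min b t)))"
    by (intro continuous_on_compose continuous_intros continuous_on_subset[OF cont]) (use ab in auto)
  then have h: "h \<in> borel_measurable borel"
    unfolding h_def comp_def by (rule borel_measurable_continuous_onI)
  show thesis
  proof
    show "(\<lambda>u. ennreal (h (\<tau> u))) \<in> borel_measurable borel" using h m by measurable
    fix u assume u: "0 \<le> u" "u \<le> ?l"
    then show "ennreal (\<rho> (arc_length_param \<gamma> a b u)) = ennreal (h (\<tau> u))"
      using mem[OF u(2)] by (simp add: arc_length_param_alt \<tau>_def h_def)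
  qed
qed

lemma arc_integral_ge:
  fixes \<rho> :: "'a::metric_space \<Rightarrow> real"
  assumes ab: "a \<le> b" and m: "0 \<le> m" "\<And>t. t \<in> {a..b} \<Longrightarrow> m \<le> \<rho> (\<gamma> t)"
  shows "ennreal m * arc_length \<gamma> a b \<le> arc_integral \<rho> \<gamma> a b"
proof (cases "arc_length \<gamma> a b = \<infinity>")
  case True
  then show ?thesis by (simp add: arc_integral_def)
next
  case False
  let ?l = "enn2real (arc_length \<gamma> a b)"
  have l: "ennreal ?l = arc_length \<gamma> a b" using False by (simp add: less_top)
  have mem: "arc_time \<gamma> a b u \<in> {a..b}" if "u \<le> ?l" for u
    using ennreal_leI[OF that] l by (intro arc_time_mem[OF ab]) simp
  have "ennreal m * arc_length \<gamma> a b = (\<integral>\<^sup>+u\<in>{0..?l}. ennreal m \<partial>lborel)"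
    using l by (simp add: nn_integral_cmult_indicator)
  also have "\<dots> \<le> (\<integral>\<^sup>+u\<in>{0..?l}. ennreal (\<rho> (arc_length_param \<gamma> a b u)) \<partial>lborel)"
    using mem m(2)
    by (intro nn_integral_mono) (auto simp: arc_length_param_alt indicator_def intro!: ennreal_leI)
  finally show ?thesis using False by (simp add: arc_integral_def)
qed

text \<open>Up to the length \<open>?p\<close> of the first piece the arc-length parametrizations of
  the whole curve and of that piece agree; beyond it the one of the whole curve is that of the
  second piece shifted by \<open>?p\<close>. The point \<open>u = ?p\<close> is assigned to the
  first piece alone, hence the half-open interval \<open>{0<..?q}\<close> below, which differs from
  \<open>{0..?q}\<close> by a null set.\<close>

lemma arc_integral_add:
  fixes \<rho> :: "'a::metric_space \<Rightarrow> real"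
  assumes ab: "a \<le> b" and bc: "b \<le> c" and cont: "continuous_on {a..c} (\<lambda>t. \<rho> (\<gamma> t))"
  shows "arc_integral \<rho> \<gamma> a c = arc_integral \<rho> \<gamma> a b + arc_integral \<rho> \<gamma> b c"
proof (cases "arc_length \<gamma> a b = \<infinity> \<or> arc_length \<gamma> b c = \<infinity>")
  case True
  then show ?thesis by (auto simp: arc_integral_def arc_length_add[OF ab bc])
next
  case False
  let ?p = "enn2real (arc_length \<gamma> a b)" and ?q = "enn2real (arc_length \<gamma> b c)"
  have p: "ennreal ?p = arc_length \<gamma> a b" and q: "ennreal ?q = arc_length \<gamma> b c"
    using False by (auto simp: less_top)
  have pq: "arc_length \<gamma> a c = ennreal (?p + ?q)"
    by (simp add: arc_length_add[OF ab bc] p q ennreal_plus)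
  have pq': "enn2real (arc_length \<gamma> a c) = ?p + ?q" unfolding pq by (intro enn2real_ennreal) simp
  have cab: "continuous_on {a..b} (\<lambda>t. \<rho> (\<gamma> t))" and cbc: "continuous_on {b..c} (\<lambda>t. \<rho> (\<gamma> t))"
    using ab bc by (auto intro: continuous_on_subset[OF cont])
  obtain k where k: "k \<in> borel_measurable borel"
    "\<And>u. 0 \<le> u \<Longrightarrow> u \<le> ?p \<Longrightarrow> ennreal (\<rho> (arc_length_param \<gamma> a b u)) = k u"
    using arc_length_param_measurable[of a b \<rho> \<gamma>] ab cab False by blast
  obtain h where h: "h \<in> borel_measurable borel"
    "\<And>u. 0 \<le> u \<Longrightarrow> u \<le> ?q \<Longrightarrow> ennreal (\<rho> (arc_length_param \<gamma> b c u)) = h u"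
    using arc_length_param_measurable[of b c \<rho> \<gamma>] bc cbc False by blast
  have 1: "arc_time \<gamma> a c u = arc_time \<gamma> a b u" if "u \<le> ?p" for u
  proof -
    let ?S = "{t \<in> {a..b}. ennreal u \<le> arc_length \<gamma> a t}" and ?T = "{t \<in> {a..c}. ennreal u \<le> arc_length \<gamma> a t}"
    have bS: "b \<in> ?S" using ennreal_leI[OF that] p ab by simp
    show ?thesis unfolding arc_time_def
    proof (rule cInf_eq_non_empty)
      show "?T \<noteq> {}" using bS bc by auto
      have bd: "bdd_below ?S" by (rule bdd_belowI[of _ a]) auto
      show "Inf ?S \<le> x" if "x \<in> ?T" for x
      proof (cases "x \<le> b")
        case True then show ?thesis using that bd by (intro cInf_lower) auto
      next
        case False
        then show ?thesis using cInf_lower[OF bS bd] by auto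
      qed
      show "y \<le> Inf ?S" if "\<And>x. x \<in> ?T \<Longrightarrow> y \<le> x" for y
        using bS bc that by (intro cInf_greatest) auto
    qed
  qed
  have 2: "arc_time \<gamma> a c u = arc_time \<gamma> b c (u - ?p)" if "?p < u" for u
  proof -
    have "t \<in> {a..c} \<and> ennreal u \<le> arc_length \<gamma> a t \<longleftrightarrow> t \<in> {b..c} \<and> ennreal (u - ?p) \<le> arc_length \<gamma> b t" for t
    proof (cases "t < b")
      case True
      have "\<not> ennreal u \<le> arc_length \<gamma> a t" if "a \<le> t"
      proof -
        have "arc_length \<gamma> a t \<le> ennreal ?p" using True that arc_length_mono[of a t b \<gamma>] by (simp add: p)
        also have "\<dots> < ennreal u" using \<open>?p < u\<close> by (simp add: ennreal_less_iff)
        finally show ?thesis by simp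
      qed
      then show ?thesis using True by auto
    next
      case False
      have "ennreal u = ennreal ?p + ennreal (u - ?p)"
        using \<open>?p < u\<close> by (simp flip: ennreal_plus)
      moreover have "arc_length \<gamma> a t = ennreal ?p + arc_length \<gamma> b t"
        unfolding p using False ab by (intro arc_length_add) auto
      moreover have "ennreal ?p \<noteq> top" by simp
      ultimately have "ennreal u \<le> arc_length \<gamma> a t \<longleftrightarrow> ennreal (u - ?p) \<le> arc_length \<gamma> b t"
        by (metis ennreal_add_left_cancel_le infinity_ennreal_def)
      then show ?thesis using False ab by auto
    qed
    then show ?thesis unfolding arc_time_def by meson
  qed
  have meas: "(\<lambda>u. k u * indicator {0..P} u) \<in> borel_measurable lborel"
    "(\<lambda>u. h (u - P) * indicator {0<..Q} (u - P)) \<in> borel_measurable lborel" for P Q :: real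
    using k(1) h(1) by measurable
  have F: "ennreal (\<rho> (arc_length_param \<gamma> a c u)) * indicator {0..?p + ?q} u
      = k u * indicator {0..?p} u + h (u - ?p) * indicator {0<..?q} (u - ?p)" for u
    using k(2)[of u] h(2)[of "u - ?p"] 1[of u] 2[of u]
      enn2real_nonneg[of "arc_length \<gamma> a b"] enn2real_nonneg[of "arc_length \<gamma> b c"]
    by (auto simp: arc_length_param_alt indicator_def simp del: enn2real_nonneg)
  have "arc_length \<gamma> a c \<noteq> \<infinity>" unfolding pq by simp
  then have "arc_integral \<rho> \<gamma> a c = (\<integral>\<^sup>+u\<in>{0..?p + ?q}. ennreal (\<rho> (arc_length_param \<gamma> a c u)) \<partial>lborel)"
    by (simp only: arc_integral_def pq' if_False)
  also have "\<dots> = (\<integral>\<^sup>+u. k u * indicator {0..?p} u + h (u - ?p) * indicator {0<..?q} (u - ?p) \<partial>lborel)"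
    by (simp only: F)
  also have "\<dots> = (\<integral>\<^sup>+u. k u * indicator {0..?p} u \<partial>lborel) + (\<integral>\<^sup>+u. h (u - ?p) * indicator {0<..?q} (u - ?p) \<partial>lborel)"
    by (intro nn_integral_add meas)
  also have "(\<integral>\<^sup>+u. h (u - ?p) * indicator {0<..?q} (u - ?p) \<partial>lborel) = (\<integral>\<^sup>+u. h u * indicator {0<..?q} u \<partial>lborel)"
    using h(1) by (subst nn_integral_real_affine[where c=1 and t="-?p" and f="\<lambda>u. h u * indicator {0<..?q} u"]) auto
  also have "\<dots> = (\<integral>\<^sup>+u. h u * indicator {0..?q} u \<partial>lborel)"
    by (intro nn_integral_cong_AE) (use AE_lborel_singleton[of 0] in \<open>eventually_elim, auto simp: indicator_def\<close>)
  also have "(\<integral>\<^sup>+u. k u * indicator {0..?p} u \<partial>lborel) = arc_integral \<rho> \<gamma> a b"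
    using False k(2) by (auto simp: arc_integral_def indicator_def intro!: nn_integral_cong)
  also have "(\<integral>\<^sup>+u. h u * indicator {0..?q} u \<partial>lborel) = arc_integral \<rho> \<gamma> b c"
    using False h(2) by (auto simp: arc_integral_def indicator_def intro!: nn_integral_cong)
  finally show ?thesis .
qed

lemma arc_integral_cong:
  assumes "a \<le> b" "\<And>t. a \<le> t \<Longrightarrow> t \<le> b \<Longrightarrow> \<gamma> t = \<gamma>' t"
  shows "arc_integral \<rho> \<gamma> a b = arc_integral \<rho> \<gamma>' a b"
proof -
  have l: "arc_length \<gamma> a t = arc_length \<gamma>' a t" if "t \<le> b" for t
    using assms that by (intro arc_length_cong) auto
  have \<tau>: "arc_time \<gamma> a b u = arc_time \<gamma>' a b u" for u
    unfolding arc_time_def by (rule arg_cong[where f=Inf]) (use l in auto)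
  have lb: "arc_length \<gamma> a b = arc_length \<gamma>' a b" using l by simp
  show ?thesis
  proof (cases "arc_length \<gamma>' a b = \<infinity>")
    case False
    then have e: "ennreal (enn2real (arc_length \<gamma>' a b)) = arc_length \<gamma>' a b" by (simp add: less_top)
    have "arc_length_param \<gamma> a b u = arc_length_param \<gamma>' a b u" if "u \<le> enn2real (arc_length \<gamma>' a b)" for u
      using arc_time_mem[OF assms(1), of u \<gamma>'] e ennreal_leI[OF that] assms(2) by (auto simp: arc_length_param_alt \<tau>)
    then show ?thesis unfolding arc_integral_def lb
      by (auto intro!: nn_integral_cong simp: indicator_def)
  qed (simp add: arc_integral_def lb)
qed

text \<open>An increasing affine change of parameter preserves lengths and commutes with the infimum
  that defines \<open>arc_time\<close>, so the point reached after each length is the same.\<close>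

lemma arc_integral_affine:
  assumes "\<alpha> > 0" "a \<le> b"
  shows "arc_integral \<rho> (\<lambda>t. \<gamma> (\<alpha> * t + \<beta>)) a b = arc_integral \<rho> \<gamma> (\<alpha> * a + \<beta>) (\<alpha> * b + \<beta>)"
proof -
  let ?\<phi> = "\<lambda>t. \<alpha> * t + \<beta>" and ?g = "\<lambda>t. \<gamma> (\<alpha> * t + \<beta>)"
  note l = arc_length_affine[OF assms(1), of \<gamma> \<beta> a]
  show ?thesis
  proof (cases "arc_length ?g a b = \<infinity>")
    case False
    then have e: "ennreal (enn2real (arc_length ?g a b)) = arc_length ?g a b" by (simp add: less_top)
    have "arc_time \<gamma> (?\<phi> a) (?\<phi> b) u = ?\<phi> (arc_time ?g a b u)" if "u \<le> enn2real (arc_length ?g a b)" for u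
    proof -
      let ?S = "{t \<in> {a..b}. ennreal u \<le> arc_length ?g a t}"
      have "?\<phi> (Inf ?S) = (INF s\<in>?S. ?\<phi> s)"
      proof (rule continuous_at_Inf_mono)
        show "mono ?\<phi>" using assms(1) by (auto simp: mono_def)
        show "continuous (at_right (Inf ?S)) ?\<phi>" by (intro continuous_intros)
        show "?S \<noteq> {}" using ennreal_leI[OF that] e assms by auto
        show "bdd_below ?S" by (rule bdd_belowI[of _ a]) auto
      qed
      also have "?\<phi> ` ?S = {t \<in> {?\<phi> a..?\<phi> b}. ennreal u \<le> arc_length \<gamma> (?\<phi> a) t}"
      proof (intro equalityI subsetI)
        fix t assume "t \<in> ?\<phi> ` ?S"
        then show "t \<in> {t \<in> {?\<phi> a..?\<phi> b}. ennreal u \<le> arc_length \<gamma> (?\<phi> a) t}"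
          using assms by (auto simp: l)
      next
        fix t assume t: "t \<in> {t \<in> {?\<phi> a..?\<phi> b}. ennreal u \<le> arc_length \<gamma> (?\<phi> a) t}"
        have eq: "t = ?\<phi> ((t - \<beta>) / \<alpha>)" using assms by simp
        have "(t - \<beta>) / \<alpha> \<in> ?S" using t assms l[of "(t - \<beta>) / \<alpha>"] by (auto simp: field_simps)
        then show "t \<in> ?\<phi> ` ?S" using eq by blast
      qed
      finally show ?thesis by (simp add: arc_time_def)
    qed
    then show ?thesis using False
      unfolding arc_integral_def l[symmetric]
      by (auto intro!: nn_integral_cong simp: indicator_def arc_length_param_alt)
  qed (simp add: arc_integral_def l[symmetric])
qed

lemma arc_length_linepath:
  fixes x y :: "'a::real_normed_vector"
  assumes "a \<le> b"
  shows "arc_length (linepath x y) a b = ennreal ((b - a) * norm (y - x))"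
proof -
  have d: "dist (linepath x y s) (linepath x y t) = (t - s) * norm (y - x)" if "s \<le> t" for s t
  proof -
    have "linepath x y s - linepath x y t = (s - t) *\<^sub>R (y - x)"
      by (simp add: linepath_def algebra_simps)
    then show ?thesis using that by (simp add: dist_norm)
  qed
  have "arc_length (linepath x y) a b \<le> ennreal ((b - a) * norm (y - x))"
  proof (rule arc_length_leI)
    fix m and t :: "nat \<Rightarrow> real" assume t: "mono t" "range t \<subseteq> {a..b}"
    have step: "t i \<le> t (Suc i)" for i using t(1) by (simp add: mono_def)
    have "(\<Sum>i<m. ennreal (dist (linepath x y (t i)) (linepath x y (t (Suc i)))))
        = (\<Sum>i<m. ennreal ((t (Suc i) - t i) * norm (y - x)))"
      using d[OF step] by simp
    also have "\<dots> = ennreal (\<Sum>i<m. (t (Suc i) - t i) * norm (y - x))"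
      using step by (intro sum_ennreal) simp
    also have "(\<Sum>i<m. (t (Suc i) - t i) * norm (y - x)) = (t m - t 0) * norm (y - x)"
      by (simp flip: sum_distrib_right add: sum_lessThan_telescope)
    also have "ennreal \<dots> \<le> ennreal ((b - a) * norm (y - x))"
    proof -
      have "t m \<le> b" "a \<le> t 0" using t(2) by (auto simp: image_subset_iff)
      then show ?thesis by (intro ennreal_leI mult_right_mono) auto
    qed
    finally show "(\<Sum>i<m. ennreal (dist (linepath x y (t i)) (linepath x y (t (Suc i))))) \<le> ennreal ((b - a) * norm (y - x))" .
  qed
  moreover have "ennreal ((b - a) * norm (y - x)) \<le> arc_length (linepath x y) a b"
    using dist_le_arc_length[OF assms, of "linepath x y"] d[OF assms] by simp
  ultimately show ?thesis by (rule antisym)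
qed

text \<open>Length grows linearly along a segment, so \<open>arc_time\<close> is
  \<open>a + u / norm (y - x)\<close> and the claim is a linear substitution. The degenerate segment
  is treated first because of this division.\<close>

lemma arc_integral_linepath:
  fixes x y :: "'a::real_normed_vector"
  assumes ab: "a \<le> b" and cont: "continuous_on {a..b} (\<lambda>t. \<rho> (linepath x y t))"
  shows "arc_integral \<rho> (linepath x y) a b
    = ennreal (norm (y - x)) * (\<integral>\<^sup>+t\<in>{a..b}. ennreal (\<rho> (linepath x y t)) \<partial>lborel)"
proof (cases "y = x")
  case True
  have "(\<integral>\<^sup>+u\<in>{0..0}. F u \<partial>lborel) = 0" for F :: "real \<Rightarrow> ennreal"
  proof -
    have "(\<integral>\<^sup>+u\<in>{0..0}. F u \<partial>lborel) = (\<integral>\<^sup>+u. 0 \<partial>(lborel::real measure))"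
      by (intro nn_integral_cong_AE) (use AE_lborel_singleton[of "0::real"] in \<open>eventually_elim, auto simp: indicator_def\<close>)
    then show ?thesis by simp
  qed
  then show ?thesis using True by (simp add: arc_integral_def arc_length_linepath[OF ab])
next
  case False
  let ?d = "norm (y - x)"
  have d: "?d > 0" using False by simp
  define h where "h t = \<rho> (linepath x y (max a (min b t)))" for t
  have "continuous_on UNIV ((\<lambda>t. \<rho> (linepath x y t)) \<circ> (\<lambda>t. max a (min b t)))"
    by (intro continuous_on_compose continuous_intros continuous_on_subset[OF cont]) (use ab in auto)
  then have h: "h \<in> borel_measurable borel"
    unfolding h_def comp_def by (rule borel_measurable_continuous_onI)
  have \<tau>: "arc_time (linepath x y) a b u = a + u / ?d" if "0 \<le> u" "u \<le> (b - a) * ?d" for u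
  proof -
    have "{t \<in> {a..b}. ennreal u \<le> arc_length (linepath x y) a t} = {a + u / ?d..b}"
    proof (rule set_eqI)
      fix t
      have "ennreal u \<le> arc_length (linepath x y) a t \<longleftrightarrow> a + u / ?d \<le> t" if "a \<le> t"
        using that d \<open>0 \<le> u\<close> by (simp add: arc_length_linepath ennreal_le_iff field_simps)
      moreover have "0 \<le> u / ?d" using d \<open>0 \<le> u\<close> by simp
      ultimately show "t \<in> {t \<in> {a..b}. ennreal u \<le> arc_length (linepath x y) a t} \<longleftrightarrow> t \<in> {a + u / ?d..b}"
        by auto
    qed
    moreover have "a + u / ?d \<le> b" using that d by (simp add: field_simps)
    ultimately show ?thesis by (simp add: arc_time_def)
  qed
  have e: "enn2real (arc_length (linepath x y) a b) = (b - a) * ?d"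
    using ab by (simp add: arc_length_linepath)
  have "arc_integral \<rho> (linepath x y) a b = (\<integral>\<^sup>+u\<in>{0..(b - a) * ?d}. ennreal (\<rho> (arc_length_param (linepath x y) a b u)) \<partial>lborel)"
    unfolding arc_integral_def e using ab by (simp add: arc_length_linepath)
  also have "\<dots> = (\<integral>\<^sup>+u. ennreal (h (a + u / ?d)) * indicator {0..(b - a) * ?d} u \<partial>lborel)"
  proof (intro nn_integral_cong)
    fix u
    show "ennreal (\<rho> (arc_length_param (linepath x y) a b u)) * indicator {0..(b - a) * ?d} u
      = ennreal (h (a + u / ?d)) * indicator {0..(b - a) * ?d} u"
    proof (cases "u \<in> {0..(b - a) * ?d}")
      case True
      then have "a \<le> a + u / ?d" "a + u / ?d \<le> b" using d by (auto simp: field_simps)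
      then show ?thesis using True \<tau>[of u] by (simp add: arc_length_param_alt h_def)
    qed simp
  qed
  also have "\<dots> = ennreal ?d * (\<integral>\<^sup>+t. ennreal (h (a + (?d * t - a * ?d) / ?d)) * indicator {0..(b - a) * ?d} (?d * t - a * ?d) \<partial>lborel)"
    using h d by (subst nn_integral_real_affine[where c="?d" and t="- a * ?d"]) (auto simp: algebra_simps)
  also have "(\<integral>\<^sup>+t. ennreal (h (a + (?d * t - a * ?d) / ?d)) * indicator {0..(b - a) * ?d} (?d * t - a * ?d) \<partial>lborel)
      = (\<integral>\<^sup>+t\<in>{a..b}. ennreal (\<rho> (linepath x y t)) \<partial>lborel)"
  proof (intro nn_integral_cong)
    fix t
    have "a + (?d * t - a * ?d) / ?d = t" using d by (simp add: field_simps)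
    moreover have "?d * t - a * ?d \<in> {0..(b - a) * ?d} \<longleftrightarrow> t \<in> {a..b}"
    proof -
      have "?d * t - a * ?d = ?d * (t - a)" "(b - a) * ?d - (?d * t - a * ?d) = ?d * (b - t)"
        by (auto simp: algebra_simps)
      then have "0 \<le> ?d * t - a * ?d \<longleftrightarrow> a \<le> t" "?d * t - a * ?d \<le> (b - a) * ?d \<longleftrightarrow> t \<le> b"
        using d by (metis diff_ge_0_iff_ge zero_le_mult_iff norm_ge_zero not_less)+
      then show ?thesis by auto
    qed
    ultimately show "ennreal (h (a + (?d * t - a * ?d) / ?d)) * indicator {0..(b - a) * ?d} (?d * t - a * ?d)
        = ennreal (\<rho> (linepath x y t)) * indicator {a..b} t"
      by (simp add: indicator_def h_def)
  qed
  finally show ?thesis .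
qed

section \<open>Distances in the ball\<close>

text \<open>Turns a bound on all concatenations of two curves into a bound on the sum of two
  distances.\<close>

lemma ennreal_le_Inf_add:
  fixes A B :: "ennreal set"
  assumes "\<And>x y. x \<in> A \<Longrightarrow> y \<in> B \<Longrightarrow> c \<le> x + y"
  shows "c \<le> Inf A + Inf B"
proof (rule ennreal_le_epsilon)
  fix e :: real assume fin: "Inf A + Inf B < top" and e: "0 < e"
  have lt: "z < z + ennreal (e / 2)" if "z < top" for z :: ennreal
    using that e by (cases z rule: ennreal_cases) (auto simp: ennreal_less_iff simp flip: ennreal_plus)
  have "Inf A < top" "Inf B < top" using fin by (auto simp: ennreal_add_less_top less_top)
  then obtain x y where xy: "x \<in> A" "x < Inf A + ennreal (e / 2)" "y \<in> B" "y < Inf B + ennreal (e / 2)"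
    using lt[of "Inf A"] lt[of "Inf B"] by (auto simp: Inf_less_iff)
  have "c \<le> x + y" using assms xy by blast
  also have "\<dots> \<le> (Inf A + ennreal (e / 2)) + (Inf B + ennreal (e / 2))"
    using xy by (intro add_mono) auto
  also have "\<dots> = Inf A + Inf B + (ennreal (e / 2) + ennreal (e / 2))" by (simp add: ac_simps)
  also have "ennreal (e / 2) + ennreal (e / 2) = ennreal e" using e by (simp flip: ennreal_plus)
  finally show "c \<le> Inf A + Inf B + ennreal e" .
qed

text \<open>Serves to find the first exit of a curve from a ball. The compact set where
  \<open>f\<close> is at least \<open>h\<close> has a least element, and the intermediate value
  theorem forces the value \<open>h\<close> there.\<close>

lemma first_hit:
  fixes f :: "real \<Rightarrow> real"
  assumes c: "continuous_on {0..1} f" and f0: "f 0 < h" and f1: "h \<le> f 1"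
  obtains b where "0 < b" "b \<le> 1" "f b = h" "\<And>t. 0 \<le> t \<Longrightarrow> t \<le> b \<Longrightarrow> f t \<le> h"
proof -
  let ?S = "{0..1} \<inter> f -` {h..}"
  have "closed ?S" by (rule continuous_closed_preimage[OF c]) auto
  then have "compact ?S" by (metis compact_Icc closed_Int_compact inf.left_idem inf_commute)
  moreover have "1 \<in> ?S" using f1 by simp
  ultimately obtain b where b: "b \<in> ?S" "\<And>t. t \<in> ?S \<Longrightarrow> b \<le> t"
    using compact_attains_inf[of ?S] by blast
  have "\<exists>s. 0 \<le> s \<and> s \<le> b \<and> f s = h"
    using b(1) f0 by (intro IVT' continuous_on_subset[OF c]) auto
  then obtain s where s: "0 \<le> s" "s \<le> b" "f s = h" by blast
  then have "b \<le> s" using b(1) by (intro b(2)) auto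
  then have fb: "f b = h" using s by simp
  have "f t \<le> h" if "0 \<le> t" "t \<le> b" for t
  proof (cases "t = b")
    case False
    then have "\<not> b \<le> t" using that by simp
    then show ?thesis using b(2)[of t] that b(1) by force
  qed (use fb in simp)
  moreover have "b \<noteq> 0" using fb f0 by auto
  ultimately show ?thesis using b(1) fb by (intro that[of b]) auto
qed

text \<open>The \<rho>-length of the segment from \<open>x\<close> to \<open>y\<close> in
  constant-speed parametrization. It supplies the upper bounds for distances in all local
  estimates.\<close>

definition seg_length :: "('a::real_normed_vector \<Rightarrow> real) \<Rightarrow> 'a \<Rightarrow> 'a \<Rightarrow> ennreal" where
  "seg_length \<rho> x y = ennreal (norm (y - x)) * (\<integral>\<^sup>+t\<in>{0..1}. ennreal (\<rho> (linepath x y t)) \<partial>lborel)"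

definition inner_curves :: "'a::real_normed_vector \<Rightarrow> 'a \<Rightarrow> (real \<Rightarrow> 'a) set" where
  "inner_curves x y = {g. path g \<and> path_image g \<subseteq> ball 0 1 \<and> pathstart g = x \<and> pathfinish g = y}"

text \<open>Here the curves lie in the open ball together with their endpoints, and the integral
  runs over all of [0,1] instead of compact subcurves. This form behaves well under joining and
  restricting curves; \<open>rho_dist_inner\<close> identifies it with \<open>rho_dist\<close> for
  points of the ball.\<close>

definition inner_dist :: "('a::real_normed_vector \<Rightarrow> real) \<Rightarrow> 'a \<Rightarrow> 'a \<Rightarrow> ennreal" where
  "inner_dist \<rho> x y = (INF g\<in>inner_curves x y. arc_integral \<rho> g 0 1)"

lemma seg_length_le:
  assumes "\<And>t. t \<in> {0..1} \<Longrightarrow> \<rho> (linepath x y t) \<le> m" "0 \<le> m"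
  shows "seg_length \<rho> x y \<le> ennreal (m * norm (y - x))"
proof -
  have "(\<integral>\<^sup>+t\<in>{0..1}. ennreal (\<rho> (linepath x y t)) \<partial>lborel) \<le> (\<integral>\<^sup>+t\<in>{0..1::real}. ennreal m \<partial>lborel)"
    using assms by (intro nn_integral_mono) (auto simp: indicator_def intro!: ennreal_leI)
  also have "\<dots> = ennreal m" by (simp add: nn_integral_cmult_indicator)
  finally have "ennreal (norm (y - x)) * (\<integral>\<^sup>+t\<in>{0..1}. ennreal (\<rho> (linepath x y t)) \<partial>lborel)
      \<le> ennreal (norm (y - x)) * ennreal m" by (rule mult_left_mono) simp
  then show ?thesis
    unfolding seg_length_def by (simp only: ennreal_mult[OF assms(2) norm_ge_zero] mult.commute[of "ennreal m"])
qed

locale ball_density =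
  fixes \<rho> :: "'a::euclidean_space \<Rightarrow> real"
  assumes continuous: "continuous_on (ball 0 1) \<rho>"
    and positive: "x \<in> ball 0 1 \<Longrightarrow> 0 < \<rho> x"
begin

lemma continuous_on_compose_curve:
  assumes "continuous_on S \<gamma>" "\<gamma> ` S \<subseteq> ball 0 1"
  shows "continuous_on S (\<lambda>t. \<rho> (\<gamma> t))"
  using continuous_on_compose2[OF continuous assms] .

lemma linepath_in_ball:
  assumes "x \<in> ball 0 1" "y \<in> ball 0 1" "t \<in> {0..1}"
  shows "linepath x y t \<in> ball (0::'a) 1"
  using convex_ball[of "0::'a" 1] assms by (simp add: linepath_def convex_def)

lemma arc_integral_seg:
  assumes "x \<in> ball 0 1" "y \<in> ball 0 1"
  shows "arc_integral \<rho> (linepath x y) 0 1 = seg_length \<rho> x y"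
  unfolding seg_length_def
  using assms linepath_in_ball
  by (intro arc_integral_linepath continuous_on_compose_curve) auto

lemma inner_dist_le_seg:
  assumes "x \<in> ball 0 1" "y \<in> ball 0 1"
  shows "inner_dist \<rho> x y \<le> seg_length \<rho> x y"
proof -
  have "linepath x y \<in> inner_curves x y"
    using linepath_in_ball[OF assms] unfolding inner_curves_def path_image_def by auto
  then have "inner_dist \<rho> x y \<le> arc_integral \<rho> (linepath x y) 0 1"
    unfolding inner_dist_def by (rule INF_lower)
  then show ?thesis by (simp add: arc_integral_seg[OF assms])
qed

lemma inner_dist_subpath:
  assumes "a \<le> b" "continuous_on {a..b} \<gamma>" "\<gamma> ` {a..b} \<subseteq> ball 0 1"
  shows "inner_dist \<rho> (\<gamma> a) (\<gamma> b) \<le> arc_integral \<rho> \<gamma> a b"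
proof (cases "a = b")
  case True
  then have "\<gamma> a \<in> ball 0 1" using assms by auto
  from inner_dist_le_seg[OF this this] show ?thesis using True by (simp add: seg_length_def)
next
  case False
  let ?g = "\<lambda>s. \<gamma> ((b - a) * s + a)"
  have ab: "b - a > 0" using assms False by simp
  have im: "(b - a) * s + a \<in> {a..b}" if "s \<in> {0..1}" for s
  proof -
    have "(b - a) * s \<le> b - a" "0 \<le> (b - a) * s"
      using mult_left_mono[of s 1 "b - a"] that ab by auto
    then show ?thesis unfolding atLeastAtMost_iff by linarith
  qed
  have "?g \<in> inner_curves (\<gamma> a) (\<gamma> b)"
    unfolding inner_curves_def path_def path_image_def pathstart_def pathfinish_def
    using im assms by (auto intro!: continuous_on_compose2[OF assms(2)] continuous_intros)
  then have "inner_dist \<rho> (\<gamma> a) (\<gamma> b) \<le> arc_integral \<rho> ?g 0 1"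
    unfolding inner_dist_def by (rule INF_lower)
  also have "\<dots> = arc_integral \<rho> \<gamma> ((b - a) * 0 + a) ((b - a) * 1 + a)"
    by (rule arc_integral_affine[OF ab]) simp
  finally show ?thesis by simp
qed

text \<open>The integral starts at a time \<open>a\<close> that may be positive because
  \<open>g\<close> may begin on the sphere, where nothing is known about \<rho>; then only its part
  on \<open>{2 * a..1}\<close> has to lie in the ball.\<close>

lemma arc_integral_inner_join:
  assumes "a \<in> {0..1/2}" "continuous_on {2 * a..1} g" "g ` {2 * a..1} \<subseteq> ball 0 1"
    and h: "path h" "path_image h \<subseteq> ball 0 1" "pathfinish g = pathstart h"
  shows "arc_integral \<rho> (g +++ h) a 1 = arc_integral \<rho> g (2 * a) 1 + arc_integral \<rho> h 0 1"
    and "continuous_on {a..1} (g +++ h)" "(g +++ h) ` {a..1} \<subseteq> ball 0 1"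
proof -
  have eq1: "(g +++ h) t = g (2 * t + 0)" if "t \<le> 1/2" for t
    using that by (simp add: joinpaths_def)
  have eq2: "(g +++ h) t = h (2 * t + (-1))" if "1/2 \<le> t" for t
  proof (cases "t = 1/2")
    case True
    show ?thesis unfolding True using h(3) by (simp add: joinpaths_def pathfinish_def pathstart_def)
  qed (use that in \<open>simp add: joinpaths_def\<close>)
  have c1: "continuous_on {a..1/2} (g +++ h)"
    by (subst continuous_on_cong[OF refl eq1])
       (use assms in \<open>auto intro!: continuous_on_compose2[OF assms(2)] continuous_intros\<close>)
  have c2: "continuous_on {1/2..1} (g +++ h)"
    by (subst continuous_on_cong[OF refl eq2])
       (use h in \<open>auto intro!: continuous_on_compose2[where f="\<lambda>t. 2 * t - 1" and g=h and t="{0..1}"] continuous_intros simp: path_def\<close>)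
  have "{a..1} = {a..1/2} \<union> {1/2..1}" using assms(1) by auto
  then show c: "continuous_on {a..1} (g +++ h)"
    using continuous_on_closed_Un[OF _ _ c1 c2] by simp
  show im: "(g +++ h) ` {a..1} \<subseteq> ball 0 1"
  proof (rule image_subsetI)
    fix t assume t: "t \<in> {a..1}"
    show "(g +++ h) t \<in> ball 0 1"
    proof (cases "t \<le> 1/2")
      case True
      then have "2 * t \<in> {2 * a..1}" using t by auto
      then show ?thesis using eq1[OF True] assms(3) by (auto simp: image_subset_iff)
    next
      case False
      then have "2 * t - 1 \<in> {0..1}" using t by auto
      then show ?thesis using eq2[of t] False h(2) unfolding path_image_def by (auto simp: image_subset_iff)
    qed
  qed
  have "arc_integral \<rho> (g +++ h) a 1 = arc_integral \<rho> (g +++ h) a (1/2) + arc_integral \<rho> (g +++ h) (1/2) 1"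
    using assms(1) by (intro arc_integral_add continuous_on_compose_curve c im) auto
  also have "arc_integral \<rho> (g +++ h) a (1/2) = arc_integral \<rho> (\<lambda>t. g (2 * t + 0)) a (1/2)"
    using assms(1) eq1 by (intro arc_integral_cong) auto
  also have "\<dots> = arc_integral \<rho> g (2 * a + 0) (2 * (1/2) + 0)"
    using assms(1) by (intro arc_integral_affine) auto
  also have "arc_integral \<rho> (g +++ h) (1/2) 1 = arc_integral \<rho> (\<lambda>t. h (2 * t + (-1))) (1/2) 1"
    using eq2 by (intro arc_integral_cong) auto
  also have "\<dots> = arc_integral \<rho> h (2 * (1/2) + (-1)) (2 * 1 + (-1))"
    by (intro arc_integral_affine) auto
  finally show "arc_integral \<rho> (g +++ h) a 1 = arc_integral \<rho> g (2 * a) 1 + arc_integral \<rho> h 0 1"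
    by simp
qed

lemma inner_dist_triangle: "inner_dist \<rho> x z \<le> inner_dist \<rho> x y + inner_dist \<rho> y z"
  unfolding inner_dist_def[of _ x y] inner_dist_def[of _ y z]
proof (rule ennreal_le_Inf_add)
  fix p q assume "p \<in> (\<lambda>g. arc_integral \<rho> g 0 1) ` inner_curves x y" "q \<in> (\<lambda>g. arc_integral \<rho> g 0 1) ` inner_curves y z"
  then obtain g h where g: "g \<in> inner_curves x y" "p = arc_integral \<rho> g 0 1"
    and h: "h \<in> inner_curves y z" "q = arc_integral \<rho> h 0 1" by blast
  have J: "arc_integral \<rho> (g +++ h) 0 1 = p + q"
    using arc_integral_inner_join(1)[of 0 g h] g h
    by (auto simp: inner_curves_def path_def path_image_def)
  have "g +++ h \<in> inner_curves x z"
    using g(1) h(1) by (auto simp: inner_curves_def path_image_join)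
  then have "inner_dist \<rho> x z \<le> arc_integral \<rho> (g +++ h) 0 1"
    unfolding inner_dist_def by (rule INF_lower)
  with J show "inner_dist \<rho> x z \<le> p + q" by simp
qed

lemma seg_length_sym:
  assumes "x \<in> ball 0 1" "y \<in> ball 0 1"
  shows "seg_length \<rho> x y = seg_length \<rho> y x"
proof -
  let ?f = "\<lambda>t. ennreal (\<rho> (linepath x y t)) * indicator {0..1} t"
  have c: "continuous_on {0..1} (\<lambda>t. \<rho> (linepath x y t))"
    using linepath_in_ball[OF assms] by (intro continuous_on_compose_curve) auto
  have "(\<lambda>t. indicator {0..1} t * \<rho> (linepath x y t)) \<in> borel_measurable borel"
    using borel_measurable_continuous_on_indicator[OF _ c] by simp
  then have "(\<lambda>t. ennreal (indicator {0..1} t * \<rho> (linepath x y t))) \<in> borel_measurable borel" by measurable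
  also have "(\<lambda>t. ennreal (indicator {0..1} t * \<rho> (linepath x y t))) = ?f"
    by (auto simp: indicator_def)
  finally have "(\<integral>\<^sup>+t. ?f t \<partial>lborel) = ennreal \<bar>-1\<bar> * (\<integral>\<^sup>+t. ?f (1 + (-1) * t) \<partial>lborel)"
    by (rule nn_integral_real_affine) simp
  also have "(\<integral>\<^sup>+t. ?f (1 + (-1) * t) \<partial>lborel) = (\<integral>\<^sup>+t\<in>{0..1}. ennreal (\<rho> (linepath y x t)) \<partial>lborel)"
    by (intro nn_integral_cong) (auto simp: indicator_def linepath_def algebra_simps)
  finally show ?thesis by (simp add: seg_length_def norm_minus_commute)
qed

text \<open>A factor \<kappa> arbitrarily close to 1, and not merely some Harnack constant, is what
  makes an exact symmetry of the distance provable.\<close>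

lemma local_comparison:
  assumes "x \<in> ball 0 1" "\<kappa> > 1"
  obtains e where "e > 0" "ball x e \<subseteq> ball 0 1"
    "\<And>w. w \<in> ball x e \<Longrightarrow> \<rho> x / \<kappa> \<le> \<rho> w \<and> \<rho> w \<le> \<kappa> * \<rho> x"
proof -
  have p: "\<rho> x > 0" using positive assms by blast
  have "isCont \<rho> x" using continuous assms(1) by (simp add: continuous_on_eq_continuous_at)
  then have t: "(\<rho> \<longlongrightarrow> \<rho> x) (nhds x)" by (simp add: isCont_def tendsto_at_iff_tendsto_nhds)
  have "\<rho> x / \<kappa> < \<rho> x" "\<rho> x < \<kappa> * \<rho> x" using p assms(2) by (auto simp: field_simps)
  then have "eventually (\<lambda>w. \<rho> x / \<kappa> < \<rho> w) (nhds x)" "eventually (\<lambda>w. \<rho> w < \<kappa> * \<rho> x) (nhds x)"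
    using order_tendstoD[OF t] by blast+
  moreover have "eventually (\<lambda>w. w \<in> ball 0 1) (nhds x)" using assms(1) by (intro eventually_nhds_in_open) auto
  ultimately have "eventually (\<lambda>w. \<rho> x / \<kappa> < \<rho> w \<and> \<rho> w < \<kappa> * \<rho> x \<and> w \<in> ball 0 1) (nhds x)"
    by eventually_elim auto
  then obtain e where "e > 0" "\<forall>w. dist w x < e \<longrightarrow> \<rho> x / \<kappa> < \<rho> w \<and> \<rho> w < \<kappa> * \<rho> x \<and> w \<in> ball 0 1"
    unfolding eventually_nhds_metric by blast
  then show ?thesis by (intro that[of e]) (auto simp: dist_commute subset_iff less_imp_le)
qed

lemma seg_length_small:
  assumes "x \<in> ball 0 1" "\<epsilon> > 0"
  obtains d where "d > 0" "\<And>y. dist y x < d \<Longrightarrow> y \<in> ball 0 1 \<and> seg_length \<rho> x y \<le> ennreal \<epsilon> \<and> seg_length \<rho> y x \<le> ennreal \<epsilon>"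
proof -
  obtain e where e: "e > 0" "ball x e \<subseteq> ball 0 1" "\<And>w. w \<in> ball x e \<Longrightarrow> \<rho> x / 2 \<le> \<rho> w \<and> \<rho> w \<le> 2 * \<rho> x"
    using local_comparison[OF assms(1), of 2] by auto
  have p: "\<rho> x > 0" using positive assms by blast
  have "y \<in> ball 0 1 \<and> seg_length \<rho> x y \<le> ennreal \<epsilon> \<and> seg_length \<rho> y x \<le> ennreal \<epsilon>"
    if y: "dist y x < min e (\<epsilon> / (2 * \<rho> x))" for y
  proof -
    have yb: "y \<in> ball x e" using y by (simp add: dist_commute)
    then have y1: "y \<in> ball 0 1" using e by blast
    have "linepath x y t \<in> ball x e" if "t \<in> {0..1}" for t
      using convex_ball[of x e] that yb e(1) by (simp add: linepath_def convex_def)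
    then have "seg_length \<rho> x y \<le> ennreal (2 * \<rho> x * norm (y - x))"
      using e(3) p by (intro seg_length_le) auto
    also have "\<dots> \<le> ennreal \<epsilon>"
      using y p by (intro ennreal_leI) (simp add: dist_norm field_simps)
    finally show ?thesis using y1 seg_length_sym[OF assms(1) y1] by simp
  qed
  then show ?thesis using e(1) p assms(2) by (intro that[of "min e (\<epsilon> / (2 * \<rho> x))"]) auto
qed

text \<open>\<open>arc_length_param\<close> runs through a curve in one direction, so the integral
  over the reversed curve is not compared directly. Instead short arcs are replaced by chords run
  backwards: near a point \<rho> varies by a factor of at most \<kappa> in either direction, which
  costs one \<kappa> for the chord and one for the arc.\<close>

lemma inner_dist_reverse_subpath:
  assumes ab: "a \<le> b" and c: "continuous_on {a..b} \<gamma>" and im: "\<gamma> ` {a..b} \<subseteq> ball 0 1"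
    and \<kappa>: "\<kappa> > 1"
  shows "inner_dist \<rho> (\<gamma> b) (\<gamma> a) \<le> ennreal (\<kappa> * \<kappa>) * arc_integral \<rho> \<gamma> a b"
proof (cases "arc_length \<gamma> a b = \<infinity>")
  case True
  then show ?thesis using \<kappa> by (simp add: arc_integral_def ennreal_mult_top)
next
  case False
  define P where "P s t \<longleftrightarrow> a \<le> s \<and> s \<le> t \<and> t \<le> b \<longrightarrow>
    inner_dist \<rho> (\<gamma> t) (\<gamma> s) \<le> ennreal (\<kappa> * \<kappa>) * arc_integral \<rho> \<gamma> s t" for s t
  \<comment> \<open>Bisection: the inequality is additive over adjacent intervals and holds on all
    short intervals around each point.\<close>
  have "P a b" using ab
  proof (induction rule: Bolzano)
    case (trans r s t)
    show ?case unfolding P_def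
    proof
      assume *: "a \<le> r \<and> r \<le> t \<and> t \<le> b"
      have "inner_dist \<rho> (\<gamma> t) (\<gamma> r) \<le> inner_dist \<rho> (\<gamma> t) (\<gamma> s) + inner_dist \<rho> (\<gamma> s) (\<gamma> r)"
        by (rule inner_dist_triangle)
      also have "\<dots> \<le> ennreal (\<kappa> * \<kappa>) * arc_integral \<rho> \<gamma> s t + ennreal (\<kappa> * \<kappa>) * arc_integral \<rho> \<gamma> r s"
        using trans * unfolding P_def by (intro add_mono) auto
      also have "\<dots> = ennreal (\<kappa> * \<kappa>) * (arc_integral \<rho> \<gamma> r s + arc_integral \<rho> \<gamma> s t)"
        by (simp add: distrib_left add.commute)
      also have "arc_integral \<rho> \<gamma> r s + arc_integral \<rho> \<gamma> s t = arc_integral \<rho> \<gamma> r t"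
        using * trans im
        by (intro arc_integral_add[symmetric] continuous_on_compose_curve continuous_on_subset[OF c]) auto
      finally show "inner_dist \<rho> (\<gamma> t) (\<gamma> r) \<le> ennreal (\<kappa> * \<kappa>) * arc_integral \<rho> \<gamma> r t" .
    qed
  next
    case (local x)
    then have xb: "\<gamma> x \<in> ball 0 1" using im local by (simp add: image_subset_iff)
    then have p: "\<rho> (\<gamma> x) > 0" by (rule positive)
    obtain e where e: "e > 0" "ball (\<gamma> x) e \<subseteq> ball 0 1"
      "\<And>w. w \<in> ball (\<gamma> x) e \<Longrightarrow> \<rho> (\<gamma> x) / \<kappa> \<le> \<rho> w \<and> \<rho> w \<le> \<kappa> * \<rho> (\<gamma> x)"
      using local_comparison[OF xb \<kappa>] by blast
    obtain d where d: "d > 0" "\<And>t. t \<in> {a..b} \<Longrightarrow> dist t x < d \<Longrightarrow> dist (\<gamma> t) (\<gamma> x) < e"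
      using c local e(1) unfolding continuous_on_iff by (metis atLeastAtMost_iff)
    have "P s t" if st: "s \<le> x \<and> x \<le> t \<and> t - s < d" for s t
      unfolding P_def
    proof
      assume *: "a \<le> s \<and> s \<le> t \<and> t \<le> b"
      have near: "\<gamma> r \<in> ball (\<gamma> x) e" if "r \<in> {s..t}" for r
        using d(2)[of r] that st * by (auto simp: dist_real_def dist_commute)
      have fin: "arc_length \<gamma> s t \<noteq> \<infinity>"
      proof -
        have "arc_length \<gamma> a b = arc_length \<gamma> a s + (arc_length \<gamma> s t + arc_length \<gamma> t b)"
          using * by (subst arc_length_add[of s t b, symmetric]) (auto intro!: arc_length_add)
        then show ?thesis using False by (auto simp: ennreal_add_eq_top)
      qed
      have "linepath (\<gamma> t) (\<gamma> s) r \<in> ball (\<gamma> x) e" if "r \<in> {0..1}" for r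
        using convex_ball[of "\<gamma> x" e] that near[of s] near[of t] * by (simp add: linepath_def convex_def)
      then have "seg_length \<rho> (\<gamma> t) (\<gamma> s) \<le> ennreal (\<kappa> * \<rho> (\<gamma> x) * norm (\<gamma> s - \<gamma> t))"
        using e(3) p \<kappa> by (intro seg_length_le) auto
      also have "\<dots> = ennreal (\<kappa> * \<rho> (\<gamma> x)) * ennreal (dist (\<gamma> s) (\<gamma> t))"
        using p \<kappa> by (simp add: ennreal_mult dist_norm)
      also have "\<dots> \<le> ennreal (\<kappa> * \<rho> (\<gamma> x)) * arc_length \<gamma> s t"
        using * by (intro mult_left_mono dist_le_arc_length) auto
      also have "\<dots> = ennreal (\<kappa> * \<kappa>) * (ennreal (\<rho> (\<gamma> x) / \<kappa>) * arc_length \<gamma> s t)"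
        using p \<kappa> by (simp add: ennreal_mult[symmetric] mult.assoc[symmetric])
      also have "\<dots> \<le> ennreal (\<kappa> * \<kappa>) * arc_integral \<rho> \<gamma> s t"
        using * p \<kappa> near e(3) by (intro mult_left_mono arc_integral_ge) auto
      finally have "seg_length \<rho> (\<gamma> t) (\<gamma> s) \<le> ennreal (\<kappa> * \<kappa>) * arc_integral \<rho> \<gamma> s t" .
      moreover have "inner_dist \<rho> (\<gamma> t) (\<gamma> s) \<le> seg_length \<rho> (\<gamma> t) (\<gamma> s)"
        using im * by (intro inner_dist_le_seg) (auto simp: image_subset_iff simp del: mem_ball)
      ultimately show "inner_dist \<rho> (\<gamma> t) (\<gamma> s) \<le> ennreal (\<kappa> * \<kappa>) * arc_integral \<rho> \<gamma> s t" by simp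
    qed
    then show ?case using d(1) by blast
  qed
  then show ?thesis using ab by (simp add: P_def)
qed

text \<open>The factor \<open>\<kappa> * \<kappa>\<close> of
  \<open>inner_dist_reverse_subpath\<close> tends to 1.\<close>

lemma inner_dist_sym: "inner_dist \<rho> x y = inner_dist \<rho> y x"
proof -
  have *: "inner_dist \<rho> y x \<le> inner_dist \<rho> x y" for x y
    unfolding inner_dist_def[of _ x y]
  proof (rule INF_greatest)
    fix g assume "g \<in> inner_curves x y"
    then have g: "continuous_on {0..1} g" "g ` {0..1} \<subseteq> ball 0 1" "g 0 = x" "g 1 = y"
      by (auto simp: inner_curves_def path_def path_image_def pathstart_def pathfinish_def)
    let ?I = "arc_integral \<rho> g 0 1"
    have lim: "((\<lambda>\<kappa>. ennreal (\<kappa> * \<kappa>) * ?I) \<longlongrightarrow> ennreal (1 * 1) * ?I) (at_right 1)"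
      by (intro tendsto_mult_ennreal tendsto_ennrealI tendsto_intros) auto
    have "inner_dist \<rho> y x \<le> ennreal (1 * 1) * ?I"
      by (rule tendsto_lowerbound[OF lim])
        (use inner_dist_reverse_subpath[OF _ g(1,2)] g(3,4) in \<open>auto simp: eventually_at_filter\<close>)
    then show "inner_dist \<rho> y x \<le> ?I" by simp
  qed
  show ?thesis by (intro antisym *)
qed

lemma arc_integral_mono_interval:
  assumes "a \<le> a'" "a' \<le> b'" "b' \<le> b" "continuous_on {a..b} \<gamma>" "\<gamma> ` {a..b} \<subseteq> ball 0 1"
  shows "arc_integral \<rho> \<gamma> a' b' \<le> arc_integral \<rho> \<gamma> a b"
proof -
  have c: "continuous_on {a..b} (\<lambda>t. \<rho> (\<gamma> t))" using assms by (intro continuous_on_compose_curve)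
  have "arc_integral \<rho> \<gamma> a b = arc_integral \<rho> \<gamma> a a' + arc_integral \<rho> \<gamma> a' b"
    using assms c by (intro arc_integral_add) auto
  moreover have "arc_integral \<rho> \<gamma> a' b = arc_integral \<rho> \<gamma> a' b' + arc_integral \<rho> \<gamma> b' b"
    using assms by (intro arc_integral_add continuous_on_subset[OF c]) auto
  ultimately show ?thesis by (simp add: add_increasing add_increasing2)
qed

text \<open>\<open>rho_length\<close> sees only times below 1, so the curve is left at a time
  \<open>b\<close> close to 1 and the remaining gap to \<open>y\<close> is bridged by a chord of
  \<rho>-length at most \<open>e\<close>.\<close>

lemma rho_length_tail:
  assumes \<gamma>: "\<gamma> \<in> ball_curves \<omega> y" and y: "y \<in> ball 0 1" and s: "0 < s" "s < 1"
  shows "inner_dist \<rho> (\<gamma> s) y \<le> rho_length \<rho> \<gamma>"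
proof (rule ennreal_le_epsilon)
  fix e :: real assume "0 < e"
  obtain d where d: "d > 0" "\<And>z. dist z y < d \<Longrightarrow> z \<in> ball 0 1 \<and> seg_length \<rho> y z \<le> ennreal e \<and> seg_length \<rho> z y \<le> ennreal e"
    using seg_length_small[OF y \<open>0 < e\<close>] by blast
  have c: "continuous_on {0..1} \<gamma>" and y1: "\<gamma> 1 = y" and im: "\<gamma> ` {0<..<1} \<subseteq> ball 0 1"
    using \<gamma> by (auto simp: ball_curves_def path_def pathfinish_def)
  obtain d' where d': "d' > 0" "\<And>t. t \<in> {0..1} \<Longrightarrow> dist t 1 < d' \<Longrightarrow> dist (\<gamma> t) y < d"
    using c d(1) y1 unfolding continuous_on_iff by (metis atLeastAtMost_iff order_refl zero_le_one)
  define b where "b = max s (1 - d' / 2)"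
  have b: "s \<le> b" "b < 1" "dist b 1 < d'" using s d'(1) by (auto simp: b_def dist_real_def)
  have "inner_dist \<rho> (\<gamma> s) y \<le> inner_dist \<rho> (\<gamma> s) (\<gamma> b) + inner_dist \<rho> (\<gamma> b) y"
    by (rule inner_dist_triangle)
  also have "inner_dist \<rho> (\<gamma> s) (\<gamma> b) \<le> arc_integral \<rho> \<gamma> s b"
    using b s im by (intro inner_dist_subpath continuous_on_subset[OF c]) auto
  also have "\<dots> \<le> rho_length \<rho> \<gamma>"
    unfolding rho_length_def using b s by (intro Sup_upper) auto
  also have "inner_dist \<rho> (\<gamma> b) y \<le> ennreal e"
  proof -
    have "dist (\<gamma> b) y < d" using d'(2)[of b] b s by auto
    from d(2)[OF this] inner_dist_le_seg[of "\<gamma> b" y] y show ?thesis by (auto intro: order_trans)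
  qed
  finally show "inner_dist \<rho> (\<gamma> s) y \<le> rho_length \<rho> \<gamma> + ennreal e" by (simp add: add_mono)
qed

lemma rho_length_le_arc_integral:
  assumes "path g" "path_image g \<subseteq> ball 0 1"
  shows "rho_length \<rho> g \<le> arc_integral \<rho> g 0 1"
  unfolding rho_length_def using assms
  by (auto intro!: Sup_least arc_integral_mono_interval simp: path_def path_image_def)

text \<open>For endpoints in the ball the ends of a curve can be replaced by chords of arbitrarily
  small \<rho>-length, so the supremum over compact subcurves leads to the same infimum.\<close>

lemma rho_dist_inner:
  assumes x: "x \<in> ball 0 1" and y: "y \<in> ball 0 1"
  shows "rho_dist \<rho> x y = inner_dist \<rho> x y"
proof (rule antisym)
  show "rho_dist \<rho> x y \<le> inner_dist \<rho> x y"
    unfolding inner_dist_def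
  proof (rule INF_greatest)
    fix g assume g: "g \<in> inner_curves x y"
    then have "g \<in> ball_curves x y" by (auto simp: inner_curves_def ball_curves_def path_image_def)
    then have "rho_dist \<rho> x y \<le> rho_length \<rho> g" unfolding rho_dist_def by (rule INF_lower)
    also have "\<dots> \<le> arc_integral \<rho> g 0 1"
      using g by (intro rho_length_le_arc_integral) (auto simp: inner_curves_def)
    finally show "rho_dist \<rho> x y \<le> arc_integral \<rho> g 0 1" .
  qed
  show "inner_dist \<rho> x y \<le> rho_dist \<rho> x y"
    unfolding rho_dist_def
  proof (rule INF_greatest, rule ennreal_le_epsilon)
    fix \<gamma> and e :: real assume \<gamma>: "\<gamma> \<in> ball_curves x y" and "0 < e"
    obtain d where d: "d > 0" "\<And>z. dist z x < d \<Longrightarrow> z \<in> ball 0 1 \<and> seg_length \<rho> x z \<le> ennreal e \<and> seg_length \<rho> z x \<le> ennreal e"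
      using seg_length_small[OF x \<open>0 < e\<close>] by blast
    have c: "continuous_on {0..1} \<gamma>" and x0: "\<gamma> 0 = x"
      using \<gamma> by (auto simp: ball_curves_def path_def pathstart_def)
    obtain d' where d': "d' > 0" "\<And>t. t \<in> {0..1} \<Longrightarrow> dist t 0 < d' \<Longrightarrow> dist (\<gamma> t) x < d"
      using c d(1) x0 unfolding continuous_on_iff by (metis atLeastAtMost_iff order_refl zero_le_one)
    define a where "a = min (1/2) (d' / 2)"
    have a: "0 < a" "a < 1" "dist a 0 < d'" using d'(1) by (auto simp: a_def dist_real_def)
    have "inner_dist \<rho> x y \<le> inner_dist \<rho> x (\<gamma> a) + inner_dist \<rho> (\<gamma> a) y"
      by (rule inner_dist_triangle)
    also have "inner_dist \<rho> x (\<gamma> a) \<le> ennreal e"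
    proof -
      have "dist (\<gamma> a) x < d" using d'(2)[of a] a by auto
      from d(2)[OF this] inner_dist_le_seg[of x "\<gamma> a"] x show ?thesis by (auto intro: order_trans)
    qed
    also have "inner_dist \<rho> (\<gamma> a) y \<le> rho_length \<rho> \<gamma>" by (rule rho_length_tail[OF \<gamma> y a(1,2)])
    finally show "inner_dist \<rho> x y \<le> rho_length \<rho> \<gamma> + ennreal e" by (simp add: add.commute add_mono)
  qed
qed

text \<open>A curve from \<open>x\<close> to 0 has to reach distance \<open>h\<close> from
  \<open>x\<close>, because \<open>h \<le> norm x\<close>; up to the first such time its Euclidean
  length is at least \<open>h\<close> and the density is at least \<open>m\<close>.\<close>

lemma inner_dist_zero_ge:
  assumes x: "x \<in> ball 0 1" and h: "0 < h" "h \<le> norm x" and m: "0 \<le> m" "\<And>w. w \<in> ball 0 1 \<Longrightarrow> dist x w \<le> h \<Longrightarrow> m \<le> \<rho> w"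
  shows "ennreal (m * h) \<le> inner_dist \<rho> x 0"
  unfolding inner_dist_def
proof (rule INF_greatest)
  fix g assume "g \<in> inner_curves x 0"
  then have g: "continuous_on {0..1} g" "g ` {0..1} \<subseteq> ball 0 1" "g 0 = x" "g 1 = 0"
    by (auto simp: inner_curves_def path_def path_image_def pathstart_def pathfinish_def)
  have "continuous_on {0..1} (\<lambda>t. dist x (g t))" by (intro continuous_intros g)
  then obtain b where b: "0 < b" "b \<le> 1" "dist x (g b) = h" and le: "\<And>t. 0 \<le> t \<Longrightarrow> t \<le> b \<Longrightarrow> dist x (g t) \<le> h"
    using first_hit[of "\<lambda>t. dist x (g t)" h] g h by auto
  have "ennreal (m * h) \<le> ennreal m * ennreal (dist (g 0) (g b))"
    using b m(1) h g(3) by (simp add: ennreal_mult[symmetric])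
  also have "\<dots> \<le> ennreal m * arc_length g 0 b"
    using b by (intro mult_left_mono dist_le_arc_length) auto
  also have "\<dots> \<le> arc_integral \<rho> g 0 b"
  proof (rule arc_integral_ge)
    show "m \<le> \<rho> (g t)" if "t \<in> {0..b}" for t
      using le[of t] that b g(2) by (intro m(2)) (auto simp: image_subset_iff simp del: mem_ball)
  qed (use b m in auto)
  also have "\<dots> \<le> arc_integral \<rho> g 0 1"
    using b g by (intro arc_integral_mono_interval) auto
  finally show "ennreal (m * h) \<le> arc_integral \<rho> g 0 1" .
qed

text \<open>The competing curve runs down the radius from \<omega> to
  \<open>t *\<^sub>R \<omega>\<close> and continues with an arbitrary curve to 0.\<close>

lemma rho_norm_sphere_le:
  assumes \<omega>: "norm \<omega> = 1" and t: "0 \<le> t" "t < 1"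
  shows "rho_norm \<rho> \<omega> \<le> (\<integral>\<^sup>+r\<in>{t..<1}. ennreal (\<rho> (r *\<^sub>R \<omega>)) \<partial>lborel) + rho_norm \<rho> (t *\<^sub>R \<omega>)"
proof -
  let ?x = "t *\<^sub>R \<omega>" and ?J = "\<integral>\<^sup>+r\<in>{t..<1}. ennreal (\<rho> (r *\<^sub>R \<omega>)) \<partial>lborel"
  let ?L = "linepath \<omega> ?x"
  have L: "?L s = (1 - s * (1 - t)) *\<^sub>R \<omega>" for s by (simp add: linepath_def algebra_simps)
  have xb: "?x \<in> ball 0 1" using \<omega> t by simp
  have Lb: "?L s \<in> ball 0 1" if "0 < s" "s \<le> 1" for s
  proof -
    have "s * (1 - t) > 0" "s * (1 - t) \<le> 1" using that t by (auto intro!: mult_le_one)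
    then show ?thesis unfolding L using \<omega> by simp
  qed
  have meas: "(\<lambda>r. ennreal (\<rho> (r *\<^sub>R \<omega>)) * indicator {t..<1} r) \<in> borel_measurable borel"
  proof -
    have "continuous_on {t..<1} (\<lambda>r. \<rho> (r *\<^sub>R \<omega>))"
      using \<omega> t by (intro continuous_on_compose_curve continuous_intros) auto
    then have "(\<lambda>r. indicator {t..<1} r * \<rho> (r *\<^sub>R \<omega>)) \<in> borel_measurable borel"
      using borel_measurable_continuous_on_indicator[of "{t..<1}" "\<lambda>r. \<rho> (r *\<^sub>R \<omega>)"] by simp
    then have "(\<lambda>r. ennreal (indicator {t..<1} r * \<rho> (r *\<^sub>R \<omega>))) \<in> borel_measurable borel" by measurable
    also have "(\<lambda>r. ennreal (indicator {t..<1} r * \<rho> (r *\<^sub>R \<omega>))) = (\<lambda>r. ennreal (\<rho> (r *\<^sub>R \<omega>)) * indicator {t..<1} r)"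
      by (auto simp: indicator_def)
    finally show ?thesis .
  qed
  have seg: "arc_integral \<rho> ?L a 1 \<le> ?J" if a: "0 < a" "a \<le> 1" for a
  proof -
    have "arc_integral \<rho> ?L a 1 = ennreal (norm (?x - \<omega>)) * (\<integral>\<^sup>+s\<in>{a..1}. ennreal (\<rho> (?L s)) \<partial>lborel)"
      using a Lb by (intro arc_integral_linepath continuous_on_compose_curve continuous_intros) auto
    also have "norm (?x - \<omega>) = 1 - t"
    proof -
      have "?x - \<omega> = (t - 1) *\<^sub>R \<omega>" by (simp add: algebra_simps)
      then show ?thesis using \<omega> t by simp
    qed
    also have "ennreal (1 - t) * (\<integral>\<^sup>+s\<in>{a..1}. ennreal (\<rho> (?L s)) \<partial>lborel)
      \<le> ennreal \<bar>- (1 - t)\<bar> * (\<integral>\<^sup>+s. ennreal (\<rho> ((1 + (- (1 - t)) * s) *\<^sub>R \<omega>)) * indicator {t..<1} (1 + (- (1 - t)) * s) \<partial>lborel)"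
    proof (rule mult_mono[OF _ nn_integral_mono])
      fix s
      show "ennreal (\<rho> (?L s)) * indicator {a..1} s \<le> ennreal (\<rho> ((1 + (- (1 - t)) * s) *\<^sub>R \<omega>)) * indicator {t..<1} (1 + (- (1 - t)) * s)"
      proof (cases "s \<in> {a..1}")
        case True
        then have "s * (1 - t) > 0" "s * (1 - t) \<le> 1 * (1 - t)" using a t by (auto intro!: mult_right_mono)
        then show ?thesis using True by (simp add: L algebra_simps)
      qed simp
    qed (use t in auto)
    also have "\<dots> = ?J"
      by (rule nn_integral_real_affine[symmetric, OF meas]) (use t in auto)
    finally show ?thesis .
  qed
  have "rho_norm \<rho> \<omega> \<le> ?J + inner_dist \<rho> ?x 0"
  proof -
    have "rho_norm \<rho> \<omega> \<le> Inf {?J} + Inf ((\<lambda>g. arc_integral \<rho> g 0 1) ` inner_curves ?x 0)"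
    proof (rule ennreal_le_Inf_add)
      fix p q assume "p \<in> {?J}" "q \<in> (\<lambda>g. arc_integral \<rho> g 0 1) ` inner_curves ?x 0"
      then obtain g where p: "p = ?J" and g: "g \<in> inner_curves ?x 0" "q = arc_integral \<rho> g 0 1" by blast
      have g': "path g" "path_image g \<subseteq> ball 0 1" "pathfinish ?L = pathstart g" "pathfinish g = 0"
        using g(1) by (auto simp: inner_curves_def)
      let ?p = "?L +++ g"
      have J: "arc_integral \<rho> ?p a 1 = arc_integral \<rho> ?L (2 * a) 1 + q"
        "continuous_on {a..1} ?p" "?p ` {a..1} \<subseteq> ball 0 1" if "0 < a" "a \<le> 1/2" for a
      proof -
        have L': "continuous_on {2 * a..1} ?L" "?L ` {2 * a..1} \<subseteq> ball 0 1" "a \<in> {0..1/2}"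
          using that Lb by (auto intro!: continuous_intros simp: image_subset_iff)
        note J' = arc_integral_inner_join[OF L'(3,1,2) g'(1,2,3)]
        show "arc_integral \<rho> ?p a 1 = arc_integral \<rho> ?L (2 * a) 1 + q"
          "continuous_on {a..1} ?p" "?p ` {a..1} \<subseteq> ball 0 1" using J' g(2) by auto
      qed
      have "?p \<in> ball_curves \<omega> 0"
      proof -
        have "?p s \<in> ball 0 1" if "0 < s" "s < 1" for s
          using J(3)[of "min s (1/2)"] that by (auto simp: image_subset_iff)
        then show ?thesis using g' by (auto simp: ball_curves_def simp del: mem_ball)
      qed
      then have "rho_norm \<rho> \<omega> \<le> rho_length \<rho> ?p"
        unfolding rho_norm_def rho_dist_def by (rule INF_lower)
      also have "\<dots> \<le> ?J + q"
        unfolding rho_length_def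
      proof (rule Sup_least, clarify)
        fix a b :: real assume ab: "0 < a" "a \<le> b" "b < 1"
        \<comment> \<open>The joining lemma covers starting times up to 1/2, where the radial part
          ends; starting earlier only enlarges the integral.\<close>
        let ?a = "min a (1/2)"
        have "arc_integral \<rho> ?p a b \<le> arc_integral \<rho> ?p ?a 1"
          using ab J(2,3)[of ?a] by (intro arc_integral_mono_interval) auto
        also have "\<dots> = arc_integral \<rho> ?L (2 * ?a) 1 + q" using ab by (intro J) auto
        also have "\<dots> \<le> ?J + q" using ab by (intro add_right_mono seg) auto
        finally show "arc_integral \<rho> ?p a b \<le> ?J + q" .
      qed
      finally show "rho_norm \<rho> \<omega> \<le> p + q" using p by simp
    qed
    then show ?thesis by (simp add: inner_dist_def)
  qed
  then show ?thesis using rho_dist_inner[OF xb, of 0] by (simp add: rho_norm_def)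
qed

end

section \<open>Polar coordinates\<close>

lemma surface_map_measurable:
  "(\<lambda>x::'a::euclidean_space. x /\<^sub>R norm x) \<in>
     measurable (restrict_space lborel (ball 0 1 - {0})) (restrict_space borel (sphere 0 1))"
  by (rule measurable_restrict_space2)
    (auto simp: space_restrict_space intro!: measurable_restrict_space1)

lemma measurable_surface_measure:
  assumes "F \<in> borel_measurable borel"
  shows "F \<in> borel_measurable (surface_measure :: 'a::euclidean_space measure)"
proof -
  have "F \<in> borel_measurable (restrict_space borel (sphere 0 1 :: 'a set))"
    using assms by (rule measurable_restrict_space1)
  then show ?thesis unfolding surface_measure_def
    by (intro measurable_completion) (simp cong: measurable_cong_sets)
qed

lemma sets_surface_measure:
  assumes "A \<in> sets borel" "A \<subseteq> sphere (0::'a::euclidean_space) 1"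
  shows "A \<in> sets surface_measure"
proof -
  have "A \<in> sets (restrict_space borel (sphere (0::'a) 1))"
    using assms by (auto simp: sets_restrict_space)
  then show ?thesis unfolding surface_measure_def by (intro sets_completionI_sets) simp
qed

lemma nn_integral_surface_measure:
  fixes F :: "'a::euclidean_space \<Rightarrow> ennreal"
  assumes F: "F \<in> borel_measurable borel"
  shows "(\<integral>\<^sup>+\<omega>. F \<omega> \<partial>surface_measure) =
    of_nat DIM('a) * (\<integral>\<^sup>+x. F (x /\<^sub>R norm x) * indicator (ball 0 1 - {0}) x \<partial>lborel)"
proof -
  let ?S = "restrict_space borel (sphere 0 1) :: 'a measure"
  have FS: "F \<in> borel_measurable ?S"
    using F by (rule measurable_restrict_space1)
  have "nn_integral (distr (restrict_space lborel (ball 0 1 - {0})) ?S (\<lambda>x. x /\<^sub>R norm x)) F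
      = (\<integral>\<^sup>+x. F (x /\<^sub>R norm x) \<partial>restrict_space lborel (ball 0 1 - {0}))"
    by (rule nn_integral_distr[OF surface_map_measurable]) (use FS in simp)
  then show ?thesis
    unfolding surface_measure_def nn_integral_completion
    by (subst nn_integral_scale_measure) (use FS in \<open>auto simp: nn_integral_restrict_space\<close>)
qed

lemma emeasure_surface_measure_sphere: "emeasure (surface_measure :: 'a::euclidean_space measure) (sphere 0 1) < \<infinity>"
proof -
  have "emeasure (surface_measure :: 'a measure) (sphere 0 1) =
    of_nat DIM('a) * emeasure lborel {t *\<^sub>R \<omega> | t \<omega>. 0 < t \<and> t < 1 \<and> \<omega> \<in> sphere (0::'a) 1}"
    by (rule emeasure_surface_measure) auto
  also have "\<dots> \<le> of_nat DIM('a) * emeasure lborel (ball (0::'a) 1)"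
    by (intro mult_left_mono emeasure_mono) auto
  also have "\<dots> < \<infinity>"
    using emeasure_bounded_finite[OF bounded_ball, of "0::'a" 1]
    by (simp add: ennreal_mult_less_top of_nat_less_top)
  finally show ?thesis .
qed

lemma nn_integral_lborel_scale:
  fixes h :: "'a::euclidean_space \<Rightarrow> ennreal"
  assumes h: "h \<in> borel_measurable borel" and s: "s > 0"
  shows "(\<integral>\<^sup>+y. h (z + s *\<^sub>R y) \<partial>lborel) = ennreal ((1/s) ^ DIM('a)) * (\<integral>\<^sup>+y. h y \<partial>lborel)"
proof -
  have "(\<integral>\<^sup>+y. h y \<partial>lborel) = ennreal (s ^ DIM('a)) * (\<integral>\<^sup>+y. h (z + s *\<^sub>R y) \<partial>lborel)"
    using s h by (subst lborel_affine[of s z])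
      (simp_all add: nn_integral_density nn_integral_distr nn_integral_cmult)
  then have "ennreal ((1/s) ^ DIM('a)) * (\<integral>\<^sup>+y. h y \<partial>lborel)
      = ennreal ((1/s) ^ DIM('a) * s ^ DIM('a)) * (\<integral>\<^sup>+y. h (z + s *\<^sub>R y) \<partial>lborel)"
    using s by (simp add: ennreal_mult mult.assoc)
  also have "(1/s) ^ DIM('a) * s ^ DIM('a) = 1" using s by (simp add: power_mult_distrib[symmetric])
  finally show ?thesis by simp
qed

lemma nn_integral_inverse_power_tail:
  assumes "a > 0" "n > 0"
  shows "(\<integral>\<^sup>+s. ennreal ((1/s) ^ Suc n) * indicator {a<..} s \<partial>lborel) = ennreal ((1/a) ^ n / n)"
proof -
  have "(\<integral>\<^sup>+s. ennreal ((1/s) ^ Suc n) * indicator {a<..} s \<partial>lborel)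
      = (\<integral>\<^sup>+s. ennreal ((1/s) ^ Suc n) * indicator {a..} s \<partial>lborel)"
    by (intro nn_integral_cong_AE) (use AE_lborel_singleton[of a] in \<open>eventually_elim, auto simp: indicator_def\<close>)
  also have "\<dots> = ennreal (0 - (- ((1/a) ^ n / n)))"
  proof (rule nn_integral_FTC_atLeast)
    show "((\<lambda>s. - ((1/s) ^ n / n)) has_real_derivative (1/x) ^ Suc n) (at x)" if "a \<le> x" for x
    proof -
      have x: "x > 0" using assms that by simp
      have d: "((\<lambda>s. 1/s) has_real_derivative - ((1/x)^2)) (at x)"
        using x by (auto intro!: derivative_eq_intros simp: power2_eq_square)
      have "((\<lambda>s. - ((1/s) ^ n / n)) has_real_derivative
          - (real n * (- ((1/x)^2) * (1/x) ^ (n - Suc 0)) / n)) (at x)"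
        by (intro DERIV_minus DERIV_cdivide DERIV_power[OF d])
      also have "- (real n * (- ((1/x)^2) * (1/x) ^ (n - Suc 0)) / n) = (1/x) ^ Suc n"
        using assms(2) by (cases n) (simp_all add: power2_eq_square)
      finally show ?thesis .
    qed
    have "((\<lambda>s::real. (1/s) ^ n) \<longlongrightarrow> 0 ^ n) at_top"
      by (intro tendsto_power tendsto_divide_0[OF tendsto_const] filterlim_at_top_imp_at_infinity filterlim_ident)
    then have "((\<lambda>s. - ((1/s) ^ n / real n)) \<longlongrightarrow> - (0 ^ n / real n)) at_top"
      using assms by (intro tendsto_minus tendsto_divide tendsto_const) auto
    then show "((\<lambda>s. - ((1/s) ^ n / real n)) \<longlongrightarrow> 0) at_top" using assms by (simp add: zero_power)
  qed (use assms in auto)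
  finally show ?thesis by simp
qed

text \<open>The surface measure is given by cones, so the left side is an integral over the unit
  ball of a function that is constant on rays. With \<open>r = s * norm x\<close> on each ray and
  \<open>y = s *\<^sub>R x\<close> in space, the condition \<open>norm x < 1\<close> becomes
  \<open>s > norm y\<close>, and integrating s^(-n-1) over such s leaves |y|^(-n) / n; the factor n
  of the surface measure cancels. The weight on the right is thus the usual Jacobian |y|^(1-n), with
  the value 0 at the origin.\<close>

lemma polar_integral:
  fixes f :: "'a::euclidean_space \<Rightarrow> ennreal"
  assumes f[measurable]: "f \<in> borel_measurable borel"
  shows "(\<integral>\<^sup>+\<omega>. (\<integral>\<^sup>+r\<in>{0<..}. f (r *\<^sub>R \<omega>) \<partial>lborel) \<partial>surface_measure)
    = (\<integral>\<^sup>+y. f y * ennreal (norm y * (1 / norm y) ^ DIM('a)) \<partial>lborel)"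
proof -
  let ?n = "DIM('a)"
  let ?B = "ball 0 1 - {0::'a}"
  define G where "G \<omega> = (\<integral>\<^sup>+r\<in>{0<..}. f (r *\<^sub>R \<omega>) \<partial>lborel)" for \<omega>
  have [measurable]: "G \<in> borel_measurable borel" unfolding G_def by measurable
  have G: "G (x /\<^sub>R norm x) * indicator ?B x
      = (\<integral>\<^sup>+s. f (s *\<^sub>R x) * ennreal (norm x) * indicator ?B x * indicator {0<..} s \<partial>lborel)" for x :: 'a
  proof (cases "x \<in> ?B")
    case True
    then have x: "norm x > 0" by auto
    have "G (x /\<^sub>R norm x) = ennreal \<bar>norm x\<bar> * (\<integral>\<^sup>+s. f ((0 + norm x * s) *\<^sub>R (x /\<^sub>R norm x)) * indicator {0<..} (0 + norm x * s) \<partial>lborel)"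
      unfolding G_def using x by (intro nn_integral_real_affine) auto
    also have "\<dots> = ennreal (norm x) * (\<integral>\<^sup>+s. f (s *\<^sub>R x) * indicator {0<..} s \<partial>lborel)"
    proof -
      have e: "norm x * s * inverse (norm x) = s" for s using x by simp
      show ?thesis
        using x by (intro arg_cong2[where f="(*)"] nn_integral_cong) (auto simp: indicator_def zero_less_mult_iff e)
    qed
    also have "\<dots> = (\<integral>\<^sup>+s. ennreal (norm x) * (f (s *\<^sub>R x) * indicator {0<..} s) \<partial>lborel)"
      by (intro nn_integral_cmult[symmetric]) measurable
    finally show ?thesis using True by (simp add: ac_simps)
  qed simp
  have "(\<integral>\<^sup>+\<omega>. G \<omega> \<partial>surface_measure) = of_nat ?n * (\<integral>\<^sup>+x. G (x /\<^sub>R norm x) * indicator ?B x \<partial>lborel)"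
    by (rule nn_integral_surface_measure) measurable
  also have "(\<integral>\<^sup>+x. G (x /\<^sub>R norm x) * indicator ?B x \<partial>lborel)
      = (\<integral>\<^sup>+x. \<integral>\<^sup>+s. f (s *\<^sub>R x) * ennreal (norm x) * indicator ?B x * indicator {0<..} s \<partial>lborel \<partial>lborel)"
    by (simp only: G)
  also have "\<dots> = (\<integral>\<^sup>+s. \<integral>\<^sup>+x. f (s *\<^sub>R x) * ennreal (norm x) * indicator ?B x * indicator {0<..} s \<partial>lborel \<partial>lborel)"
  proof (rule lborel_pair.Fubini')
    have [measurable]: "?B \<in> sets borel" by simp
    show "(\<lambda>(s, x). f (s *\<^sub>R x) * ennreal (norm x) * indicator ?B x * indicator {0<..} s)
        \<in> borel_measurable (lborel \<Otimes>\<^sub>M lborel)"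
      unfolding measurable_cong_sets[OF sets_pair_measure_cong[OF sets_lborel sets_lborel] refl]
      by measurable
  qed
  also have "\<dots> = (\<integral>\<^sup>+s. \<integral>\<^sup>+y. f y * ennreal (norm y) * (ennreal ((1/s) ^ Suc ?n) * indicator {norm y<..} s) * indicator (UNIV - {0}) y \<partial>lborel \<partial>lborel)"
  proof (rule nn_integral_cong)
    fix s :: real
    show "(\<integral>\<^sup>+x. f (s *\<^sub>R x) * ennreal (norm x) * indicator ?B x * indicator {0<..} s \<partial>lborel)
      = (\<integral>\<^sup>+y. f y * ennreal (norm y) * (ennreal ((1/s) ^ Suc ?n) * indicator {norm y<..} s) * indicator (UNIV - {0}) y \<partial>lborel)"
    proof (cases "s > 0")
      case True
      define h where "h y = f y * ennreal (norm y / s) * indicator {y. norm y < s \<and> y \<noteq> 0} y" for y :: 'a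
      have [measurable]: "h \<in> borel_measurable borel" unfolding h_def by measurable
      have "(\<integral>\<^sup>+x. f (s *\<^sub>R x) * ennreal (norm x) * indicator ?B x * indicator {0<..} s \<partial>lborel)
          = (\<integral>\<^sup>+x. h (0 + s *\<^sub>R x) \<partial>lborel)"
        using True by (intro nn_integral_cong) (auto simp: h_def indicator_def)
      also have "\<dots> = ennreal ((1/s) ^ ?n) * (\<integral>\<^sup>+y. h y \<partial>lborel)"
        using True by (intro nn_integral_lborel_scale) measurable
      also have "\<dots> = (\<integral>\<^sup>+y. ennreal ((1/s) ^ ?n) * h y \<partial>lborel)"
        by (intro nn_integral_cmult[symmetric]) measurable
      also have "\<dots> = (\<integral>\<^sup>+y. f y * ennreal (norm y) * (ennreal ((1/s) ^ Suc ?n) * indicator {norm y<..} s) * indicator (UNIV - {0}) y \<partial>lborel)"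
      proof (intro nn_integral_cong)
        fix y :: 'a
        have "ennreal (norm y / s) * ennreal ((1/s) ^ ?n) = ennreal (norm y) * ennreal ((1/s) ^ Suc ?n)"
          using True by (simp add: ennreal_mult[symmetric])
        then show "ennreal ((1/s) ^ ?n) * h y = f y * ennreal (norm y) * (ennreal ((1/s) ^ Suc ?n) * indicator {norm y<..} s) * indicator (UNIV - {0}) y"
          unfolding h_def indicator_def by (auto simp: ac_simps)
      qed
      finally show ?thesis .
    next
      case False
      have "\<not> norm y < s" for y :: 'a using False norm_ge_zero[of y] by linarith
      then show ?thesis using False by (simp add: indicator_def)
    qed
  qed
  also have "\<dots> = (\<integral>\<^sup>+y. \<integral>\<^sup>+s. f y * ennreal (norm y) * (ennreal ((1/s) ^ Suc ?n) * indicator {norm y<..} s) * indicator (UNIV - {0}) y \<partial>lborel \<partial>lborel)"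
  proof (rule lborel_pair.Fubini'[symmetric])
    let ?k = "\<lambda>p::real \<times> 'a. f (snd p) * ennreal (norm (snd p)) *
      (ennreal ((1 / fst p) ^ Suc ?n) * indicator {p. norm (snd p) < fst p} p) * indicator (UNIV - {0}) (snd p)"
    have [measurable]: "UNIV - {0::'a} \<in> sets borel" by simp
    have k: "?k \<in> borel_measurable (borel \<Otimes>\<^sub>M borel)" by measurable
    have e: "?k = (\<lambda>(s, y). f y * ennreal (norm y) * (ennreal ((1/s) ^ Suc ?n) * indicator {norm y<..} s) * indicator (UNIV - {0}) y)"
      by (auto simp: fun_eq_iff indicator_def)
    show "(\<lambda>(s, y). f y * ennreal (norm y) * (ennreal ((1/s) ^ Suc ?n) * indicator {norm y<..} s) * indicator (UNIV - {0}) y)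
        \<in> borel_measurable (lborel \<Otimes>\<^sub>M lborel)"
      unfolding measurable_cong_sets[OF sets_pair_measure_cong[OF sets_lborel sets_lborel] refl]
      by (rule subst[where P="\<lambda>w. w \<in> borel_measurable (borel \<Otimes>\<^sub>M borel)", OF e k])
  qed
  also have "\<dots> = (\<integral>\<^sup>+y. f y * ennreal (norm y * ((1 / norm y) ^ ?n / ?n)) \<partial>lborel)"
  proof (intro nn_integral_cong)
    fix y :: 'a
    show "(\<integral>\<^sup>+s. f y * ennreal (norm y) * (ennreal ((1/s) ^ Suc ?n) * indicator {norm y<..} s) * indicator (UNIV - {0}) y \<partial>lborel)
      = f y * ennreal (norm y * ((1 / norm y) ^ ?n / ?n))"
    proof (cases "y = 0")
      case False
      then have "(\<integral>\<^sup>+s. f y * ennreal (norm y) * (ennreal ((1/s) ^ Suc ?n) * indicator {norm y<..} s) * indicator (UNIV - {0}) y \<partial>lborel)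
        = f y * ennreal (norm y) * (\<integral>\<^sup>+s. ennreal ((1/s) ^ Suc ?n) * indicator {norm y<..} s \<partial>lborel)"
        by (simp add: nn_integral_cmult)
      also have "(\<integral>\<^sup>+s. ennreal ((1/s) ^ Suc ?n) * indicator {norm y<..} s \<partial>lborel) = ennreal ((1 / norm y) ^ ?n / ?n)"
        using False by (intro nn_integral_inverse_power_tail) auto
      also have "f y * ennreal (norm y) * ennreal ((1 / norm y) ^ ?n / ?n) = f y * ennreal (norm y * ((1 / norm y) ^ ?n / ?n))"
        by (subst ennreal_mult) (auto simp: mult.assoc)
      finally show ?thesis .
    qed simp
  qed
  also have "of_nat ?n * \<dots> = (\<integral>\<^sup>+y. ennreal ?n * (f y * ennreal (norm y * ((1 / norm y) ^ ?n / ?n))) \<partial>lborel)"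
    unfolding ennreal_of_nat_eq_real_of_nat by (intro nn_integral_cmult[symmetric]) measurable
  also have "\<dots> = (\<integral>\<^sup>+y. f y * ennreal (norm y * (1 / norm y) ^ ?n) \<partial>lborel)"
  proof (intro nn_integral_cong)
    fix y :: 'a
    have "ennreal ?n * ennreal (norm y * ((1 / norm y) ^ ?n / ?n)) = ennreal (norm y * (1 / norm y) ^ ?n)"
      by (subst ennreal_mult[symmetric]) auto
    then show "ennreal ?n * (f y * ennreal (norm y * ((1 / norm y) ^ ?n / ?n))) = f y * ennreal (norm y * (1 / norm y) ^ ?n)"
      by (metis mult.left_commute)
  qed
  finally show ?thesis by (simp add: G_def)
qed

text \<open>Where \<open>norm y\<close> exceeds 1/2 the polar Jacobian |y|^(1-n) is at most 2^(n-1);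
  the rest is Chebyshev's inequality on the sphere. The value \<open>c = \<infinity>\<close> is
  allowed and later yields null sets.\<close>

lemma radial_length_area:
  fixes H :: "'a::euclidean_space \<Rightarrow> ennreal"
  assumes H[measurable]: "H \<in> borel_measurable borel" and E[measurable]: "E \<in> sets borel" "E \<subseteq> sphere 0 1"
    and t: "1/2 \<le> t" and c: "\<And>\<omega>. \<omega> \<in> E \<Longrightarrow> c \<le> (\<integral>\<^sup>+r\<in>{t<..<1}. H (r *\<^sub>R \<omega>) \<partial>lborel)"
  shows "c * emeasure surface_measure E \<le> ennreal (2 ^ (DIM('a) - 1)) * (\<integral>\<^sup>+y\<in>ball 0 1. H y \<partial>lborel)"
proof -
  let ?f = "\<lambda>y. H y * indicator {y. t < norm y \<and> norm y < 1} y"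
  have [measurable]: "ball (0::'a) 1 \<in> sets borel" by simp
  have "c * emeasure surface_measure E = (\<integral>\<^sup>+\<omega>. c * indicator E \<omega> \<partial>surface_measure)"
    using E by (simp add: nn_integral_cmult_indicator sets_surface_measure)
  also have "\<dots> \<le> (\<integral>\<^sup>+\<omega>. (\<integral>\<^sup>+r\<in>{0<..}. ?f (r *\<^sub>R \<omega>) \<partial>lborel) \<partial>surface_measure)"
  proof (intro nn_integral_mono)
    fix \<omega> :: 'a
    show "c * indicator E \<omega> \<le> (\<integral>\<^sup>+r\<in>{0<..}. ?f (r *\<^sub>R \<omega>) \<partial>lborel)"
    proof (cases "\<omega> \<in> E")
      case True
      then have "norm \<omega> = 1" using E by auto
      then have "(\<integral>\<^sup>+r\<in>{t<..<1}. H (r *\<^sub>R \<omega>) \<partial>lborel) \<le> (\<integral>\<^sup>+r\<in>{0<..}. ?f (r *\<^sub>R \<omega>) \<partial>lborel)"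
        using t by (intro nn_integral_mono) (auto simp: indicator_def)
      then show ?thesis using c[OF True] True by auto
    qed simp
  qed
  also have "\<dots> = (\<integral>\<^sup>+y. ?f y * ennreal (norm y * (1 / norm y) ^ DIM('a)) \<partial>lborel)"
    by (rule polar_integral) measurable
  also have "\<dots> \<le> (\<integral>\<^sup>+y. ennreal (2 ^ (DIM('a) - 1)) * (H y * indicator (ball 0 1) y) \<partial>lborel)"
  proof (intro nn_integral_mono)
    fix y :: 'a
    show "?f y * ennreal (norm y * (1 / norm y) ^ DIM('a)) \<le> ennreal (2 ^ (DIM('a) - 1)) * (H y * indicator (ball 0 1) y)"
    proof (cases "t < norm y \<and> norm y < 1")
      case True
      then have y: "1/2 < norm y" using t by simp
      have "DIM('a) = Suc (DIM('a) - 1)" by simp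
      then have "norm y * (1 / norm y) ^ DIM('a) = (1 / norm y) ^ (DIM('a) - 1)"
      proof -
        obtain m where "DIM('a) = Suc m" by (metis DIM_positive Suc_pred)
        moreover have "norm y \<noteq> 0" using y by linarith
        ultimately show ?thesis by simp
      qed
      also have "\<dots> \<le> 2 ^ (DIM('a) - 1)" 
      proof (intro power_mono)
        have "norm y > 0" using y by linarith
        then show "1 / norm y \<le> 2" using y by (simp add: divide_le_eq)
      qed simp
      finally show ?thesis using True by (auto simp: mult.commute intro!: mult_left_mono ennreal_leI)
    qed (simp add: indicator_def)
  qed
  also have "\<dots> = ennreal (2 ^ (DIM('a) - 1)) * (\<integral>\<^sup>+y\<in>ball 0 1. H y \<partial>lborel)"
    by (intro nn_integral_cmult) measurable
  finally show ?thesis .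
qed

text \<open>The cone over the cap contains about 1/h disjoint balls of radius h/8, centred on the
  axis at spacing h/4; their total volume is of order h^n / h.\<close>

lemma surface_cap_lower_bound:
  fixes e :: "'a::euclidean_space"
  assumes e: "norm e = 1" and h: "0 < h" "h \<le> 1"
  shows "ennreal (unit_ball_vol DIM('a) / 8 ^ DIM('a) * h ^ (DIM('a) - 1)) \<le> emeasure surface_measure (sphere 0 1 \<inter> ball e h)"
proof -
  let ?n = "DIM('a)" and ?A = "sphere 0 1 \<inter> ball e h"
  define J where "J = nat \<lceil>1 / h\<rceil>"
  define t where "t j = 1/2 + real j * h / 4" for j
  let ?C = "{t *\<^sub>R \<omega> | t \<omega>. 0 < t \<and> t < 1 \<and> \<omega> \<in> ?A}"
  have J: "1 / h \<le> real J" "real J < 1 / h + 1" unfolding J_def using h by (auto simp: of_nat_ceiling) linarith+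
  have tj: "1/2 \<le> t j" "t j + h / 8 \<le> 1" if "j < J" for j
  proof -
    have "real j + 1 \<le> real J" using that by linarith
    then have "real j \<le> 1 / h" using J(2) by linarith
    then have "real j * h \<le> 1" using h by (simp add: field_simps)
    then show "t j + h / 8 \<le> 1" "1/2 \<le> t j" using h by (auto simp: t_def)
  qed
  have sub: "ball (t j *\<^sub>R e) (h / 8) \<subseteq> ?C" if "j < J" for j
  proof
    fix y assume y: "y \<in> ball (t j *\<^sub>R e) (h / 8)"
    note T = tj[OF that]
    have d: "norm (y - t j *\<^sub>R e) < h / 8" using y by (simp add: dist_norm norm_minus_commute)
    have nt: "norm (t j *\<^sub>R e) = t j" using e T by simp
    have n1: "\<bar>norm y - t j\<bar> < h / 8" using norm_triangle_ineq3[of y "t j *\<^sub>R e"] d nt by simp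
    then have ny: "norm y > 0" "norm y < 1" using T h by linarith+
    \<comment> \<open>Passing to the axis point of the same norm costs a second h/8. Since
      \<open>norm y\<close> is at least 1/4, normalizing turns the resulting bound h/4 into
      h.\<close>
    have "norm (y - norm y *\<^sub>R e) \<le> norm (y - t j *\<^sub>R e) + norm ((t j - norm y) *\<^sub>R e)"
      using norm_triangle_ineq[of "y - t j *\<^sub>R e" "(t j - norm y) *\<^sub>R e"] by (simp add: algebra_simps)
    also have "\<dots> < h / 4" using d n1 e by (simp add: abs_minus_commute)
    also have "h / 4 \<le> h * norm y"
    proof -
      have "1/4 \<le> norm y" using n1 T h by linarith
      then show ?thesis using mult_left_mono[of "1/4" "norm y" h] h by simp
    qed
    finally have lt: "norm (y - norm y *\<^sub>R e) < h * norm y" .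
    have "y - norm y *\<^sub>R e = norm y *\<^sub>R (y /\<^sub>R norm y - e)"
      using ny by (simp add: scaleR_diff_right)
    then have "norm (y - norm y *\<^sub>R e) = norm y * norm (y /\<^sub>R norm y - e)"
      by (simp only: norm_scaleR abs_norm_cancel)
    with lt ny(1) have "norm (y /\<^sub>R norm y - e) < h"
      by (metis mult.commute mult_less_cancel_right_pos)
    then have "y /\<^sub>R norm y \<in> ?A" using ny by (simp add: dist_norm norm_minus_commute)
    moreover have "y = norm y *\<^sub>R (y /\<^sub>R norm y)" using ny by simp
    ultimately show "y \<in> ?C" using ny by blast
  qed
  have disj: "disjoint_family_on (\<lambda>j. ball (t j *\<^sub>R e) (h / 8)) {..<J}"
    unfolding disjoint_family_on_def
  proof (intro ballI impI, rule ccontr)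
    fix i j assume ij: "i \<noteq> j" and "ball (t i *\<^sub>R e) (h / 8) \<inter> ball (t j *\<^sub>R e) (h / 8) \<noteq> {}"
    then obtain y where "dist (t i *\<^sub>R e) y < h / 8" "dist (t j *\<^sub>R e) y < h / 8" by auto
    then have "dist (t i *\<^sub>R e) (t j *\<^sub>R e) < h / 4"
      using dist_triangle2[of "t i *\<^sub>R e" "t j *\<^sub>R e" y] by linarith
    moreover have "dist (t i *\<^sub>R e) (t j *\<^sub>R e) = \<bar>t i - t j\<bar>"
      using e by (simp add: dist_norm flip: scaleR_diff_left)
    moreover have "t i - t j = (real i - real j) * (h / 4)" by (simp add: t_def field_simps)
    then have "\<bar>t i - t j\<bar> = \<bar>real i - real j\<bar> * (h / 4)" using h by (simp only: abs_mult)
    moreover have "\<bar>real i - real j\<bar> \<ge> 1" using ij by linarith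
    moreover have "1 * (h / 4) \<le> \<bar>real i - real j\<bar> * (h / 4)"
      using ij h by (intro mult_right_mono) auto
    ultimately show False by linarith
  qed
  have "ennreal (unit_ball_vol ?n / 8 ^ ?n * h ^ (?n - 1)) \<le> ennreal (real J * (unit_ball_vol ?n * (h / 8) ^ ?n))"
  proof (rule ennreal_leI)
    have "?n = Suc (?n - 1)" by simp
    then have "h ^ ?n = h * h ^ (?n - 1)" by (metis power_Suc)
    moreover have "1 \<le> real J * h" using J(1) h by (simp add: field_simps)
    then have "1 * (unit_ball_vol ?n / 8 ^ ?n * h ^ (?n - 1)) \<le> (real J * h) * (unit_ball_vol ?n / 8 ^ ?n * h ^ (?n - 1))"
      using h by (intro mult_right_mono) auto
    ultimately show "unit_ball_vol ?n / 8 ^ ?n * h ^ (?n - 1) \<le> real J * (unit_ball_vol ?n * (h / 8) ^ ?n)"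
      by (simp add: power_divide mult_ac)
  qed
  also have "\<dots> = (\<Sum>j<J. emeasure lborel (ball (t j *\<^sub>R e) (h / 8)))"
    using h by (simp add: emeasure_ball ennreal_mult' ennreal_of_nat_eq_real_of_nat)
  also have "\<dots> = emeasure lborel (\<Union>j<J. ball (t j *\<^sub>R e) (h / 8))"
    using disj by (intro sum_emeasure) auto
  also have "\<dots> \<le> emeasure lborel ?C"
  proof (rule emeasure_mono)
    have "(\<lambda>x::'a. x /\<^sub>R norm x) -` ?A \<inter> (ball 0 1 - {0}) = ?C"
    proof (intro equalityI subsetI)
      fix x assume x: "x \<in> (\<lambda>x. x /\<^sub>R norm x) -` ?A \<inter> (ball 0 1 - {0})"
      then have "x = norm x *\<^sub>R (x /\<^sub>R norm x)" "0 < norm x" "norm x < 1" "x /\<^sub>R norm x \<in> ?A" by auto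
      then show "x \<in> ?C" by blast
    qed auto
    moreover have "(\<lambda>x::'a. x /\<^sub>R norm x) -` ?A \<inter> space borel \<in> sets borel"
      by (rule measurable_sets[of _ borel borel]) auto
    then have "(\<lambda>x::'a. x /\<^sub>R norm x) -` ?A \<inter> space borel \<inter> (ball 0 1 - {0}) \<in> sets borel"
      by (rule sets.Int) simp
    ultimately show "?C \<in> sets lborel" by simp
  qed (use sub in auto)
  also have "\<dots> \<le> of_nat ?n * emeasure lborel ?C"
  proof -
    have "1 * emeasure lborel ?C \<le> of_nat ?n * emeasure lborel ?C"
      by (intro mult_right_mono) (auto simp: ennreal_of_nat_eq_real_of_nat DIM_positive Suc_leI simp flip: ennreal_1)
    then show ?thesis by simp
  qed
  also have "\<dots> = emeasure surface_measure ?A"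
    by (rule emeasure_surface_measure[symmetric]) auto
  finally show ?thesis .
qed

section \<open>Shears and slices\<close>

text \<open>On each of the finitely many sets where \<open>v (z \<bullet> e)\<close> is a fixed
  \<open>w\<close>, the map is the translation by \<open>w\<close>, and orthogonality of
  \<open>w\<close> to \<open>e\<close> makes it preserve that set.\<close>

lemma simple_shear_emeasure:
  fixes e :: "'a::euclidean_space" and v :: "real \<Rightarrow> 'a"
  assumes v[measurable]: "v \<in> borel_measurable borel" and fin: "finite (range v)"
    and orth: "\<And>\<tau>. v \<tau> \<bullet> e = 0" and A[measurable]: "A \<in> sets borel"
  shows "emeasure lborel {z. z + v (z \<bullet> e) \<in> A} = emeasure lborel A"
proof -
  have sing[measurable]: "{w::'a} \<in> sets borel" for w by simp
  let ?P = "\<lambda>w. {z. z + w \<in> A \<and> v (z \<bullet> e) = w}" and ?Q = "\<lambda>w. {z. z \<in> A \<and> v (z \<bullet> e) = w}"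
  have P[measurable]: "?P w \<in> sets borel" and Q[measurable]: "?Q w \<in> sets borel" for w
    by measurable
  have PQ: "emeasure lborel (?P w) = emeasure lborel (?Q w)" if w: "w \<in> range v" for w
  proof -
    have we: "w \<bullet> e = 0" using w orth by auto
    have "emeasure lborel (?Q w) = emeasure (distr lborel borel ((+) w)) (?Q w)"
      by (simp add: lborel_distr_plus)
    also have "\<dots> = emeasure lborel ((+) w -` ?Q w \<inter> space lborel)"
      by (intro emeasure_distr) (use Q in auto)
    also have "(+) w -` ?Q w \<inter> space lborel = ?P w"
      by (auto simp: inner_add_left we add.commute)
    finally show ?thesis by simp
  qed
  have "emeasure lborel {z. z + v (z \<bullet> e) \<in> A} = emeasure lborel (\<Union>w\<in>range v. ?P w)"
    by (rule arg_cong[where f="emeasure lborel"]) auto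
  also have "\<dots> = (\<Sum>w\<in>range v. emeasure lborel (?P w))"
    by (rule sum_emeasure[symmetric]) (use fin P in \<open>auto simp: disjoint_family_on_def\<close>)
  also have "\<dots> = (\<Sum>w\<in>range v. emeasure lborel (?Q w))"
    using PQ by (rule sum.cong[OF refl])
  also have "\<dots> = emeasure lborel (\<Union>w\<in>range v. ?Q w)"
    by (rule sum_emeasure) (use fin Q in \<open>auto simp: disjoint_family_on_def\<close>)
  also have "(\<Union>w\<in>range v. ?Q w) = A" by auto
  finally show ?thesis .
qed

lemma shear_measurable:
  fixes e :: "'a::euclidean_space" and v :: "real \<Rightarrow> 'a"
  assumes [measurable]: "v \<in> borel_measurable borel"
  shows "(\<lambda>z. z + v (z \<bullet> e)) \<in> borel_measurable borel"
  by measurable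

text \<open>Passage to the limit from finitely valued \<open>v\<close>. The indicator of an open set
  is lower semicontinuous, so Fatou's lemma gives the inequality.\<close>

lemma shear_emeasure_open_le:
  fixes e :: "'a::euclidean_space" and v :: "real \<Rightarrow> 'a"
  assumes v[measurable]: "v \<in> borel_measurable borel" and e: "norm e = 1"
    and orth: "\<And>\<tau>. v \<tau> \<bullet> e = 0" and U: "open U"
  shows "emeasure lborel {z. z + v (z \<bullet> e) \<in> U} \<le> emeasure lborel U"
proof -
  obtain F where F: "\<And>i. simple_function borel (F i)" "\<And>\<tau>. (\<lambda>i. F i \<tau>) \<longlonglongrightarrow> v \<tau>"
    using borel_measurable_implies_sequence_metric[OF v, of 0] by (auto simp: space_borel)
  \<comment> \<open>Removing the component along \<open>e\<close> keeps the approximations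
    orthogonal to \<open>e\<close> and leaves their limit unchanged, because \<open>v\<close> is
    already orthogonal.\<close>
  define w where "w i \<tau> = F i \<tau> - (F i \<tau> \<bullet> e) *\<^sub>R e" for i \<tau>
  have ee: "e \<bullet> e = 1" using e by (simp add: dot_square_norm)
  have w_orth: "w i \<tau> \<bullet> e = 0" for i \<tau> by (simp add: w_def inner_diff_left ee)
  have [measurable]: "F i \<in> borel_measurable borel" for i using F(1) by (rule borel_measurable_simple_function)
  have w_meas[measurable]: "w i \<in> borel_measurable borel" for i unfolding w_def by measurable
  have w_fin: "finite (range (w i))" for i
  proof -
    have "finite (range (F i))" using simple_functionD(1)[OF F(1)[of i]] by simp
    then have "finite ((\<lambda>x. x - (x \<bullet> e) *\<^sub>R e) ` range (F i))" by (rule finite_imageI)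
    then show ?thesis by (simp add: w_def image_image)
  qed
  have w_lim: "(\<lambda>i. w i \<tau>) \<longlonglongrightarrow> v \<tau>" for \<tau>
  proof -
    have "(\<lambda>i. w i \<tau>) \<longlonglongrightarrow> v \<tau> - (v \<tau> \<bullet> e) *\<^sub>R e" unfolding w_def by (intro tendsto_intros F(2))
    then show ?thesis by (simp add: orth)
  qed
  have Ub[measurable]: "U \<in> sets borel" using U by simp
  have pt: "indicator U (z + v (z \<bullet> e)) \<le> liminf (\<lambda>i. indicator U (z + w i (z \<bullet> e)) :: ennreal)" for z
  proof (cases "z + v (z \<bullet> e) \<in> U")
    case True
    have "(\<lambda>i. z + w i (z \<bullet> e)) \<longlonglongrightarrow> z + v (z \<bullet> e)" by (intro tendsto_intros w_lim)
    then have "eventually (\<lambda>i. z + w i (z \<bullet> e) \<in> U) sequentially"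
      using U True by (rule topological_tendstoD)
    then have "eventually (\<lambda>i. (1::ennreal) \<le> indicator U (z + w i (z \<bullet> e))) sequentially"
      by eventually_elim simp
    then have "1 \<le> liminf (\<lambda>i. indicator U (z + w i (z \<bullet> e)) :: ennreal)"
      by (rule Liminf_bounded)
    then show ?thesis using True by simp
  qed simp
  have "emeasure lborel {z. z + v (z \<bullet> e) \<in> U} = (\<integral>\<^sup>+z. indicator U (z + v (z \<bullet> e)) \<partial>lborel)"
  proof -
    have m: "{z. z + v (z \<bullet> e) \<in> U} \<in> sets lborel"
      using measurable_sets[OF shear_measurable[OF v, of e] Ub] by (simp add: vimage_def)
    have "(\<lambda>z. indicator U (z + v (z \<bullet> e)) :: ennreal) = indicator {z. z + v (z \<bullet> e) \<in> U}"
      by (auto simp: indicator_def)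
    then show ?thesis using m by simp
  qed
  also have "\<dots> \<le> (\<integral>\<^sup>+z. liminf (\<lambda>i. indicator U (z + w i (z \<bullet> e))) \<partial>lborel)"
    by (intro nn_integral_mono pt)
  also have "\<dots> \<le> liminf (\<lambda>i. \<integral>\<^sup>+z. indicator U (z + w i (z \<bullet> e)) \<partial>lborel)"
    by (rule nn_integral_liminf) measurable
  also have "(\<lambda>i. \<integral>\<^sup>+z. indicator U (z + w i (z \<bullet> e)) \<partial>lborel) = (\<lambda>i. emeasure lborel U)"
  proof
    fix i
    have m: "{z. z + w i (z \<bullet> e) \<in> U} \<in> sets lborel"
      using measurable_sets[OF shear_measurable[OF w_meas, where e=e] Ub] by (simp add: vimage_def)
    have "(\<lambda>z. indicator U (z + w i (z \<bullet> e)) :: ennreal) = indicator {z. z + w i (z \<bullet> e) \<in> U}"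
      by (auto simp: indicator_def)
    then have "(\<integral>\<^sup>+z. indicator U (z + w i (z \<bullet> e)) \<partial>lborel) = emeasure lborel {z. z + w i (z \<bullet> e) \<in> U}"
      using m by simp
    also have "\<dots> = emeasure lborel U"
      by (rule simple_shear_emeasure[OF w_meas w_fin w_orth Ub])
    finally show "(\<integral>\<^sup>+z. indicator U (z + w i (z \<bullet> e)) \<partial>lborel) = emeasure lborel U" .
  qed
  finally show ?thesis by (simp add: Liminf_const)
qed

text \<open>Outer regularity of Lebesgue measure carries the inequality from open to Borel sets, and
  comparison of measures carries it to integrals.\<close>

lemma shear_nn_integral_le:
  fixes e :: "'a::euclidean_space" and v :: "real \<Rightarrow> 'a"
  assumes v: "v \<in> borel_measurable borel" and e: "norm e = 1"
    and orth: "\<And>\<tau>. v \<tau> \<bullet> e = 0" and h: "h \<in> borel_measurable borel"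
  shows "(\<integral>\<^sup>+z. h (z + v (z \<bullet> e)) \<partial>lborel) \<le> (\<integral>\<^sup>+z. h z \<partial>lborel)"
proof -
  let ?T = "\<lambda>z. z + v (z \<bullet> e)"
  note T = shear_measurable[OF v, of e]
  have "distr lborel borel ?T \<le> lborel"
    unfolding le_measure[of "distr lborel borel ?T" lborel, simplified]
  proof
    fix A :: "'a set" assume A: "A \<in> sets borel"
    have "emeasure (distr lborel borel ?T) A \<le> emeasure lborel A + ennreal \<epsilon>" if \<epsilon>: "0 < \<epsilon>" for \<epsilon>
    proof -
      obtain U where U: "open U" "A \<subseteq> U" "emeasure lborel (U - A) < ennreal \<epsilon>"
        using outer_regular_lborel[OF A \<epsilon>] by blast
      have "emeasure (distr lborel borel ?T) A = emeasure lborel (?T -` A \<inter> space lborel)"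
        using A T by (intro emeasure_distr) auto
      also have "\<dots> \<le> emeasure lborel {z. ?T z \<in> U}"
      proof (rule emeasure_mono)
        show "{z. ?T z \<in> U} \<in> sets lborel"
          using measurable_sets[OF T, of U] U(1) by (simp add: vimage_def)
      qed (use U(2) in auto)
      also have "\<dots> \<le> emeasure lborel U" by (rule shear_emeasure_open_le[OF v e orth U(1)])
      also have "\<dots> = emeasure lborel (A \<union> (U - A))" using U(2) by (simp add: Un_absorb1)
      also have "\<dots> \<le> emeasure lborel A + emeasure lborel (U - A)"
        using A U(1) by (intro emeasure_subadditive) auto
      also have "\<dots> \<le> emeasure lborel A + ennreal \<epsilon>" using U(3) by (intro add_left_mono) auto
      finally show ?thesis .
    qed
    then show "emeasure (distr lborel borel ?T) A \<le> emeasure lborel A"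
      by (rule ennreal_le_epsilon)
  qed
  then have "nn_integral (distr lborel borel ?T) h \<le> nn_integral lborel h"
    by (intro nn_integral_mono_measure) auto
  then show ?thesis using T h by (simp add: nn_integral_distr)
qed

text \<open>The map is diagonal with entry 1 in direction \<open>e\<close> and \<open>u\<close> in
  the others, written without coordinates; its determinant is u^(n-1).\<close>

lemma nn_integral_lborel_stretch:
  fixes e :: "'a::euclidean_space"
  assumes k: "k \<in> borel_measurable borel" and e: "e \<in> Basis" and u: "u > 0"
  shows "(\<integral>\<^sup>+z. k z \<partial>lborel) = ennreal (u ^ (DIM('a) - 1)) *
    (\<integral>\<^sup>+z. k (u *\<^sub>R z + ((1 - u) * (z \<bullet> e)) *\<^sub>R e) \<partial>lborel)"
proof -
  define c where "c b = (if b = e then 1 else u)" for b :: 'a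
  define S where "S x = 0 + (\<Sum>j\<in>Basis. (c j * (x \<bullet> j)) *\<^sub>R j)" for x :: 'a
  have S: "S x = u *\<^sub>R x + ((1 - u) * (x \<bullet> e)) *\<^sub>R e" for x
  proof -
    have "S x = (\<Sum>j\<in>Basis. u *\<^sub>R ((x \<bullet> j) *\<^sub>R j) + (if j = e then ((1 - u) * (x \<bullet> e)) *\<^sub>R e else 0))"
      unfolding S_def add_0 by (intro sum.cong) (auto simp: c_def algebra_simps)
    also have "\<dots> = u *\<^sub>R x + ((1 - u) * (x \<bullet> e)) *\<^sub>R e"
      unfolding sum.distrib scaleR_sum_right[symmetric] euclidean_representation
      using e by (simp add: sum.delta)
    finally show ?thesis .
  qed
  have "(\<Prod>j\<in>Basis. \<bar>c j\<bar>) = (\<Prod>j\<in>insert e (Basis - {e}). \<bar>c j\<bar>)"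
    using e by (simp add: insert_absorb)
  also have "\<dots> = (\<Prod>j\<in>Basis - {e}. u)" using u by (subst prod.insert) (auto simp: c_def intro!: prod.cong)
  also have "\<dots> = u ^ (DIM('a) - 1)" using e by simp
  finally have P: "(\<Prod>j\<in>Basis. \<bar>c j\<bar>) = u ^ (DIM('a) - 1)" .
  have cn: "\<And>j. j \<in> Basis \<Longrightarrow> c j \<noteq> 0" using u by (simp add: c_def)
  have L: "lborel = density (distr lborel borel S) (\<lambda>_. ennreal (u ^ (DIM('a) - 1)))"
    using lborel_affine_euclidean[of c "0::'a", OF cn] by (simp add: P S_def[abs_def])
  have Sm[measurable]: "S \<in> borel_measurable borel" unfolding S_def[abs_def] by measurable
  note k[measurable]
  have "(\<integral>\<^sup>+z. k z \<partial>lborel) = (\<integral>\<^sup>+z. k z \<partial>density (distr lborel borel S) (\<lambda>_. ennreal (u ^ (DIM('a) - 1))))"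
    by (simp only: L[symmetric])
  also have "\<dots> = (\<integral>\<^sup>+z. ennreal (u ^ (DIM('a) - 1)) * k (S z) \<partial>lborel)"
    using k Sm by (simp add: nn_integral_density nn_integral_distr)
  also have "\<dots> = ennreal (u ^ (DIM('a) - 1)) * (\<integral>\<^sup>+z. k (S z) \<partial>lborel)"
    by (intro nn_integral_cmult) measurable
  finally show ?thesis by (simp only: S)
qed

text \<open>The map moves \<open>z\<close> towards the point of the curve \<open>y\<close> in the same hyperplane
  \<open>{z. z \<bullet> e = \<tau>}\<close>, so only the remaining \<open>n - 1\<close> directions are contracted.\<close>

lemma slice_contraction_integral_le:
  fixes e :: "'a::euclidean_space" and y :: "real \<Rightarrow> 'a"
  assumes y[measurable]: "y \<in> borel_measurable borel" and e: "e \<in> Basis"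
    and ye: "\<And>\<tau>. y \<tau> \<bullet> e = \<tau>" and h[measurable]: "h \<in> borel_measurable borel" and u: "u > 0"
  shows "ennreal (u ^ (DIM('a) - 1)) * (\<integral>\<^sup>+z. h ((1 - u) *\<^sub>R y (z \<bullet> e) + u *\<^sub>R z) \<partial>lborel) \<le> (\<integral>\<^sup>+z. h z \<partial>lborel)"
proof -
  \<comment> \<open>The contraction is the stretch \<open>?S\<close> followed by the shear with this
    \<open>v\<close>, because \<open>?S\<close> leaves \<open>z \<bullet> e\<close>
    unchanged.\<close>
  define v where "v \<tau> = (1 - u) *\<^sub>R (y \<tau> - \<tau> *\<^sub>R e)" for \<tau>
  have [measurable]: "v \<in> borel_measurable borel" unfolding v_def by measurable
  have ee: "e \<bullet> e = 1" using e by simp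
  have orth: "v \<tau> \<bullet> e = 0" for \<tau> by (simp add: v_def inner_diff_left ye ee)
  let ?k = "\<lambda>z. h (z + v (z \<bullet> e))"
  let ?S = "\<lambda>z. u *\<^sub>R z + ((1 - u) * (z \<bullet> e)) *\<^sub>R e"
  have Se: "?S z \<bullet> e = z \<bullet> e" for z by (simp add: inner_add_left ee algebra_simps)
  have "?k (?S z) = h ((1 - u) *\<^sub>R y (z \<bullet> e) + u *\<^sub>R z)" for z
    unfolding Se v_def by (rule arg_cong[where f=h]) (simp add: algebra_simps)
  then have "ennreal (u ^ (DIM('a) - 1)) * (\<integral>\<^sup>+z. h ((1 - u) *\<^sub>R y (z \<bullet> e) + u *\<^sub>R z) \<partial>lborel)
      = ennreal (u ^ (DIM('a) - 1)) * (\<integral>\<^sup>+z. ?k (?S z) \<partial>lborel)" by simp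
  also have "\<dots> = (\<integral>\<^sup>+z. ?k z \<partial>lborel)"
    by (rule nn_integral_lborel_stretch[symmetric, OF _ e u]) measurable
  also have "\<dots> \<le> (\<integral>\<^sup>+z. h z \<partial>lborel)"
    by (rule shear_nn_integral_le) (use e orth in auto)
  finally show ?thesis .
qed

text \<open>A pointwise substitute for Hoelder's inequality: after integration the threshold
  \<theta> is free to be chosen, even depending on the variable of integration.\<close>

lemma le_threshold_power:
  fixes g \<theta> :: real
  assumes "0 \<le> g" "0 < \<theta>"
  shows "g \<le> \<theta> + g ^ Suc m / \<theta> ^ m"
proof (cases "g \<le> \<theta>")
  case True
  have "0 \<le> g ^ Suc m / \<theta> ^ m" using assms by simp
  then show ?thesis using True by linarith
next
  case False
  then have "\<theta> ^ m \<le> g ^ m" using assms by (intro power_mono) auto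
  then have "g * \<theta> ^ m \<le> g ^ Suc m" using assms by (simp add: mult_left_mono)
  then have "g \<le> g ^ Suc m / \<theta> ^ m" using assms by (simp add: field_simps)
  then show ?thesis using assms by simp
qed

text \<open>Finiteness of \<open>X\<close> is essential, since the second hypothesis is vacuous for
  an infinite \<open>X\<close>.\<close>

lemma ennreal_half_absorb:
  assumes "X < \<infinity>" "X \<le> ennreal (1/2) * X + ennreal (1/2) * Y"
  shows "X \<le> (Y::ennreal)"
proof (cases Y rule: ennreal_cases)
  case (real y)
  obtain x where x: "X = ennreal x" "0 \<le> x" using assms(1) by (cases X rule: ennreal_cases) auto
  have "ennreal x \<le> ennreal (1/2 * x + 1/2 * y)"
  proof -
    have "0 \<le> 1/2 * x" "0 \<le> 1/2 * y" "0 \<le> (1/2::real)" using x real by auto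
    then have "ennreal (1/2 * x + 1/2 * y) = ennreal (1/2) * ennreal x + ennreal (1/2) * ennreal y"
      using x(2) real(1) by (simp only: ennreal_plus ennreal_mult)
    then show ?thesis using assms(2) by (simp only: x(1) real(2))
  qed
  then have "x \<le> 1/2 * x + 1/2 * y" using x real by (subst (asm) ennreal_le_iff) auto
  then show ?thesis using x real by (auto intro: ennreal_leI)
qed simp

text \<open>The hypothesis \<open>len\<close> is averaged over \<open>F\<close>. Contracting towards
  the curve with ratio u costs a Jacobian u^(-(n-1)), which for n >= 2 is not integrable near 0, so
  the threshold has to grow as u tends to 0. With threshold \<open>\<theta> * u powr (-a)\<close>
  and a = (n-1)/n, the threshold term and the energy term both end up with the integrable factor
  \<open>u powr (-a)\<close>.\<close>

lemma slice_pencil_estimate: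
  fixes e :: "'a::euclidean_space" and y :: "real \<Rightarrow> 'a" and g :: "'a \<Rightarrow> real" and D :: real
  assumes y[measurable]: "y \<in> borel_measurable borel" and e: "e \<in> Basis"
    and ye: "\<And>\<tau>. y \<tau> \<bullet> e = \<tau>" and g[measurable]: "g \<in> borel_measurable borel" and g0: "\<And>z. 0 \<le> g z"
    and F[measurable]: "F \<in> sets borel" and Ffin: "emeasure lborel F < \<infinity>" and D: "D > 0"
    and len: "\<And>z. z \<in> F \<Longrightarrow> 1 \<le> ennreal D * (\<integral>\<^sup>+u\<in>{0<..<1}. ennreal (g ((1 - u) *\<^sub>R y (z \<bullet> e) + u *\<^sub>R z)) \<partial>lborel)"
  shows "emeasure lborel F \<le> ennreal ((2 * real DIM('a) * D) ^ DIM('a)) * (\<integral>\<^sup>+z. ennreal (g z ^ DIM('a)) \<partial>lborel)"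
proof -
  obtain m where m: "DIM('a) = Suc m" by (metis DIM_positive Suc_pred)
  let ?n = "real (Suc m)"
  \<comment> \<open>Chosen so that \<open>D * (\<theta> * ?n) = 1/2\<close>, where \<open>?n\<close>
    is the integral of \<open>u powr (-a)\<close>: the threshold term then accounts for at most half
    of the measure of \<open>F\<close> and is absorbed.\<close>
  define \<theta> where "\<theta> = 1 / (2 * ?n * D)"
  define a where "a = real m / ?n"
  have \<theta>: "\<theta> > 0" using D by (simp add: \<theta>_def)
  have a: "0 \<le> a" "a < 1" "1 - a = 1 / ?n" by (auto simp: a_def field_simps)
  let ?\<Phi> = "\<lambda>u z. (1 - u) *\<^sub>R y (z \<bullet> e) + u *\<^sub>R z"
  let ?I = "\<integral>\<^sup>+z. ennreal (g z ^ Suc m) \<partial>lborel"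
  have pw: "(\<integral>\<^sup>+u. ennreal (u powr (-a)) * indicator {0<..<1} u \<partial>lborel) \<le> ennreal ?n"
  proof -
    have "((\<lambda>u. u powr (-a)) has_integral (1 powr (-a+1) / (-a+1))) {0..1}"
      using a by (intro has_integral_powr_from_0) auto
    then have "(\<integral>\<^sup>+u. ennreal (u powr (-a)) * indicator {0..1} u \<partial>lborel) = ennreal (1 powr (-a+1) / (-a+1))"
      by (intro nn_integral_has_integral_lebesgue') auto
    also have "1 powr (-a+1) / (-a+1) = ?n" using a(3) by simp
    finally have "(\<integral>\<^sup>+u. ennreal (u powr (-a)) * indicator {0..1} u \<partial>lborel) = ennreal ?n" .
    moreover have "(\<integral>\<^sup>+u. ennreal (u powr (-a)) * indicator {0<..<1} u \<partial>lborel) \<le> (\<integral>\<^sup>+u. ennreal (u powr (-a)) * indicator {0..1} u \<partial>lborel)"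
      by (intro nn_integral_mono) (auto simp: indicator_def)
    ultimately show ?thesis by simp
  qed
  let ?A = "\<lambda>u. ennreal (\<theta> * u powr (-a)) * indicator {0<..<1::real} u"
  let ?B = "\<lambda>u z. ennreal (g (?\<Phi> u z) ^ Suc m / (\<theta> * u powr (-a)) ^ m) * indicator {0<..<1::real} u"
  have "emeasure lborel F = (\<integral>\<^sup>+z. indicator F z \<partial>lborel)" by simp
  also have "\<dots> \<le> (\<integral>\<^sup>+z. ennreal D * (\<integral>\<^sup>+u. ?A u \<partial>lborel) * indicator F z + ennreal D * (\<integral>\<^sup>+u. ?B u z \<partial>lborel) \<partial>lborel)"
  proof (rule nn_integral_mono)
    fix z :: 'a
    show "indicator F z \<le> ennreal D * (\<integral>\<^sup>+u. ?A u \<partial>lborel) * indicator F z + ennreal D * (\<integral>\<^sup>+u. ?B u z \<partial>lborel)"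
    proof (cases "z \<in> F")
      case True
      have "(\<integral>\<^sup>+u\<in>{0<..<1}. ennreal (g (?\<Phi> u z)) \<partial>lborel) \<le> (\<integral>\<^sup>+u. ?A u + ?B u z \<partial>lborel)"
      proof (rule nn_integral_mono)
        fix u :: real
        show "ennreal (g (?\<Phi> u z)) * indicator {0<..<1} u \<le> ?A u + ?B u z"
        proof (cases "u \<in> {0<..<1}")
          case True
          then have p: "0 < \<theta> * u powr (-a)" using \<theta> by simp
          have "ennreal (g (?\<Phi> u z)) \<le> ennreal (\<theta> * u powr (-a) + g (?\<Phi> u z) ^ Suc m / (\<theta> * u powr (-a)) ^ m)"
            by (intro ennreal_leI le_threshold_power g0 p)
          also have "\<dots> = ennreal (\<theta> * u powr (-a)) + ennreal (g (?\<Phi> u z) ^ Suc m / (\<theta> * u powr (-a)) ^ m)"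
            using p g0 by (intro ennreal_plus) auto
          finally show ?thesis using True by simp
        qed simp
      qed
      also have "\<dots> = (\<integral>\<^sup>+u. ?A u \<partial>lborel) + (\<integral>\<^sup>+u. ?B u z \<partial>lborel)"
        by (intro nn_integral_add) measurable
      finally have "ennreal D * (\<integral>\<^sup>+u\<in>{0<..<1}. ennreal (g (?\<Phi> u z)) \<partial>lborel)
          \<le> ennreal D * ((\<integral>\<^sup>+u. ?A u \<partial>lborel) + (\<integral>\<^sup>+u. ?B u z \<partial>lborel))"
        by (rule mult_left_mono) simp
      with len[OF True] have "1 \<le> ennreal D * ((\<integral>\<^sup>+u. ?A u \<partial>lborel) + (\<integral>\<^sup>+u. ?B u z \<partial>lborel))"
        by (rule order_trans)
      then show ?thesis using True by (simp add: distrib_left)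
    qed simp
  qed
  also have "\<dots> = (\<integral>\<^sup>+z. ennreal D * (\<integral>\<^sup>+u. ?A u \<partial>lborel) * indicator F z \<partial>lborel) + (\<integral>\<^sup>+z. ennreal D * (\<integral>\<^sup>+u. ?B u z \<partial>lborel) \<partial>lborel)"
    by (intro nn_integral_add) measurable
  also have "\<dots> = ennreal D * (\<integral>\<^sup>+u. ?A u \<partial>lborel) * emeasure lborel F + ennreal D * (\<integral>\<^sup>+z. (\<integral>\<^sup>+u. ?B u z \<partial>lborel) \<partial>lborel)"
    by (intro arg_cong2[where f="(+)"] nn_integral_cmult_indicator nn_integral_cmult) (simp, measurable)
  also have "(\<integral>\<^sup>+z. (\<integral>\<^sup>+u. ?B u z \<partial>lborel) \<partial>lborel) = (\<integral>\<^sup>+u. (\<integral>\<^sup>+z. ?B u z \<partial>lborel) \<partial>lborel)"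
  proof (rule lborel_pair.Fubini')
    show "(\<lambda>(u, z). ?B u z) \<in> borel_measurable (lborel \<Otimes>\<^sub>M lborel)"
      unfolding measurable_cong_sets[OF sets_pair_measure_cong[OF sets_lborel sets_lborel] refl]
      by measurable
  qed
  also have "\<dots> \<le> (\<integral>\<^sup>+u. ennreal (1 / \<theta> ^ m) * ?I * (ennreal (u powr (-a)) * indicator {0<..<1} u) \<partial>lborel)"
  proof (rule nn_integral_mono)
    fix u :: real
    show "(\<integral>\<^sup>+z. ?B u z \<partial>lborel) \<le> ennreal (1 / \<theta> ^ m) * ?I * (ennreal (u powr (-a)) * indicator {0<..<1} u)"
    proof (cases "u \<in> {0<..<1}")
      case True
      then have u: "u > 0" by simp
      define q where "q = 1 / (\<theta> * u powr (-a)) ^ m"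
      have q: "q \<ge> 0" using \<theta> u by (simp add: q_def)
      have "(\<integral>\<^sup>+z. ?B u z \<partial>lborel) = (\<integral>\<^sup>+z. ennreal q * ennreal (g (?\<Phi> u z) ^ Suc m) \<partial>lborel)"
        using True q g0 by (intro nn_integral_cong) (simp add: ennreal_mult[symmetric] q_def)
      also have "\<dots> = ennreal q * (\<integral>\<^sup>+z. ennreal (g (?\<Phi> u z) ^ Suc m) \<partial>lborel)"
        by (intro nn_integral_cmult) measurable
      also have "ennreal q = ennreal (1 / \<theta> ^ m * u powr (-a)) * ennreal (u ^ m)"
      proof -
        \<comment> \<open>The balance of exponents \<open>m - a = a * m\<close>, which is what
          determines \<open>a = m / Suc m\<close>.\<close>
        have "u powr (-a) * u ^ m = 1 / (u powr (-a)) ^ m"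
        proof -
          have "(u powr (-a)) ^ m = u powr (-a * m)" using u by (simp add: powr_realpow[symmetric] powr_powr)
          moreover have "u ^ m = u powr m" using u by (simp add: powr_realpow)
          moreover have "-a + m = a * m" by (simp add: a_def field_simps)
          then have "u powr (-a) * u powr m = u powr (a * m)" using u by (simp flip: powr_add)
          moreover have "1 / u powr (-a * m) = u powr (a * m)" using u by (simp add: powr_minus field_simps)
          ultimately show ?thesis by simp
        qed
        then have "q = (1 / \<theta> ^ m * u powr (-a)) * u ^ m"
          unfolding q_def power_mult_distrib by (simp add: mult.assoc)
        moreover have "0 \<le> 1 / \<theta> ^ m * u powr (-a)" "0 \<le> u ^ m" using \<theta> u by auto
        ultimately show ?thesis by (simp only: ennreal_mult)
      qed
      also have "ennreal (1 / \<theta> ^ m * u powr (-a)) * ennreal (u ^ m) * (\<integral>\<^sup>+z. ennreal (g (?\<Phi> u z) ^ Suc m) \<partial>lborel)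
          \<le> ennreal (1 / \<theta> ^ m * u powr (-a)) * ?I"
      proof -
        have "ennreal (u ^ (DIM('a) - 1)) * (\<integral>\<^sup>+z. ennreal (g (?\<Phi> u z) ^ Suc m) \<partial>lborel) \<le> ?I"
          by (rule slice_contraction_integral_le[OF y e ye _ u]) measurable
        then show ?thesis by (simp add: m mult.assoc mult_left_mono)
      qed
      also have "\<dots> = ennreal (1 / \<theta> ^ m) * ?I * (ennreal (u powr (-a)) * indicator {0<..<1} u)"
      proof -
        have "ennreal (1 / \<theta> ^ m * u powr (-a)) = ennreal (1 / \<theta> ^ m) * ennreal (u powr (-a))"
          using \<theta> by (intro ennreal_mult) auto
        then show ?thesis using True by (simp only:) (simp add: ac_simps)
      qed
      finally show ?thesis .
    qed simp
  qed
  also have "\<dots> = ennreal (1 / \<theta> ^ m) * ?I * (\<integral>\<^sup>+u. ennreal (u powr (-a)) * indicator {0<..<1} u \<partial>lborel)"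
    by (intro nn_integral_cmult) measurable
  also have "\<dots> \<le> ennreal (1 / \<theta> ^ m) * ?I * ennreal ?n"
    by (intro mult_left_mono pw) simp
  also have "(\<integral>\<^sup>+u. ?A u \<partial>lborel) = ennreal \<theta> * (\<integral>\<^sup>+u. ennreal (u powr (-a)) * indicator {0<..<1} u \<partial>lborel)"
    using \<theta> by (subst nn_integral_cmult[symmetric]) (auto simp: ennreal_mult mult.assoc intro!: nn_integral_cong)
  also have "\<dots> \<le> ennreal \<theta> * ennreal ?n"
    by (intro mult_left_mono pw) simp
  finally have "emeasure lborel F \<le> ennreal D * (ennreal \<theta> * ennreal ?n) * emeasure lborel F + ennreal D * (ennreal (1 / \<theta> ^ m) * ?I * ennreal ?n)"
    by (simp add: mult_left_mono mult_right_mono add_mono)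
  also have "ennreal D * (ennreal \<theta> * ennreal ?n) = ennreal (1/2)"
  proof -
    have "D * (\<theta> * ?n) = 1/2" using D by (simp add: \<theta>_def del: of_nat_Suc)
    moreover have "ennreal D * (ennreal \<theta> * ennreal ?n) = ennreal (D * (\<theta> * ?n))"
      using D \<theta> by (simp add: ennreal_mult del: of_nat_Suc)
    ultimately show ?thesis by (simp only:)
  qed
  also have "ennreal D * (ennreal (1 / \<theta> ^ m) * ?I * ennreal ?n) = ennreal (1/2) * (ennreal ((2 * ?n * D) ^ Suc m) * ?I)"
  proof -
    have "D * (1 / \<theta> ^ m) * ?n = 1/2 * (2 * ?n * D) ^ Suc m"
      unfolding \<theta>_def by (simp add: power_divide)
    moreover have "0 \<le> D" "0 \<le> 1 / \<theta> ^ m" "0 \<le> ?n" "0 \<le> D * (1 / \<theta> ^ m)" "0 \<le> (2 * ?n * D) ^ Suc m" "0 \<le> (1/2::real)"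
      using D \<theta> by (auto simp del: power_Suc)
    ultimately have "ennreal D * ennreal (1 / \<theta> ^ m) * ennreal ?n = ennreal (1/2) * ennreal ((2 * ?n * D) ^ Suc m)"
      by (simp only: ennreal_mult[symmetric])
    then have "ennreal D * ennreal (1 / \<theta> ^ m) * ennreal ?n * ?I = ennreal (1/2) * ennreal ((2 * ?n * D) ^ Suc m) * ?I"
      by (rule arg_cong)
    then show ?thesis by (simp only: mult.assoc mult.commute[of ?I])
  qed
  finally have "emeasure lborel F \<le> ennreal ((2 * ?n * D) ^ Suc m) * ?I"
    by (rule ennreal_half_absorb[OF Ffin])
  then show ?thesis by (simp only: m)
qed

section \<open>Level bands and radial crossings\<close>

text \<open>\<open>t\<close> is the first time at which \<open>f\<close> reaches \<beta>, and
  \<open>s\<close> the last time up to \<open>t\<close> at which \<open>f\<close> is at most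
  \<alpha>. A downward crossing is an upward one in reversed time.\<close>

lemma continuous_crossing:
  fixes f :: "real \<Rightarrow> real"
  assumes cont: "continuous_on {a..b} f" and ab: "a \<le> b" and lt: "\<alpha> < \<beta>"
    and ends: "f a \<le> \<alpha> \<and> \<beta> \<le> f b \<or> f b \<le> \<alpha> \<and> \<beta> \<le> f a"
  obtains s t where "a \<le> s" "s \<le> t" "t \<le> b" "\<And>r. s < r \<Longrightarrow> r < t \<Longrightarrow> \<alpha> < f r \<and> f r < \<beta>"
    "f s \<le> \<alpha> \<and> \<beta> \<le> f t \<or> f t \<le> \<alpha> \<and> \<beta> \<le> f s"
proof -
  have up: "\<exists>s t. a \<le> s \<and> s \<le> t \<and> t \<le> b \<and> (\<forall>r. s < r \<longrightarrow> r < t \<longrightarrow> \<alpha> < f r \<and> f r < \<beta>) \<and> f s \<le> \<alpha> \<and> \<beta> \<le> f t"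
    if cont: "continuous_on {a..b} f" and ab: "a \<le> b" and fa: "f a \<le> \<alpha>" and fb: "\<beta> \<le> f b" for a b and f :: "real \<Rightarrow> real"
  proof -
    let ?S = "{a..b} \<inter> f -` {\<beta>..}"
    have "closed ?S" by (rule continuous_closed_preimage[OF cont]) auto
    then have "compact ?S" by (metis compact_Icc closed_Int_compact inf.left_idem inf_commute)
    moreover have "b \<in> ?S" using ab fb by auto
    ultimately obtain t where t: "t \<in> ?S" "\<And>r. r \<in> ?S \<Longrightarrow> t \<le> r"
      using compact_attains_inf[of ?S] by blast
    have at: "{a..t} \<subseteq> {a..b}" using t(1) by auto
    let ?T = "{a..t} \<inter> f -` {..\<alpha>}"
    have "closed ?T" by (rule continuous_closed_preimage[OF continuous_on_subset[OF cont at]]) auto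
    then have "compact ?T" by (metis compact_Icc closed_Int_compact inf.left_idem inf_commute)
    moreover have "a \<in> ?T" using t(1) fa by auto
    ultimately obtain s where s: "s \<in> ?T" "\<And>r. r \<in> ?T \<Longrightarrow> r \<le> s"
      using compact_attains_sup[of ?T] by blast
    have "\<alpha> < f r \<and> f r < \<beta>" if "s < r" "r < t" for r
    proof
      show "\<alpha> < f r" using s(2)[of r] s(1) that by (force simp: not_le[symmetric])
      show "f r < \<beta>" using t(2)[of r] t(1) s(1) that by (force simp: not_le[symmetric])
    qed
    then show ?thesis using s(1) t(1) by (intro exI[of _ s] exI[of _ t]) auto
  qed
  show thesis
  proof (cases "f a \<le> \<alpha> \<and> \<beta> \<le> f b")
    case True
    then show ?thesis using up[OF cont ab] that by blast
  next
    case False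
    then have *: "f b \<le> \<alpha>" "\<beta> \<le> f a" using ends by auto
    let ?g = "\<lambda>x. f (- x)"
    have "continuous_on {-b..-a} ?g"
      by (rule continuous_on_compose2[OF cont]) (auto intro!: continuous_intros)
    from up[OF this] ab * obtain s t where st: "-b \<le> s" "s \<le> t" "t \<le> -a"
      "\<forall>r. s < r \<longrightarrow> r < t \<longrightarrow> \<alpha> < ?g r \<and> ?g r < \<beta>" "?g s \<le> \<alpha>" "\<beta> \<le> ?g t" by auto
    have "\<alpha> < f r \<and> f r < \<beta>" if "-t < r" "r < -s" for r
      using st(4)[rule_format, of "-r"] that by auto
    then show ?thesis using st by (intro that[of "-t" "-s"]) auto
  qed
qed

lemma sum_le_single:
  fixes f :: "'i \<Rightarrow> ennreal"
  assumes "finite I" "\<And>i j. i \<in> I \<Longrightarrow> j \<in> I \<Longrightarrow> f i \<noteq> 0 \<Longrightarrow> f j \<noteq> 0 \<Longrightarrow> i = j" "\<And>i. i \<in> I \<Longrightarrow> f i \<le> c"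
  shows "sum f I \<le> c"
proof (cases "\<exists>i\<in>I. f i \<noteq> 0")
  case True
  then obtain i where i: "i \<in> I" "f i \<noteq> 0" by blast
  have "sum f I = sum f {i}"
    using assms(1,2) i by (intro sum.mono_neutral_right) auto
  then show ?thesis using assms(3)[OF i(1)] by simp
next
  case False
  then show ?thesis by simp
qed

lemma ennreal_mult_le_divide:
  assumes "0 < c" "ennreal c * X \<le> ennreal y" "0 \<le> y"
  shows "X \<le> ennreal (y / c)"
proof -
  have "X = ennreal (1 / c) * (ennreal c * X)"
    using assms(1) by (simp add: mult.assoc[symmetric] ennreal_mult[symmetric])
  also have "\<dots> \<le> ennreal (1 / c) * ennreal y" by (intro mult_left_mono assms) simp
  also have "\<dots> = ennreal (y / c)" using assms by (simp add: ennreal_mult[symmetric])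
  finally show ?thesis .
qed

locale conformal = ball_density \<rho> for \<rho> :: "'a::euclidean_space \<Rightarrow> real" +
  fixes A B :: real
  assumes A: "1 \<le> A" and harnack: "harnack A \<rho>" and B: "0 < B" and volume_growth: "volume_growth B \<rho>"
begin

text \<open>Finite on the ball by \<open>rho_norm_u\<close>. Elsewhere \<open>enn2real\<close> may
  turn an infinite value into 0, so the functions built from \<open>u\<close> carry an indicator of
  the ball.\<close>

definition u :: "'a \<Rightarrow> real" where "u x = enn2real (rho_norm \<rho> x)"

lemma seg_length_finite:
  assumes "x \<in> ball 0 1" "y \<in> ball 0 1"
  shows "seg_length \<rho> x y < \<infinity>"
proof -
  have "continuous_on {0..1} (\<lambda>t. \<rho> (linepath x y t))"
    using linepath_in_ball[OF assms] by (intro continuous_on_compose_curve) auto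
  then have "compact ((\<lambda>t. \<rho> (linepath x y t)) ` {0..1})" by (intro compact_continuous_image) auto
  then have "bounded ((\<lambda>t. \<rho> (linepath x y t)) ` {0..1})" by (rule compact_imp_bounded)
  then obtain m where m: "\<And>t. t \<in> {0..1} \<Longrightarrow> \<bar>\<rho> (linepath x y t)\<bar> \<le> m" by (force simp: bounded_iff)
  have "0 \<le> m" using m[of 0] by force
  have "seg_length \<rho> x y \<le> ennreal (m * norm (y - x))"
    using m \<open>0 \<le> m\<close> by (intro seg_length_le) (auto simp: abs_le_iff)
  also have "\<dots> < \<infinity>" by simp
  finally show ?thesis .
qed

lemma rho_norm_inner: "x \<in> ball 0 1 \<Longrightarrow> rho_norm \<rho> x = inner_dist \<rho> x 0"
  unfolding rho_norm_def by (rule rho_dist_inner) auto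

lemma rho_norm_u:
  assumes "x \<in> ball 0 1"
  shows "rho_norm \<rho> x = ennreal (u x)"
proof -
  have "rho_norm \<rho> x \<le> seg_length \<rho> x 0"
    unfolding rho_norm_inner[OF assms] using assms by (intro inner_dist_le_seg) auto
  also have "\<dots> < \<infinity>" using assms by (intro seg_length_finite) auto
  finally show ?thesis by (simp add: u_def)
qed

lemma u_nonneg: "0 \<le> u x" by (simp add: u_def)

lemma u_le_add_inner:
  assumes "x \<in> ball 0 1" "y \<in> ball 0 1"
  shows "ennreal (u x) \<le> ennreal (u y) + inner_dist \<rho> x y"
  using inner_dist_triangle[of x 0 y] assms
  by (simp add: rho_norm_u[symmetric] rho_norm_inner add.commute)

lemma u_le_add_seg:
  assumes "x \<in> ball 0 1" "y \<in> ball 0 1" "seg_length \<rho> x y \<le> ennreal m" "0 \<le> m"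
  shows "u x \<le> u y + m"
proof -
  have "ennreal (u x) \<le> ennreal (u y) + ennreal m"
    using u_le_add_inner[OF assms(1,2)] inner_dist_le_seg[OF assms(1,2)] assms(3)
    by (meson add_left_mono order_trans)
  then show ?thesis using assms(4) u_nonneg[of y]
    by (simp add: ennreal_plus[symmetric] ennreal_le_iff del: ennreal_plus)
qed

lemma u_continuous: "continuous_on (ball 0 1) u"
  unfolding continuous_on_iff
proof (intro ballI allI impI)
  fix x :: 'a and \<epsilon> :: real assume x: "x \<in> ball 0 1" and \<epsilon>: "0 < \<epsilon>"
  obtain d where d: "d > 0" "\<And>y. dist y x < d \<Longrightarrow> y \<in> ball 0 1 \<and> seg_length \<rho> x y \<le> ennreal (\<epsilon>/2) \<and> seg_length \<rho> y x \<le> ennreal (\<epsilon>/2)"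
    using seg_length_small[OF x, of "\<epsilon>/2"] \<epsilon> by auto
  have "dist (u y) (u x) < \<epsilon>" if "dist y x < d" for y
  proof -
    note dy = d(2)[OF that]
    have "u x \<le> u y + \<epsilon>/2" "u y \<le> u x + \<epsilon>/2"
      using dy x \<epsilon> by (auto intro!: u_le_add_seg)
    then show ?thesis using \<epsilon> by (simp add: dist_real_def)
  qed
  then show "\<exists>d>0. \<forall>x'\<in>ball 0 1. dist x' x < d \<longrightarrow> dist (u x') (u x) < \<epsilon>" using d(1) by blast
qed

lemma whitney_ball_subset: "z \<in> ball 0 1 \<Longrightarrow> whitney_ball z \<subseteq> ball (0::'a) 1"
proof
  fix w assume z: "z \<in> ball 0 1" and "w \<in> whitney_ball z"
  then have "norm (w - z) < (1 - norm z) / 2" by (simp add: whitney_ball_def dist_norm norm_minus_commute)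
  then have "norm w < 1" using norm_triangle_sub[of w z] z by simp
  then show "w \<in> ball 0 1" by simp
qed

lemma centre_whitney_ball: "z \<in> ball 0 1 \<Longrightarrow> z \<in> whitney_ball z"
  by (simp add: whitney_ball_def)

lemma harnack_le:
  assumes "z \<in> ball 0 1" "x \<in> whitney_ball z" "y \<in> whitney_ball z"
  shows "\<rho> x \<le> A * \<rho> y"
proof -
  have "\<rho> x / \<rho> y \<le> A" using harnack assms unfolding harnack_def by blast
  moreover have "\<rho> y > 0" using positive whitney_ball_subset assms by blast
  ultimately show ?thesis by (simp add: divide_le_eq)
qed

lemma u_whitney_lipschitz:
  assumes z: "z \<in> ball 0 1" and xy: "x \<in> whitney_ball z" "y \<in> whitney_ball z"
  shows "u x \<le> u y + A * \<rho> z * norm (x - y)"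
proof (rule u_le_add_seg)
  have "linepath x y t \<in> whitney_ball z" if "t \<in> {0..1}" for t
    using convex_ball[of z "(1 - norm z)/2"] xy that by (simp add: linepath_def whitney_ball_def convex_def)
  then show "seg_length \<rho> x y \<le> ennreal (A * \<rho> z * norm (x - y))"
    unfolding norm_minus_commute[of x y]
    using harnack_le[OF z _ centre_whitney_ball[OF z]] A positive[OF z] by (intro seg_length_le) auto
  show "0 \<le> A * \<rho> z * norm (x - y)" using A positive[OF z] by simp
qed (use whitney_ball_subset[OF z] xy in blast)+

text \<open>A path from \<open>x\<close> to 0 must reach distance \<open>(1 - norm x) / 4\<close>
  from \<open>x\<close>, and up to there Harnack keeps the density above
  \<open>\<rho> x / A\<close>. The condition \<open>1/2 \<le> norm x\<close> ensures that this
  distance is at most \<open>norm x\<close>.\<close>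

lemma density_le_u:
  assumes x: "x \<in> ball 0 1" "1/2 \<le> norm x"
  shows "\<rho> x * (1 - norm x) \<le> 4 * A * u x"
proof -
  let ?h = "(1 - norm x) / 4"
  have h: "0 < ?h" "?h \<le> norm x" using x by auto
  have "ennreal (\<rho> x / A * ?h) \<le> inner_dist \<rho> x 0"
  proof (rule inner_dist_zero_ge[OF x(1) h])
    show "0 \<le> \<rho> x / A" using positive[OF x(1)] A by simp
    fix w assume w: "w \<in> ball 0 1" "dist x w \<le> ?h"
    then have "w \<in> whitney_ball x" using h x by (simp add: whitney_ball_def)
    then have "\<rho> x \<le> A * \<rho> w" using x centre_whitney_ball by (intro harnack_le[of x]) auto
    then show "\<rho> x / A \<le> \<rho> w" using A by (simp add: divide_le_eq mult.commute)
  qed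
  also have "\<dots> = ennreal (u x)" using rho_norm_inner[OF x(1)] rho_norm_u[OF x(1)] by simp
  finally have "\<rho> x / A * ?h \<le> u x" using u_nonneg by (simp add: ennreal_le_iff)
  then show ?thesis using A by (simp add: field_simps)
qed

text \<open>The increase of \<open>u\<close> on the Whitney ball is at most
  \<open>A * \<rho> x * ((1 - norm x) / 2)\<close>, and \<open>density_le_u\<close> bounds this by
  \<open>2 * A * A * u x\<close>.\<close>

lemma u_whitney_le:
  assumes x: "x \<in> ball 0 1" "1/2 \<le> norm x" and y: "y \<in> whitney_ball x"
  shows "u y \<le> (1 + 2 * A * A) * u x"
proof -
  have "u y \<le> u x + A * \<rho> x * norm (y - x)"
    using u_whitney_lipschitz[OF x(1) y centre_whitney_ball[OF x(1)]] .
  also have "A * \<rho> x * norm (y - x) \<le> A * \<rho> x * ((1 - norm x) / 2)"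
    using y A positive[OF x(1)] by (intro mult_left_mono) (auto simp: whitney_ball_def dist_norm norm_minus_commute)
  also have "\<dots> = A / 2 * (\<rho> x * (1 - norm x))" by simp
  also have "\<dots> \<le> A / 2 * (4 * A * u x)" using density_le_u[OF x] A by (intro mult_left_mono) auto
  finally show ?thesis by (simp add: algebra_simps)
qed

text \<open>The extension by 0 makes it a Borel function on the whole space. Since \<open>u\<close>
  is nonnegative and the inequalities are strict, the choice \<alpha> = -1 keeps all of the set
  where \<open>u\<close> is below \<beta>.\<close>

definition band :: "real \<Rightarrow> real \<Rightarrow> 'a \<Rightarrow> real" where
  "band \<alpha> \<beta> y = \<rho> y * indicator {y \<in> ball 0 1. \<alpha> < u y \<and> u y < \<beta>} y"

lemma open_band: "open {y \<in> ball 0 1. \<alpha> < u y \<and> u y < \<beta>}"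
proof -
  have "open (ball 0 1 \<inter> u -` {\<alpha><..<\<beta>})"
    by (intro continuous_open_preimage u_continuous) auto
  also have "ball 0 1 \<inter> u -` {\<alpha><..<\<beta>} = {y \<in> ball 0 1. \<alpha> < u y \<and> u y < \<beta>}" by auto
  finally show ?thesis .
qed

lemma band_measurable[measurable]: "band \<alpha> \<beta> \<in> borel_measurable borel"
proof -
  have "(\<lambda>y. indicator {y \<in> ball 0 1. \<alpha> < u y \<and> u y < \<beta>} y *\<^sub>R \<rho> y) \<in> borel_measurable borel"
    using open_band by (intro borel_measurable_continuous_on_indicator continuous_on_subset[OF continuous]) auto
  then show ?thesis by (simp add: band_def[abs_def] mult.commute)
qed

lemma band_nonneg: "0 \<le> band \<alpha> \<beta> y"
  using positive[of y] by (auto simp: band_def indicator_def)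

text \<open>The band lies in the \<rho>-ball of radius \<beta> around 0. Symmetry of the distance
  enters here: \<open>rho_ball\<close> measures from 0 to \<open>y\<close>, and \<open>u\<close>
  from \<open>y\<close> to 0.\<close>

lemma band_integral_le:
  assumes "0 < \<beta>"
  shows "(\<integral>\<^sup>+y. ennreal (band \<alpha> \<beta> y ^ DIM('a)) \<partial>lborel) \<le> ennreal (B * \<beta> ^ DIM('a))"
proof -
  have "rho_dist \<rho> 0 y = ennreal (u y)" if "y \<in> ball 0 1" for y
    using rho_dist_inner[of 0 y] inner_dist_sym[of 0 y] rho_norm_inner[OF that] rho_norm_u[OF that] that by simp
  then have *: "y \<in> rho_ball \<rho> 0 \<beta>" if "y \<in> ball 0 1" "u y < \<beta>" for y
    using that u_nonneg[of y] by (simp add: rho_ball_def ennreal_less_iff)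
  have "(\<integral>\<^sup>+y. ennreal (band \<alpha> \<beta> y ^ DIM('a)) \<partial>lborel) \<le> (\<integral>\<^sup>+y\<in>rho_ball \<rho> 0 \<beta>. ennreal (\<rho> y ^ DIM('a)) \<partial>lborel)"
    using * by (intro nn_integral_mono) (auto simp: band_def indicator_def zero_power)
  also have "\<dots> \<le> ennreal (B * \<beta> ^ DIM('a))"
    using volume_growth assms unfolding volume_growth_def by auto
  finally show ?thesis .
qed

text \<open>On a subinterval whose interior stays in the band and whose ends lie on opposite sides,
  \<open>band\<close> agrees with \<rho> almost everywhere, and the \<rho>-length of this part
  bounds the difference of \<open>u\<close> at the ends.\<close>

lemma band_crossing:
  assumes ab: "a \<le> b" and im: "linepath p q ` {a..b} \<subseteq> ball 0 1" and lt: "\<alpha> < \<beta>"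
    and ends: "u (linepath p q a) \<le> \<alpha> \<and> \<beta> \<le> u (linepath p q b) \<or> u (linepath p q b) \<le> \<alpha> \<and> \<beta> \<le> u (linepath p q a)"
  shows "ennreal (\<beta> - \<alpha>) \<le> ennreal (norm (q - p)) * (\<integral>\<^sup>+s\<in>{a<..<b}. ennreal (band \<alpha> \<beta> (linepath p q s)) \<partial>lborel)"
proof -
  let ?\<gamma> = "linepath p q"
  have cg: "continuous_on {a..b} ?\<gamma>" by (intro continuous_intros)
  have c: "continuous_on {a..b} (\<lambda>s. u (?\<gamma> s))"
    by (rule continuous_on_compose2[OF u_continuous cg im])
  obtain s t where st: "a \<le> s" "s \<le> t" "t \<le> b" "\<And>r. s < r \<Longrightarrow> r < t \<Longrightarrow> \<alpha> < u (?\<gamma> r) \<and> u (?\<gamma> r) < \<beta>"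
    "u (?\<gamma> s) \<le> \<alpha> \<and> \<beta> \<le> u (?\<gamma> t) \<or> u (?\<gamma> t) \<le> \<alpha> \<and> \<beta> \<le> u (?\<gamma> s)"
    using continuous_crossing[OF c ab lt ends] by metis
  have inb: "?\<gamma> r \<in> ball 0 1" if "s \<le> r" "r \<le> t" for r
    using im that st by (auto simp: image_subset_iff simp del: mem_ball)
  have gap: "ennreal (\<beta> - \<alpha>) \<le> inner_dist \<rho> (?\<gamma> s) (?\<gamma> t)"
  proof -
    have aux: "ennreal (\<beta> - \<alpha>) \<le> X" if "ennreal v \<le> ennreal w + X" "\<beta> \<le> v" "w \<le> \<alpha>" "0 \<le> w" for v w X
    proof (cases X rule: ennreal_cases)
      case (real x)
      then have "ennreal v \<le> ennreal (w + x)" using that by (simp add: ennreal_plus)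
      then have "v \<le> w + x" using real(1) that(4) by (subst (asm) ennreal_le_iff) auto
      then show ?thesis using that real by (auto intro!: ennreal_leI)
    qed simp
    show ?thesis
      using st(5) u_le_add_inner[of "?\<gamma> s" "?\<gamma> t"] u_le_add_inner[of "?\<gamma> t" "?\<gamma> s"] inb[of s] inb[of t] st(2)
        u_nonneg inner_dist_sym[of "?\<gamma> s" "?\<gamma> t"]
      by (auto intro: aux)
  qed
  also have "\<dots> \<le> arc_integral \<rho> ?\<gamma> s t"
    using st inb by (intro inner_dist_subpath continuous_on_subset[OF cg]) auto
  also have "\<dots> = ennreal (norm (q - p)) * (\<integral>\<^sup>+r\<in>{s..t}. ennreal (\<rho> (?\<gamma> r)) \<partial>lborel)"
    using st inb by (intro arc_integral_linepath continuous_on_compose_curve continuous_on_subset[OF cg]) auto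
  also have "\<dots> \<le> ennreal (norm (q - p)) * (\<integral>\<^sup>+r\<in>{a<..<b}. ennreal (band \<alpha> \<beta> (?\<gamma> r)) \<partial>lborel)"
  proof (rule mult_left_mono)
    have "AE r in lborel. ennreal (\<rho> (?\<gamma> r)) * indicator {s..t} r \<le> ennreal (band \<alpha> \<beta> (?\<gamma> r)) * indicator {a<..<b} r"
      using AE_lborel_singleton[of s] AE_lborel_singleton[of t]
    proof eventually_elim
      case (elim r)
      show ?case
      proof (cases "r \<in> {s..t}")
        case True
        then have r: "s < r" "r < t" using elim by auto
        then have "band \<alpha> \<beta> (?\<gamma> r) = \<rho> (?\<gamma> r)" using st(4)[OF r] inb[of r] by (simp add: band_def)
        then show ?thesis using r st by auto
      qed simp
    qed
    then show "(\<integral>\<^sup>+r\<in>{s..t}. ennreal (\<rho> (?\<gamma> r)) \<partial>lborel) \<le> (\<integral>\<^sup>+r\<in>{a<..<b}. ennreal (band \<alpha> \<beta> (?\<gamma> r)) \<partial>lborel)"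
      by (rule nn_integral_mono_AE)
  qed simp
  finally show ?thesis .
qed

lemma radial_band_crossing:
  assumes \<omega>: "norm \<omega> = 1" and r: "0 \<le> t" "t \<le> r" "t \<le> r'" "r < 1" "r' < 1" and lt: "\<alpha> < \<beta>"
    and ends: "u (r *\<^sub>R \<omega>) \<le> \<alpha>" "\<beta> \<le> u (r' *\<^sub>R \<omega>)"
  shows "ennreal (\<beta> - \<alpha>) \<le> (\<integral>\<^sup>+s\<in>{t<..<1}. ennreal (band \<alpha> \<beta> (s *\<^sub>R \<omega>)) \<partial>lborel)"
proof -
  have L: "linepath 0 \<omega> s = s *\<^sub>R \<omega>" for s by (simp add: linepath_def)
  let ?a = "min r r'" and ?b = "max r r'"
  have "ennreal (\<beta> - \<alpha>) \<le> ennreal (norm (\<omega> - 0)) * (\<integral>\<^sup>+s\<in>{?a<..<?b}. ennreal (band \<alpha> \<beta> (linepath 0 \<omega> s)) \<partial>lborel)"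
  proof (rule band_crossing[OF _ _ lt])
    show "?a \<le> ?b" by simp
    show "linepath 0 \<omega> ` {?a..?b} \<subseteq> ball 0 1" unfolding L using r \<omega> by auto
    show "u (linepath 0 \<omega> ?a) \<le> \<alpha> \<and> \<beta> \<le> u (linepath 0 \<omega> ?b) \<or> u (linepath 0 \<omega> ?b) \<le> \<alpha> \<and> \<beta> \<le> u (linepath 0 \<omega> ?a)"
      unfolding L using ends by (auto simp: min_def max_def)
  qed
  also have "\<dots> = (\<integral>\<^sup>+s\<in>{?a<..<?b}. ennreal (band \<alpha> \<beta> (s *\<^sub>R \<omega>)) \<partial>lborel)"
    using \<omega> by (simp add: L)
  also have "\<dots> \<le> (\<integral>\<^sup>+s\<in>{t<..<1}. ennreal (band \<alpha> \<beta> (s *\<^sub>R \<omega>)) \<partial>lborel)"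
    using r by (intro nn_integral_mono) (auto simp: indicator_def)
  finally show ?thesis .
qed

text \<open>Crossing \<open>K\<close> dyadic levels along radii gains the factor \<open>K\<^sup>1\<^sup>-\<^sup>n\<close>, because the
  \<open>n\<close>-energy of the logarithm of \<open>u\<close> in \<open>K\<close> disjoint bands is only proportional to \<open>K\<close>.\<close>

lemma dyadic_crossing_measure:
  assumes E: "E \<in> sets borel" "E \<subseteq> sphere 0 1" and K: "0 < K" and \<beta>: "0 < \<beta>" and t: "1/2 \<le> t" "t < 1"
    and cross: "\<And>\<omega>. \<omega> \<in> E \<Longrightarrow> \<exists>r\<in>{t..<1}. \<exists>r'\<in>{t..<1}. u (r *\<^sub>R \<omega>) \<le> \<beta> / 2 ^ (K - 1) \<and> 2 * \<beta> \<le> u (r' *\<^sub>R \<omega>)"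
  shows "emeasure surface_measure E \<le> ennreal (8 ^ DIM('a) * B * ((1 - t) / K) ^ (DIM('a) - 1))"
proof -
  obtain m where m: "DIM('a) = Suc m" by (metis DIM_positive Suc_pred)
  define b where "b k = \<beta> / 2 ^ k" for k :: nat
  \<comment> \<open>With this threshold \<open>\<theta> * (1 - t)\<close> is \<open>K / 2\<close>,
    so what lies below the threshold accounts for at most half of the \<open>K\<close>
    crossings.\<close>
  define \<theta> where "\<theta> = K / (2 * (1 - t))"
  have b: "b k > 0" for k using \<beta> by (simp add: b_def)
  have \<theta>: "\<theta> > 0" using K t by (simp add: \<theta>_def)
  define V where "V k = {y \<in> ball 0 1. b k < u y \<and> u y < 2 * b k}" for k
  \<comment> \<open>Division by \<open>b k\<close> gives every crossing a length of at least 1. It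
    also makes the energy bound the same for all bands, because volume growth has order n.\<close>
  define G where "G k y = band (b k) (2 * b k) y / b k" for k and y :: 'a
  have G0: "0 \<le> G k y" for k y using band_nonneg b by (simp add: G_def less_imp_le)
  have [measurable]: "G k \<in> borel_measurable borel" for k unfolding G_def by measurable
  have [measurable]: "V k \<in> sets borel" for k using open_band[of "b k" "2 * b k"] by (simp add: V_def)
  define H where "H y = (\<Sum>k<K. ennreal (G k y ^ Suc m / \<theta> ^ m))" for y
  have [measurable]: "H \<in> borel_measurable borel" unfolding H_def by measurable
  have b_mono: "b j \<le> b i" if "i \<le> j" for i j
    unfolding b_def using that \<beta> by (intro divide_left_mono power_increasing) auto
  have b_half: "2 * b j \<le> b i" if "i < j" for i j
    using b_mono[of "Suc i" j] that by (simp add: b_def)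
  have uniq: "i = j" if "y \<in> V i" "y \<in> V j" for i j y
  proof (rule ccontr)
    assume "i \<noteq> j"
    then consider "i < j" | "j < i" by linarith
    then show False using that b_half[of i j] b_half[of j i] by cases (auto simp: V_def)
  qed
  have half: "ennreal (real K / 2) \<le> (\<integral>\<^sup>+r\<in>{t<..<1}. H (r *\<^sub>R \<omega>) \<partial>lborel)" if \<omega>: "\<omega> \<in> E" for \<omega>
  proof -
    have n1: "norm \<omega> = 1" using \<omega> E by auto
    obtain r r' where r: "r \<in> {t..<1}" "r' \<in> {t..<1}" "u (r *\<^sub>R \<omega>) \<le> b (K - 1)" "2 * b 0 \<le> u (r' *\<^sub>R \<omega>)"
      using cross[OF \<omega>] by (auto simp: b_def)
    have one: "1 \<le> (\<integral>\<^sup>+s\<in>{t<..<1}. ennreal (G k (s *\<^sub>R \<omega>)) \<partial>lborel)" if k: "k < K" for k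
    proof -
      have "ennreal (2 * b k - b k) \<le> (\<integral>\<^sup>+s\<in>{t<..<1}. ennreal (band (b k) (2 * b k) (s *\<^sub>R \<omega>)) \<partial>lborel)"
      proof (rule radial_band_crossing[OF n1])
        have "b (K - 1) \<le> b k" using k by (intro b_mono) linarith
        then show "u (r *\<^sub>R \<omega>) \<le> b k" using r(3) by linarith
        show "2 * b k \<le> u (r' *\<^sub>R \<omega>)" using r(4) b_mono[of 0 k] by simp
      qed (use r t b[of k] in auto)
      also have "\<dots> = (\<integral>\<^sup>+s. ennreal (b k) * (ennreal (G k (s *\<^sub>R \<omega>)) * indicator {t<..<1} s) \<partial>lborel)"
        using b[of k] band_nonneg by (intro nn_integral_cong) (auto simp: G_def ennreal_mult[symmetric] indicator_def)
      also have "\<dots> = ennreal (b k) * (\<integral>\<^sup>+s\<in>{t<..<1}. ennreal (G k (s *\<^sub>R \<omega>)) \<partial>lborel)"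
        by (intro nn_integral_cmult) measurable
      finally have "ennreal (1 / b k) * ennreal (b k) \<le> ennreal (1 / b k) * (ennreal (b k) * (\<integral>\<^sup>+s\<in>{t<..<1}. ennreal (G k (s *\<^sub>R \<omega>)) \<partial>lborel))"
        by (intro mult_left_mono) auto
      then show ?thesis using b[of k] by (simp add: mult.assoc[symmetric] ennreal_mult[symmetric])
    qed
    have "ennreal (real K) = (\<Sum>k<K. 1)" by (simp add: ennreal_of_nat_eq_real_of_nat)
    also have "\<dots> \<le> (\<Sum>k<K. \<integral>\<^sup>+s\<in>{t<..<1}. ennreal (G k (s *\<^sub>R \<omega>)) \<partial>lborel)"
      using one by (intro sum_mono) auto
    also have "\<dots> = (\<integral>\<^sup>+s. (\<Sum>k<K. ennreal (G k (s *\<^sub>R \<omega>)) * indicator {t<..<1} s) \<partial>lborel)"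
      by (intro nn_integral_sum[symmetric]) measurable
    also have "\<dots> \<le> (\<integral>\<^sup>+s. ennreal \<theta> * indicator {t<..<1} s + H (s *\<^sub>R \<omega>) * indicator {t<..<1} s \<partial>lborel)"
    proof (rule nn_integral_mono)
      fix s :: real
      let ?y = "s *\<^sub>R \<omega>"
      show "(\<Sum>k<K. ennreal (G k ?y) * indicator {t<..<1} s) \<le> ennreal \<theta> * indicator {t<..<1} s + H ?y * indicator {t<..<1} s"
      proof (cases "s \<in> {t<..<1}")
        case True
        have "ennreal (G k ?y) \<le> ennreal \<theta> * indicator (V k) ?y + ennreal (G k ?y ^ Suc m / \<theta> ^ m)" for k
        proof (cases "?y \<in> V k")
          case True
          have "ennreal (G k ?y) \<le> ennreal (\<theta> + G k ?y ^ Suc m / \<theta> ^ m)"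
            by (intro ennreal_leI le_threshold_power G0 \<theta>)
          also have "\<dots> = ennreal \<theta> + ennreal (G k ?y ^ Suc m / \<theta> ^ m)"
            using \<theta> G0[of k ?y] by (intro ennreal_plus) auto
          finally show ?thesis using True by simp
        next
          case False
          then have "G k ?y = 0" by (auto simp: G_def band_def V_def)
          then show ?thesis by simp
        qed
        then have "(\<Sum>k<K. ennreal (G k ?y)) \<le> (\<Sum>k<K. ennreal \<theta> * indicator (V k) ?y + ennreal (G k ?y ^ Suc m / \<theta> ^ m))"
          by (intro sum_mono)
        also have "\<dots> = (\<Sum>k<K. ennreal \<theta> * indicator (V k) ?y) + H ?y"
          by (simp add: sum.distrib H_def)
        \<comment> \<open>At any point at most one band is active, so the threshold is paid once and
          not \<open>K\<close> times; this is the source of the gain.\<close>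
        also have "(\<Sum>k<K. ennreal \<theta> * indicator (V k) ?y) \<le> ennreal \<theta>"
          by (rule sum_le_single) (auto simp: indicator_def intro: uniq split: if_splits)
        finally show ?thesis using True by (simp add: add_right_mono)
      qed simp
    qed
    also have "\<dots> = (\<integral>\<^sup>+s. ennreal \<theta> * indicator {t<..<1} s \<partial>lborel) + (\<integral>\<^sup>+s. H (s *\<^sub>R \<omega>) * indicator {t<..<1} s \<partial>lborel)"
      by (intro nn_integral_add) measurable
    also have "(\<integral>\<^sup>+s. ennreal \<theta> * indicator {t<..<1} s \<partial>lborel) = ennreal (real K / 2)"
    proof -
      have "x / (2 * d) * d = x / 2" if "d \<noteq> 0" for x d :: real using that by simp
      from this[of "1 - t" "real K"] have "\<theta> * (1 - t) = real K / 2" using t unfolding \<theta>_def by linarith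
      then show ?thesis using t \<theta> by (simp add: nn_integral_cmult_indicator ennreal_mult[symmetric])
    qed
    finally have le: "ennreal (real K) \<le> ennreal (real K / 2) + (\<integral>\<^sup>+s. H (s *\<^sub>R \<omega>) * indicator {t<..<1} s \<partial>lborel)" .
    have "ennreal (real K) = ennreal (real K / 2) + ennreal (real K / 2)" by (subst ennreal_plus[symmetric]) auto
    then show ?thesis using le by (metis ennreal_add_left_cancel_le ennreal_neq_top infinity_ennreal_def)
  qed
  have "ennreal (real K / 2) * emeasure surface_measure E
      \<le> ennreal (2 ^ (DIM('a) - 1)) * (\<integral>\<^sup>+y\<in>ball 0 1. H y \<partial>lborel)"
    by (rule radial_length_area[OF _ E t(1) half]) measurable
  also have "(\<integral>\<^sup>+y\<in>ball 0 1. H y \<partial>lborel) \<le> (\<integral>\<^sup>+y. H y \<partial>lborel)"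
    by (intro nn_integral_mono) (auto simp: indicator_def)
  also have "\<dots> = (\<Sum>k<K. \<integral>\<^sup>+y. ennreal (G k y ^ Suc m / \<theta> ^ m) \<partial>lborel)"
    unfolding H_def by (intro nn_integral_sum) measurable
  also have "\<dots> \<le> (\<Sum>k<K. ennreal (2 ^ Suc m * B / \<theta> ^ m))"
  proof (rule sum_mono)
    fix k
    let ?c = "1 / (b k ^ Suc m * \<theta> ^ m)"
    have c: "0 \<le> ?c" using b[of k] \<theta> by simp
    have "(\<integral>\<^sup>+y. ennreal (G k y ^ Suc m / \<theta> ^ m) \<partial>lborel) = (\<integral>\<^sup>+y. ennreal ?c * ennreal (band (b k) (2 * b k) y ^ Suc m) \<partial>lborel)"
      using c band_nonneg by (intro nn_integral_cong) (simp add: G_def power_divide ennreal_mult[symmetric] del: power_Suc)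
    also have "\<dots> = ennreal ?c * (\<integral>\<^sup>+y. ennreal (band (b k) (2 * b k) y ^ Suc m) \<partial>lborel)"
      by (intro nn_integral_cmult) measurable
    also have "\<dots> \<le> ennreal ?c * ennreal (B * (2 * b k) ^ Suc m)"
      using band_integral_le[of "2 * b k" "b k"] b[of k] by (intro mult_left_mono) (auto simp: m)
    also have "\<dots> = ennreal (?c * (B * (2 * b k) ^ Suc m))" using c b[of k] B by (intro ennreal_mult[symmetric]) auto
    also have "?c * (B * (2 * b k) ^ Suc m) = 2 ^ Suc m * B / \<theta> ^ m"
      using b[of k] \<theta> by (simp add: power_mult_distrib)
    finally show "(\<integral>\<^sup>+y. ennreal (G k y ^ Suc m / \<theta> ^ m) \<partial>lborel) \<le> ennreal (2 ^ Suc m * B / \<theta> ^ m)" .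
  qed
  also have "\<dots> = ennreal (real K * (2 ^ Suc m * B / \<theta> ^ m))"
    using B \<theta> by (subst ennreal_mult) (auto simp: ennreal_of_nat_eq_real_of_nat)
  finally have "ennreal (real K / 2) * emeasure surface_measure E \<le> ennreal (2 ^ m) * ennreal (real K * (2 ^ Suc m * B / \<theta> ^ m))"
    by (simp add: m mult_left_mono)
  also have "\<dots> = ennreal (2 ^ m * (real K * (2 ^ Suc m * B / \<theta> ^ m)))"
    using B \<theta> by (intro ennreal_mult[symmetric]) auto
  finally have "emeasure surface_measure E \<le> ennreal (2 ^ m * (real K * (2 ^ Suc m * B / \<theta> ^ m)) / (real K / 2))"
    using K B \<theta> by (intro ennreal_mult_le_divide) auto
  also have "2 ^ m * (real K * (2 ^ Suc m * B / \<theta> ^ m)) / (real K / 2) \<le> 8 ^ DIM('a) * B * ((1 - t) / K) ^ (DIM('a) - 1)"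
  proof -
    have "1 / \<theta> ^ m = (1 / \<theta>) ^ m" by (simp add: power_one_over)
    also have "1 / \<theta> = 2 * ((1 - t) / K)" by (simp add: \<theta>_def)
    also have "(2 * ((1 - t) / K)) ^ m = 2 ^ m * ((1 - t) / K) ^ m" by (rule power_mult_distrib)
    finally have W: "1 / \<theta> ^ m = 2 ^ m * ((1 - t) / K) ^ m" .
    have "2 ^ m * (real K * (2 ^ Suc m * B / \<theta> ^ m)) / (real K / 2) = 2 ^ m * 2 ^ Suc m * 2 * B * (1 / \<theta> ^ m)"
      using K by simp
    also have "\<dots> = 2 ^ m * 2 ^ Suc m * 2 * 2 ^ m * (B * ((1 - t) / K) ^ m)"
      unfolding W by (simp only: mult_ac)
    finally have "2 ^ m * (real K * (2 ^ Suc m * B / \<theta> ^ m)) / (real K / 2)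
      = 2 ^ m * 2 ^ Suc m * 2 * 2 ^ m * (B * ((1 - t) / K) ^ m)" .
    also have "(2::real) ^ m * 2 ^ Suc m * 2 * 2 ^ m = 4 * (2 * 2 * 2) ^ m"
      unfolding power_mult_distrib by simp
    also have "4 * (2 * 2 * 2) ^ m * (B * ((1 - t) / K) ^ m) \<le> 8 * (2 * 2 * 2) ^ m * (B * ((1 - t) / K) ^ m)"
      using B t by (intro mult_right_mono) auto
    finally show ?thesis by (simp add: m)
  qed
  finally show ?thesis by (simp add: ennreal_leI)
qed

end

section \<open>Auxiliary facts: shrinking sets, Borel level times, large coordinates\<close>

lemma decreasing_nn_integral_tendsto_0:
  assumes f: "f \<in> borel_measurable M" and dec: "decseq S" and S: "\<And>i::nat. S i \<in> sets M"
    and fin: "(\<integral>\<^sup>+x\<in>S 0. f x \<partial>M) < \<infinity>" and z: "\<And>x. (\<forall>i. x \<in> S i) \<Longrightarrow> f x = 0"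
  shows "(\<lambda>i. \<integral>\<^sup>+x\<in>S i. f x \<partial>M) \<longlonglongrightarrow> 0"
proof -
  let ?N = "density M f"
  have e: "emeasure ?N (S i) = (\<integral>\<^sup>+x\<in>S i. f x \<partial>M)" for i
    using f S by (intro emeasure_density) auto
  have le: "emeasure ?N (S i) \<le> emeasure ?N (S 0)" for i
    using dec S[of 0] by (intro emeasure_mono) (auto simp: decseq_def)
  have "(\<lambda>i. emeasure ?N (S i)) \<longlonglongrightarrow> emeasure ?N (\<Inter>i. S i)"
  proof (rule Lim_emeasure_decseq)
    show "range S \<subseteq> sets ?N" using S by auto
    show "emeasure ?N (S i) \<noteq> \<infinity>" for i using le[of i] fin e[of 0] by (auto simp: top_unique)
  qed (use dec in auto)
  moreover have "emeasure ?N (\<Inter>i. S i) = 0"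
  proof -
    have "emeasure ?N (\<Inter>i. S i) = (\<integral>\<^sup>+x\<in>(\<Inter>i. S i). f x \<partial>M)"
      using f S by (intro emeasure_density) auto
    also have "\<dots> = (\<integral>\<^sup>+x. 0 \<partial>M)" using z by (intro nn_integral_cong) (auto simp: indicator_def)
    finally show ?thesis by simp
  qed
  ultimately show ?thesis by (simp add: e)
qed

text \<open>The first time at which \<open>f\<close> is at least \<tau> is monotone in \<tau>, hence
  Borel, and the intermediate value theorem makes the value there equal to \<tau>. The value
  \<open>b\<close> for \<tau> above \<open>f b\<close> keeps \<open>s\<close> monotone on the whole
  line.\<close>

lemma borel_level_selection_up:
  fixes f :: "real \<Rightarrow> real"
  assumes c: "continuous_on {a..b} f" and ab: "a \<le> b" and le: "f a \<le> f b"
  obtains s where "s \<in> borel_measurable borel" "\<And>\<tau>. f a \<le> \<tau> \<Longrightarrow> \<tau> \<le> f b \<Longrightarrow> s \<tau> \<in> {a..b} \<and> f (s \<tau>) = \<tau>"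
proof -
  define S where "S \<tau> = {a..b} \<inter> f -` {\<tau>..}" for \<tau>
  define s where "s \<tau> = (if \<tau> > f b then b else Inf (S \<tau>))" for \<tau>
  have bS: "b \<in> S \<tau>" if "\<tau> \<le> f b" for \<tau> using that ab by (simp add: S_def)
  have bd: "bdd_below (S \<tau>)" for \<tau> by (rule bdd_belowI[of _ a]) (simp add: S_def)
  have le_b: "Inf (S \<tau>) \<le> b" if "\<tau> \<le> f b" for \<tau> using cInf_lower[OF bS[OF that] bd] .
  have "mono s"
  proof (rule monoI)
    fix x y :: real assume xy: "x \<le> y"
    show "s x \<le> s y"
    proof (cases "y > f b")
      case True then show ?thesis using le_b[of x] by (auto simp: s_def)
    next
      case False
      then have "Inf (S x) \<le> Inf (S y)"
        using bS[of y] bd[of x] xy by (intro cInf_superset_mono) (auto simp: S_def)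
      then show ?thesis using False xy by (simp add: s_def)
    qed
  qed
  then have "s \<in> borel_measurable borel" by (rule borel_measurable_mono)
  moreover have "s \<tau> \<in> {a..b} \<and> f (s \<tau>) = \<tau>" if \<tau>: "f a \<le> \<tau>" "\<tau> \<le> f b" for \<tau>
  proof -
    have s: "s \<tau> = Inf (S \<tau>)" using \<tau> by (simp add: s_def)
    have "closed (S \<tau>)" unfolding S_def by (rule continuous_closed_preimage[OF c]) auto
    then have mem: "Inf (S \<tau>) \<in> S \<tau>" using bS[OF \<tau>(2)] bd by (intro closed_contains_Inf) auto
    have "\<exists>r. a \<le> r \<and> r \<le> Inf (S \<tau>) \<and> f r = \<tau>"
      using mem \<tau>(1) by (intro IVT' continuous_on_subset[OF c]) (auto simp: S_def)
    then obtain r where r: "a \<le> r" "r \<le> Inf (S \<tau>)" "f r = \<tau>" by blast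
    then have "r \<in> S \<tau>" using mem by (auto simp: S_def)
    then have "Inf (S \<tau>) \<le> r" by (rule cInf_lower[OF _ bd])
    then have "r = Inf (S \<tau>)" using r by simp
    then show ?thesis using r mem s by (auto simp: S_def)
  qed
  ultimately show ?thesis by (rule that)
qed

lemma borel_level_selection:
  fixes f :: "real \<Rightarrow> real"
  assumes c: "continuous_on {a..b} f" and ab: "a \<le> b"
  obtains s where "s \<in> borel_measurable borel"
    "\<And>\<tau>. min (f a) (f b) \<le> \<tau> \<Longrightarrow> \<tau> \<le> max (f a) (f b) \<Longrightarrow> s \<tau> \<in> {a..b} \<and> f (s \<tau>) = \<tau>"
proof (cases "f a \<le> f b")
  case True
  then show ?thesis using borel_level_selection_up[OF c ab True] that by (metis max_def min_def)
next
  case False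
  have c': "continuous_on {a..b} (\<lambda>x. - f x)" by (intro continuous_intros c)
  obtain s where s[measurable]: "s \<in> borel_measurable borel"
    and s2: "\<And>\<tau>. - f a \<le> \<tau> \<Longrightarrow> \<tau> \<le> - f b \<Longrightarrow> s \<tau> \<in> {a..b} \<and> - f (s \<tau>) = \<tau>"
    using borel_level_selection_up[OF c' ab] False by auto
  show ?thesis
  proof (rule that)
    show "(\<lambda>\<tau>. s (- \<tau>)) \<in> borel_measurable borel" by measurable
    fix \<tau> assume "min (f a) (f b) \<le> \<tau>" "\<tau> \<le> max (f a) (f b)"
    then show "s (- \<tau>) \<in> {a..b} \<and> f (s (- \<tau>)) = \<tau>" using s2[of "- \<tau>"] False by auto
  qed
qed

lemma exists_large_coordinate:
  fixes x :: "'a::euclidean_space"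
  shows "\<exists>e\<in>Basis. norm x \<le> DIM('a) * \<bar>x \<bullet> e\<bar>"
proof (rule ccontr)
  assume "\<not> ?thesis"
  then have *: "\<bar>x \<bullet> e\<bar> < norm x / DIM('a)" if "e \<in> Basis" for e
    using that by (auto simp: not_le field_simps)
  have "norm x \<le> (\<Sum>e\<in>Basis. \<bar>x \<bullet> e\<bar>)" by (rule norm_le_l1)
  also have "\<dots> < (\<Sum>e\<in>(Basis::'a set). norm x / DIM('a))"
    by (rule sum_strict_mono) (use * in auto)
  also have "\<dots> = norm x" by simp
  finally show False by simp
qed

section \<open>Shadows of points on the sphere and Harnack chains\<close>

context conformal begin

text \<open>For each fixed \<open>r\<close> the condition on \<omega> is open, and a union of open
  sets is open however large \<open>T\<close> is.\<close>

lemma radial_level_sets: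
  assumes T: "T \<subseteq> {0..<1}" and V: "open V"
  shows "{\<omega> \<in> sphere 0 1. \<exists>r\<in>T. u (r *\<^sub>R \<omega>) \<in> V} \<in> sets borel"
proof -
  have "open (ball 0 1 \<inter> u -` V)"
    by (intro continuous_open_preimage u_continuous V) auto
  then have "open ((\<lambda>\<omega>. r *\<^sub>R \<omega>) -` (ball 0 1 \<inter> u -` V))" for r :: real
    by (intro open_vimage continuous_intros)
  then have o: "open (\<Union>r\<in>T. (\<lambda>\<omega>. r *\<^sub>R \<omega>) -` (ball 0 1 \<inter> u -` V))" by blast
  have "r *\<^sub>R \<omega> \<in> ball 0 1" if "norm \<omega> = 1" "r \<in> T" for r and \<omega> :: 'a
    using that T by auto
  then have "{\<omega> \<in> sphere 0 1. \<exists>r\<in>T. u (r *\<^sub>R \<omega>) \<in> V}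
      = sphere 0 1 \<inter> (\<Union>r\<in>T. (\<lambda>\<omega>. r *\<^sub>R \<omega>) -` (ball 0 1 \<inter> u -` V))"
    by auto
  also have "\<dots> \<in> sets borel" by (intro sets.Int borel_open[OF o] borel_closed closed_sphere)
  finally show ?thesis .
qed

lemma radial_low_sets:
  assumes "T \<subseteq> {0..<1}"
  shows "{\<omega> \<in> sphere 0 1. \<exists>r\<in>T. u (r *\<^sub>R \<omega>) < b} \<in> sets borel"
    and "{\<omega> \<in> sphere 0 1. \<exists>r\<in>T. b < u (r *\<^sub>R \<omega>)} \<in> sets borel"
  using radial_level_sets[OF assms, of "{..<b}"] radial_level_sets[OF assms, of "{b<..}"] by auto

text \<open>The case \<open>K = 1\<close> of \<open>dyadic_crossing_measure\<close>: every radius in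
  the set rises from at most \<open>l\<close> to above \<open>2 * l\<close> and so crosses a single
  band.\<close>

lemma radial_high_measure:
  assumes r: "1/2 \<le> r" "r < 1" and l: "0 < l" and low: "\<And>\<omega>. norm \<omega> = 1 \<Longrightarrow> u (r *\<^sub>R \<omega>) \<le> l"
  shows "emeasure surface_measure {\<omega> \<in> sphere 0 1. \<exists>t\<in>{r..<1}. 2 * l < u (t *\<^sub>R \<omega>)}
    \<le> ennreal (8 ^ DIM('a) * B * (1 - r) ^ (DIM('a) - 1))"
proof -
  let ?E = "{\<omega> \<in> sphere 0 1. \<exists>t\<in>{r..<1}. 2 * l < u (t *\<^sub>R \<omega>)}"
  have "emeasure surface_measure ?E \<le> ennreal (8 ^ DIM('a) * B * ((1 - r) / real 1) ^ (DIM('a) - 1))"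
  proof (rule dyadic_crossing_measure[where \<beta>=l])
    show "?E \<in> sets borel" by (rule radial_low_sets) (use r in auto)
    show "\<exists>s\<in>{r..<1}. \<exists>s'\<in>{r..<1}. u (s *\<^sub>R \<omega>) \<le> l / 2 ^ (1 - 1) \<and> 2 * l \<le> u (s' *\<^sub>R \<omega>)" if \<omega>: "\<omega> \<in> ?E" for \<omega>
    proof -
      obtain t where "t \<in> {r..<1}" "2 * l < u (t *\<^sub>R \<omega>)" "norm \<omega> = 1" using \<omega> by auto
      then show ?thesis using r low[of \<omega>] by (intro bexI[of _ r] bexI[of _ t]) auto
    qed
  qed (use r l in auto)
  then show ?thesis by simp
qed

text \<open>The set \<open>G\<close> is a cap below \<open>x\<close> without the radii on which \<open>u\<close> drops from \<open>u x / 2\<close>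
  by a large factor; these have small measure because \<open>n \<ge> 2\<close>.\<close>

lemma shadow_measure:
  assumes dim: "DIM('a) \<ge> 2"
  obtains c c' where "0 < c" "0 < c'"
    "\<And>x. x \<in> ball 0 1 \<Longrightarrow> 1/2 \<le> norm x \<Longrightarrow> 0 < u x \<Longrightarrow>
      \<exists>G\<in>sets borel. G \<subseteq> sphere 0 1 \<and> (\<forall>\<omega>\<in>G. \<forall>R\<in>{norm x..<1}. c * u x \<le> u (R *\<^sub>R \<omega>)) \<and>
        ennreal (c' * (1 - norm x) ^ (DIM('a) - 1)) \<le> emeasure surface_measure G"
proof -
  let ?n = "DIM('a)"
  \<comment> \<open>Chosen so that \<open>u\<close> loses at most half of \<open>u x\<close> between
    \<open>x\<close> and the points of the same norm over the cap: the loss is bounded by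
    \<open>A * \<eta> * (4 * A * u x)\<close>.\<close>
  define \<eta> where "\<eta> = 1 / (8 * A * A)"
  have AA: "1 \<le> A * A" using mult_mono[of 1 A 1 A] A by simp
  have \<eta>: "0 < \<eta>" "\<eta> \<le> 1/8" using AA unfolding \<eta>_def by (auto simp: field_simps)
  define \<kappa> where "\<kappa> = unit_ball_vol ?n / 8 ^ ?n"
  have \<kappa>: "\<kappa> > 0" by (simp add: \<kappa>_def)
  \<comment> \<open>\<open>K \<ge> q\<close> makes the bound for the exceptional radii at most half
    of the lower bound for the measure of the cap. The former carries the factor K^(1-n), which
    becomes small with large \<open>K\<close> since n >= 2.\<close>
  define q where "q = 2 * (8 ^ ?n * B) / (\<kappa> * \<eta> ^ (?n - 1))"
  define K where "K = Suc (nat \<lceil>q\<rceil>)"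
  have qK: "q \<le> real K" unfolding K_def by linarith
  have K1: "1 \<le> real K" "0 < K" by (auto simp: K_def)
  have KK: "8 ^ ?n * B * (s / K) ^ (?n - 1) \<le> \<kappa> / 2 * (\<eta> * s) ^ (?n - 1)" if s: "0 \<le> s" for s
  proof -
    have "real K ^ 1 \<le> real K ^ (?n - 1)" using K1 dim by (intro power_increasing) auto
    then have "q \<le> real K ^ (?n - 1)" unfolding power_one_right using qK by (rule order_trans[rotated])
    then have "8 ^ ?n * B \<le> \<kappa> / 2 * \<eta> ^ (?n - 1) * real K ^ (?n - 1)"
      using \<kappa> \<eta>(1) unfolding q_def by (simp add: field_simps)
    then have "8 ^ ?n * B / real K ^ (?n - 1) \<le> \<kappa> / 2 * \<eta> ^ (?n - 1)"
      using K1 by (simp add: divide_le_eq)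
    then have "8 ^ ?n * B / real K ^ (?n - 1) * s ^ (?n - 1) \<le> \<kappa> / 2 * \<eta> ^ (?n - 1) * s ^ (?n - 1)"
      using s by (intro mult_right_mono) auto
    then show ?thesis by (simp add: power_divide power_mult_distrib mult.assoc)
  qed
  define c :: real where "c = 1 / (4 * 2 ^ (K - 1))"
  define c' where "c' = \<kappa> / 2 * \<eta> ^ (?n - 1)"
  show thesis
  proof (rule that[of c c'])
    show "0 < c" "0 < c'" using \<kappa> \<eta> by (auto simp: c_def c'_def)
    fix x :: 'a assume x: "x \<in> ball 0 1" "1/2 \<le> norm x" and ux: "0 < u x"
    define s where "s = 1 - norm x"
    define e where "e = x /\<^sub>R norm x"
    have s: "0 < s" "s \<le> 1" using x by (auto simp: s_def)
    have "norm x > 0" using x(2) by linarith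
    then have ne: "norm e = 1" and xe: "x = norm x *\<^sub>R e" by (auto simp: e_def)
    define C where "C = sphere 0 1 \<inter> ball e (\<eta> * s)"
    \<comment> \<open>Over the cap \<open>u\<close> starts at \<open>u x / 2\<close> or more. The
      top dyadic level is \<open>u x / 4\<close>, so the start is at least twice that level, and a
      radius in \<open>E\<close> falls below the lowest of the \<open>K\<close> levels.\<close>
    define E where "E = C \<inter> {\<omega> \<in> sphere 0 1. \<exists>r\<in>{norm x..<1}. u (r *\<^sub>R \<omega>) < u x / 4 / 2 ^ (K - 1)}"
    have Cb: "C \<in> sets borel" unfolding C_def by (intro sets.Int borel_closed borel_open) auto
    have Eb: "E \<in> sets borel" unfolding E_def
      by (intro sets.Int[OF Cb] radial_low_sets(1)) (use \<open>norm x > 0\<close> in auto)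
    have start: "u x / 2 \<le> u (norm x *\<^sub>R \<omega>)" if "\<omega> \<in> C" for \<omega>
    proof -
      have "norm (x - norm x *\<^sub>R \<omega>) = norm x * norm (e - \<omega>)"
        using xe by (metis abs_norm_cancel norm_scaleR scaleR_diff_right)
      also have "\<dots> \<le> 1 * norm (e - \<omega>)" using x by (intro mult_right_mono) auto
      also have "\<dots> \<le> \<eta> * s" using that by (simp add: C_def dist_norm)
      finally have d: "norm (x - norm x *\<^sub>R \<omega>) \<le> \<eta> * s" .
      also have "\<dots> < s / 2" using \<eta> s by (simp add: field_simps)
      finally have W: "norm x *\<^sub>R \<omega> \<in> whitney_ball x" by (simp add: whitney_ball_def dist_norm s_def)
      have "u x \<le> u (norm x *\<^sub>R \<omega>) + A * \<rho> x * norm (x - norm x *\<^sub>R \<omega>)"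
        by (rule u_whitney_lipschitz[OF x(1) centre_whitney_ball[OF x(1)] W])
      also have "A * \<rho> x * norm (x - norm x *\<^sub>R \<omega>) \<le> A * \<rho> x * (\<eta> * s)"
        using d A positive[OF x(1)] by (intro mult_left_mono) auto
      also have "\<dots> = A * \<eta> * (\<rho> x * (1 - norm x))" by (simp add: s_def)
      also have "\<dots> \<le> A * \<eta> * (4 * A * u x)"
        using density_le_u[OF x] A \<eta> by (intro mult_left_mono) auto
      also have "\<dots> = u x / 2" using A by (simp add: \<eta>_def field_simps)
      finally show ?thesis by simp
    qed
    have "emeasure surface_measure E \<le> ennreal (8 ^ ?n * B * ((1 - norm x) / K) ^ (?n - 1))"
    proof (rule dyadic_crossing_measure[OF Eb _ K1(2), where \<beta>="u x / 4"])
      show "\<exists>r\<in>{norm x..<1}. \<exists>r'\<in>{norm x..<1}. u (r *\<^sub>R \<omega>) \<le> u x / 4 / 2 ^ (K - 1) \<and> 2 * (u x / 4) \<le> u (r' *\<^sub>R \<omega>)"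
        if "\<omega> \<in> E" for \<omega>
      proof -
        obtain r where r: "r \<in> {norm x..<1}" "u (r *\<^sub>R \<omega>) < u x / 4 / 2 ^ (K - 1)" "\<omega> \<in> C"
          using \<open>\<omega> \<in> E\<close> by (auto simp: E_def)
        then show ?thesis using start[OF r(3)] x by (intro bexI[of _ r] bexI[of _ "norm x"]) auto
      qed
    qed (use x ux in \<open>auto simp: E_def C_def\<close>)
    also have "\<dots> \<le> ennreal (\<kappa> / 2 * (\<eta> * s) ^ (?n - 1))"
      using KK[of s] s unfolding s_def by (intro ennreal_leI) auto
    finally have mE: "emeasure surface_measure E \<le> ennreal (\<kappa> / 2 * (\<eta> * s) ^ (?n - 1))" .
    have "\<eta> * s \<le> 1 * 1" using \<eta> s by (intro mult_mono) auto
    then have "ennreal (\<kappa> * (\<eta> * s) ^ (?n - 1)) \<le> emeasure surface_measure C"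
      unfolding \<kappa>_def C_def using \<eta> s by (intro surface_cap_lower_bound[OF ne]) auto
    also have "\<dots> \<le> emeasure surface_measure (E \<union> (C - E))"
      using Cb Eb by (intro emeasure_mono) (auto simp: C_def E_def intro!: sets_surface_measure)
    also have "\<dots> \<le> emeasure surface_measure E + emeasure surface_measure (C - E)"
      using Cb Eb by (intro emeasure_subadditive sets_surface_measure) (auto simp: C_def E_def)
    also have "\<dots> \<le> ennreal (\<kappa> / 2 * (\<eta> * s) ^ (?n - 1)) + emeasure surface_measure (C - E)"
      by (intro add_right_mono mE)
    finally have le: "ennreal (\<kappa> * (\<eta> * s) ^ (?n - 1)) \<le> ennreal (\<kappa> / 2 * (\<eta> * s) ^ (?n - 1)) + emeasure surface_measure (C - E)" .
    let ?h = "\<kappa> / 2 * (\<eta> * s) ^ (?n - 1)"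
    have "\<kappa> * (\<eta> * s) ^ (?n - 1) = ?h + ?h" by simp
    moreover have "0 \<le> ?h" using \<kappa> \<eta> s by simp
    ultimately have "ennreal ?h + ennreal ?h \<le> ennreal ?h + emeasure surface_measure (C - E)"
      using le by (metis ennreal_plus)
    then have "ennreal ?h \<le> emeasure surface_measure (C - E)"
      by (metis ennreal_add_left_cancel_le ennreal_neq_top infinity_ennreal_def)
    moreover have "?h = c' * (1 - norm x) ^ (?n - 1)" by (simp add: c'_def s_def power_mult_distrib)
    moreover have "\<forall>\<omega>\<in>C - E. \<forall>R\<in>{norm x..<1}. c * u x \<le> u (R *\<^sub>R \<omega>)"
    proof (intro ballI, rule ccontr)
      fix \<omega> R assume \<omega>: "\<omega> \<in> C - E" and R: "R \<in> {norm x..<1}" and "\<not> c * u x \<le> u (R *\<^sub>R \<omega>)"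
      then have "u (R *\<^sub>R \<omega>) < u x / 4 / 2 ^ (K - 1)" by (simp add: c_def not_le)
      then have "\<omega> \<in> E" using \<omega> R unfolding E_def C_def by blast
      then show False using \<omega> by simp
    qed
    ultimately show "\<exists>G\<in>sets borel. G \<subseteq> sphere 0 1 \<and> (\<forall>\<omega>\<in>G. \<forall>R\<in>{norm x..<1}. c * u x \<le> u (R *\<^sub>R \<omega>)) \<and>
        ennreal (c' * (1 - norm x) ^ (?n - 1)) \<le> emeasure surface_measure G"
      using Cb Eb by (intro bexI[of _ "C - E"]) (auto simp: C_def)
  qed
qed

text \<open>The first step covers the fraction \<open>1 / Suc N\<close> of the way, at most
  \<open>h / 4\<close>, and so stays in the Whitney ball of \<open>x\<close>; convexity keeps the
  new point in the ball of radius \<open>1 - h\<close>, from where the induction continues.\<close>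

lemma harnack_chain:
  assumes "0 < h"
  shows "x \<in> ball 0 1 \<Longrightarrow> h \<le> 1 - norm x \<Longrightarrow> h \<le> 1 - norm y \<Longrightarrow> norm (y - x) \<le> real N * (h / 4) \<Longrightarrow> \<rho> y \<le> A ^ N * \<rho> x"
proof (induction N arbitrary: x)
  case 0
  then show ?case by simp
next
  case (Suc N)
  let ?z = "x + (1 / real (Suc N)) *\<^sub>R (y - x)"
  have n0: "0 < real (Suc N)" by simp
  have zx: "norm (?z - x) \<le> h / 4"
  proof -
    have "norm (?z - x) = norm (y - x) / real (Suc N)" by simp
    also have "\<dots> \<le> h / 4" using Suc.prems(4) n0 by (simp add: divide_le_eq mult.commute del: of_nat_Suc)
    finally show ?thesis .
  qed
  have conv: "?z = (1 - 1 / real (Suc N)) *\<^sub>R x + (1 / real (Suc N)) *\<^sub>R y"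
    by (simp add: algebra_simps)
  have "?z \<in> cball 0 (1 - h)"
    unfolding conv using Suc.prems by (intro convexD[OF convex_cball]) auto
  then have z1: "norm ?z \<le> 1 - h" by (simp only: mem_cball_0)
  have W: "?z \<in> whitney_ball x"
  proof -
    have "h / 4 < h / 2" using assms by simp
    also have "h / 2 \<le> (1 - norm x) / 2" using Suc.prems(2) by (rule divide_right_mono) simp
    finally show ?thesis
      unfolding whitney_ball_def mem_ball dist_norm norm_minus_commute[of x ?z] using zx by linarith
  qed
  have "y - ?z = (real N / real (Suc N)) *\<^sub>R (y - x)"
  proof -
    have "y - ?z = (1 - 1 / real (Suc N)) *\<^sub>R (y - x)" by (simp add: algebra_simps)
    also have "1 - 1 / real (Suc N) = real N / real (Suc N)" by (simp add: field_simps)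
    finally show ?thesis .
  qed
  then have "norm (y - ?z) = real N / real (Suc N) * norm (y - x)" by simp
  also have "\<dots> \<le> real N / real (Suc N) * (real (Suc N) * (h / 4))"
    using Suc.prems(4) by (intro mult_left_mono) auto
  also have "\<dots> = real N * (h / 4)" using n0 by (simp del: of_nat_Suc)
  finally have "norm (y - ?z) \<le> real N * (h / 4)" .
  then have "\<rho> y \<le> A ^ N * \<rho> ?z"
    using z1 Suc.prems assms by (intro Suc.IH) auto
  also have "\<rho> ?z \<le> A * \<rho> x"
    by (rule harnack_le[OF Suc.prems(1) W centre_whitney_ball[OF Suc.prems(1)]])
  then have "A ^ N * \<rho> ?z \<le> A ^ N * (A * \<rho> x)" using A by (intro mult_left_mono) auto
  finally show ?case by (simp add: mult_ac)
qed

lemma harnack_chain_u: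
  assumes h: "0 < h" "h \<le> 1 - norm x" "h \<le> 1 - norm y" and N: "norm (y - x) \<le> real N * (h / 4)"
  shows "u y \<le> u x + A ^ N * \<rho> x * norm (y - x)"
proof -
  have xb: "x \<in> ball 0 1" and yb: "y \<in> ball 0 1" using h by auto
  have "\<rho> (linepath y x t) \<le> A ^ N * \<rho> x" if t: "t \<in> {0..1}" for t
  proof (rule harnack_chain[OF h(1) xb h(2)])
    have "linepath y x t \<in> cball 0 (1 - h)"
      using convexD[OF convex_cball, of y 0 "1 - h" x "1 - t" t] h t by (simp add: linepath_def)
    then show "h \<le> 1 - norm (linepath y x t)" by simp
    have "linepath y x t - x = (1 - t) *\<^sub>R (y - x)" by (simp add: linepath_def algebra_simps)
    then have "norm (linepath y x t - x) = (1 - t) * norm (y - x)" using t by simp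
    also have "\<dots> \<le> 1 * norm (y - x)" using t by (intro mult_right_mono) auto
    finally show "norm (linepath y x t - x) \<le> real N * (h / 4)" using N by simp
  qed
  then have "seg_length \<rho> y x \<le> ennreal (A ^ N * \<rho> x * norm (x - y))"
    using A positive[OF xb] by (intro seg_length_le) auto
  then have "u y \<le> u x + A ^ N * \<rho> x * norm (x - y)"
    using A positive[OF xb] by (intro u_le_add_seg[OF yb xb]) auto
  then show ?thesis by (simp add: norm_minus_commute)
qed

end

section \<open>Boundary values\<close>

lemma ennreal_mult_left_cancel_le:
  assumes "0 < c" "ennreal c * X \<le> ennreal c * Y"
  shows "X \<le> Y"
  using assms by (subst (asm) ennreal_mult_le_mult_iff) auto

context conformal begin

text \<open>The integral of a fixed integrable function over balls shrinking to \<omega> tends to 0;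
  the centre contributes nothing because \<open>band\<close> vanishes on the sphere.\<close>

lemma band_energy_small:
  assumes \<omega>: "norm \<omega> = 1" and \<beta>: "0 < \<beta>" and \<delta>: "0 < \<delta>"
  obtains R0 where "0 < R0" "\<And>R. R < R0 \<Longrightarrow> (\<integral>\<^sup>+y\<in>ball \<omega> R. ennreal (band \<alpha> \<beta> y ^ DIM('a)) \<partial>lborel) < ennreal \<delta>"
proof -
  let ?f = "\<lambda>y. ennreal (band \<alpha> \<beta> y ^ DIM('a))"
  let ?S = "\<lambda>i::nat. ball \<omega> (1 / real (Suc i))"
  have "(\<lambda>i. \<integral>\<^sup>+y\<in>?S i. ?f y \<partial>lborel) \<longlonglongrightarrow> 0"
  proof (rule decreasing_nn_integral_tendsto_0)
    show "decseq ?S"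
      by (auto simp: decseq_def intro!: subset_ball divide_left_mono)
    have "(\<integral>\<^sup>+y\<in>?S 0. ?f y \<partial>lborel) \<le> (\<integral>\<^sup>+y. ?f y \<partial>lborel)"
      by (intro nn_integral_mono) (auto simp: indicator_def)
    also have "\<dots> < \<infinity>" using band_integral_le[OF \<beta>, of \<alpha>] by (simp add: le_less_trans)
    finally show "(\<integral>\<^sup>+y\<in>?S 0. ?f y \<partial>lborel) < \<infinity>" .
    fix y assume y: "\<forall>i. y \<in> ?S i"
    have "y = \<omega>"
    proof (rule ccontr)
      assume "y \<noteq> \<omega>"
      then obtain i where "inverse (real (Suc i)) < dist \<omega> y"
        using reals_Archimedean[of "dist \<omega> y"] by auto
      then show False using y[rule_format, of i] by (simp add: inverse_eq_divide)
    qed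
    then show "?f y = 0" using \<omega> by (simp add: band_def zero_power)
  qed auto
  then have "eventually (\<lambda>i. (\<integral>\<^sup>+y\<in>?S i. ?f y \<partial>lborel) < ennreal \<delta>) sequentially"
    using \<delta> by (intro order_tendstoD(2)) auto
  then obtain i where i: "(\<integral>\<^sup>+y\<in>?S i. ?f y \<partial>lborel) < ennreal \<delta>"
    by (auto simp: eventually_sequentially)
  show thesis
  proof (rule that)
    fix R assume "R < 1 / real (Suc i)"
    then have "(\<integral>\<^sup>+y\<in>ball \<omega> R. ?f y \<partial>lborel) \<le> (\<integral>\<^sup>+y\<in>?S i. ?f y \<partial>lborel)"
      by (intro nn_integral_mono) (auto simp: indicator_def)
    then show "(\<integral>\<^sup>+y\<in>ball \<omega> R. ?f y \<partial>lborel) < ennreal \<delta>" using i by (rule le_less_trans)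
  qed simp
qed

text \<open>Otherwise \<open>u > \<mu> + \<epsilon>\<close> on a ball of radius comparable to \<open>R\<close>, and the segments joining
  this ball to the curve inside hyperplanes orthogonal to a coordinate direction force a definite
  amount of energy near \<open>\<omega>\<close>.\<close>

lemma low_point_near_curve_end:
  assumes \<omega>: "norm \<omega> = 1" and \<gamma>: "\<gamma> \<in> ball_curves \<omega> 0" and low: "\<And>s. 0 < s \<Longrightarrow> s < 1 \<Longrightarrow> u (\<gamma> s) \<le> \<mu>"
    and \<epsilon>: "0 < \<epsilon>" and R: "0 < R" "R < 1"
    and small: "(\<integral>\<^sup>+y\<in>ball \<omega> (2 * R). ennreal (band \<mu> (\<mu> + \<epsilon>) y ^ DIM('a)) \<partial>lborel)
      < ennreal (\<epsilon> ^ DIM('a) * (unit_ball_vol DIM('a) * (1 / (32 * real DIM('a) ^ 2)) ^ DIM('a)))"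
  obtains z where "dist z \<omega> < R" "R / (8 * DIM('a)) \<le> 1 - norm z" "u z \<le> \<mu> + \<epsilon>"
proof (rule ccontr)
  assume contra: "\<not> thesis"
  note found = that
  let ?n = "DIM('a)"
  have n: "1 \<le> real ?n" using DIM_positive[where 'a='a] by linarith
  \<comment> \<open>Small against the width R/n of the slab between the hyperplanes through \<omega>
    and \<open>q\<close>, so that the ball \<open>F\<close> fits strictly inside.\<close>
  define \<eta> where "\<eta> = 1 / (4 * real ?n)"
  have \<eta>: "0 < \<eta>" "\<eta> \<le> 1/4" using n by (auto simp: \<eta>_def field_simps)
  have c: "continuous_on {0..1} \<gamma>" and g0: "\<gamma> 0 = \<omega>" and g1: "\<gamma> 1 = 0" and im: "\<gamma> ` {0<..<1} \<subseteq> ball 0 1"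
    using \<gamma> by (auto simp: ball_curves_def path_def pathstart_def pathfinish_def)
  have cf: "continuous_on {0..1} (\<lambda>s. dist (\<gamma> s) \<omega>)" by (intro continuous_intros c)
  obtain b where b: "0 < b" "b \<le> 1" "dist (\<gamma> b) \<omega> = R" "\<And>s. 0 \<le> s \<Longrightarrow> s \<le> b \<Longrightarrow> dist (\<gamma> s) \<omega> \<le> R"
    using first_hit[OF cf, of R] g0 g1 R \<omega> by auto
  have b1: "b < 1"
  proof (rule ccontr)
    assume "\<not> b < 1"
    then have "b = 1" using b by simp
    then show False using b(3) g1 \<omega> R by simp
  qed
  define q where "q = \<gamma> b"
  have qb: "norm q < 1" using im b(1) b1 by (auto simp: q_def image_subset_iff)
  have qw: "norm (q - \<omega>) = R" using b(3) by (simp add: q_def dist_norm)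
  \<comment> \<open>The curve meets every hyperplane orthogonal to \<open>e\<close> between \<omega>
    and \<open>q\<close>; a large coordinate makes this slab at least R/n wide.\<close>
  obtain e where e: "e \<in> Basis" "norm (q - \<omega>) \<le> ?n * \<bar>(q - \<omega>) \<bullet> e\<bar>"
    using exists_large_coordinate[of "q - \<omega>"] by blast
  have gap: "R / ?n \<le> \<bar>q \<bullet> e - \<omega> \<bullet> e\<bar>"
    using e(2) n unfolding qw by (simp add: inner_diff_left divide_le_eq mult.commute)
  let ?f = "\<lambda>s. \<gamma> s \<bullet> e"
  have cf: "continuous_on {0..b} ?f"
    using b by (intro continuous_intros continuous_on_subset[OF c]) auto
  obtain s where s[measurable]: "s \<in> borel_measurable borel"
    and s2: "\<And>\<tau>. min (?f 0) (?f b) \<le> \<tau> \<Longrightarrow> \<tau> \<le> max (?f 0) (?f b) \<Longrightarrow> s \<tau> \<in> {0..b} \<and> ?f (s \<tau>) = \<tau>"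
    using borel_level_selection[OF cf] b(1) by (metis less_imp_le)
  define lo hi where "lo = min (\<omega> \<bullet> e) (q \<bullet> e)" and "hi = max (\<omega> \<bullet> e) (q \<bullet> e)"
  \<comment> \<open>Outside the slab the value is a dummy with the right coordinate, so that
    \<open>y \<tau> \<bullet> e = \<tau>\<close> holds for every \<tau>. The clamp of
    \<open>s \<tau>\<close> to [0,1] makes the composition Borel on the whole line.\<close>
  define y where "y \<tau> = (if lo \<le> \<tau> \<and> \<tau> \<le> hi then \<gamma> (max 0 (min 1 (s \<tau>))) else \<tau> *\<^sub>R e)" for \<tau>
  have y_meas: "y \<in> borel_measurable borel"
  proof -
    have "continuous_on UNIV (\<gamma> \<circ> (\<lambda>t. max 0 (min 1 t)))"
      by (intro continuous_on_compose continuous_intros continuous_on_subset[OF c]) auto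
    then have [measurable]: "(\<lambda>t. \<gamma> (max 0 (min 1 t))) \<in> borel_measurable borel"
      unfolding comp_def by (rule borel_measurable_continuous_onI)
    have "(\<lambda>\<tau>. (\<lambda>t. \<gamma> (max 0 (min 1 t))) (s \<tau>)) \<in> borel_measurable borel"
      by measurable
    then show ?thesis unfolding y_def by simp
  qed
  have ee: "e \<bullet> e = 1" using e(1) by simp
  have ys: "y \<tau> = \<gamma> (s \<tau>) \<and> s \<tau> \<in> {0..b} \<and> \<gamma> (s \<tau>) \<bullet> e = \<tau>" if "lo \<le> \<tau>" "\<tau> \<le> hi" for \<tau>
  proof -
    have "s \<tau> \<in> {0..b} \<and> ?f (s \<tau>) = \<tau>" using s2[of \<tau>] that by (simp add: lo_def hi_def g0 q_def)
    then show ?thesis using that b by (simp add: y_def)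
  qed
  have ye: "y \<tau> \<bullet> e = \<tau>" for \<tau>
  proof (cases "lo \<le> \<tau> \<and> \<tau> \<le> hi")
    case True
    then show ?thesis using ys[of \<tau>] by simp
  next
    case False
    then show ?thesis by (auto simp: y_def ee)
  qed
  define m where "m = (1/2) *\<^sub>R (\<omega> + q)"
  have m1: "norm m \<le> 1" using norm_triangle_ineq[of \<omega> q] \<omega> qb by (simp add: m_def)
  \<comment> \<open>The midpoint of \<omega> and \<open>q\<close> is central in the slab but may be
    too close to the sphere; scaling it by \<open>1 - \<eta> * R\<close> keeps all of
    \<open>F\<close> at distance at least \<open>\<eta> * R / 2\<close> from the sphere.\<close>
  define z0 where "z0 = (1 - \<eta> * R) *\<^sub>R m"
  define F where "F = ball z0 (\<eta> * R / 2)"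
  have \<eta>R: "0 < \<eta> * R" "\<eta> * R < 1" using \<eta> R mult_strict_mono[of \<eta> 1 R 1] by auto
  have z0m: "norm (z0 - m) \<le> \<eta> * R"
  proof -
    have "z0 - m = (- (\<eta> * R)) *\<^sub>R m" by (simp add: z0_def algebra_simps)
    then have "norm (z0 - m) = \<eta> * R * norm m"
      by (simp only: norm_scaleR abs_minus_cancel abs_of_pos[OF \<eta>R(1)])
    also have "\<dots> \<le> \<eta> * R * 1" using m1 \<eta>R by (intro mult_left_mono) auto
    finally show ?thesis by simp
  qed
  have zF: "norm (z - z0) < \<eta> * R / 2" if "z \<in> F" for z
    using that by (simp add: F_def dist_norm norm_minus_commute)
  have z_m: "norm (z - m) < 3/2 * (\<eta> * R)" if "z \<in> F" for z
    using norm_triangle_ineq[of "z - z0" "z0 - m"] zF[OF that] z0m by simp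
  have \<eta>R4: "\<eta> * R \<le> R / 4" using \<eta>(2) R mult_right_mono[of \<eta> "1/4" R] by simp
  have z\<omega>: "dist z \<omega> < R" if "z \<in> F" for z
  proof -
    have "m - \<omega> = (1/2) *\<^sub>R (q - \<omega>)" by (simp add: m_def algebra_simps flip: scaleR_add_left)
    then have "norm (m - \<omega>) = R / 2" using qw by simp
    moreover have "norm (z - \<omega>) \<le> norm (z - m) + norm (m - \<omega>)"
      using norm_triangle_ineq[of "z - m" "m - \<omega>"] by simp
    ultimately show ?thesis unfolding dist_norm using z_m[OF that] \<eta>R4 R by linarith
  qed
  have zh: "\<eta> * R / 2 \<le> 1 - norm z" if "z \<in> F" for z
  proof -
    have "norm z0 = (1 - \<eta> * R) * norm m" using \<eta>R by (simp add: z0_def)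
    also have "\<dots> \<le> (1 - \<eta> * R) * 1" using m1 \<eta>R by (intro mult_left_mono) auto
    finally show ?thesis using norm_triangle_ineq[of "z - z0" z0] zF[OF that] by simp
  qed
  have ze: "lo < z \<bullet> e \<and> z \<bullet> e < hi" if "z \<in> F" for z
  proof -
    have "\<bar>(z - m) \<bullet> e\<bar> \<le> norm (z - m)" using Basis_le_norm[OF e(1)] .
    then have "\<bar>z \<bullet> e - m \<bullet> e\<bar> < 3/2 * (\<eta> * R)" using z_m[OF that] by (simp add: inner_diff_left)
    also have "\<dots> = 3/8 * (R / ?n)" by (simp add: \<eta>_def)
    also have "\<dots> \<le> 3/8 * \<bar>q \<bullet> e - \<omega> \<bullet> e\<bar>" using gap by (intro mult_left_mono) auto
    finally have "8 * \<bar>z \<bullet> e - m \<bullet> e\<bar> < 3 * \<bar>q \<bullet> e - \<omega> \<bullet> e\<bar>" by simp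
    moreover have "2 * (m \<bullet> e) = \<omega> \<bullet> e + q \<bullet> e" by (simp add: m_def inner_add_left)
    moreover have "min a b < x \<and> x < max a b" if "8 * \<bar>x - c\<bar> < 3 * \<bar>b - a\<bar>" "2 * c = a + b" for a b c x :: real
      using that by (auto simp: min_def max_def abs_if split: if_splits)
    ultimately show ?thesis unfolding lo_def hi_def by blast
  qed
  have hR: "\<eta> * R / 2 = R / (8 * ?n)" by (simp add: \<eta>_def)
  have high: "\<mu> + \<epsilon> < u z" if "z \<in> F" for z
  proof (rule ccontr)
    assume "\<not> \<mu> + \<epsilon> < u z"
    then show False using contra found[of z] z\<omega>[OF \<open>z \<in> F\<close>] zh[OF \<open>z \<in> F\<close>] hR by auto
  qed
  \<comment> \<open>After division by \<epsilon> a crossing of the band counts as at least 1; the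
    cutoff localizes the energy near \<omega>.\<close>
  define g where "g w = band \<mu> (\<mu> + \<epsilon>) w / \<epsilon> * indicator (ball \<omega> (2 * R)) w" for w
  have g_meas: "g \<in> borel_measurable borel" unfolding g_def
    by (intro borel_measurable_times borel_measurable_divide band_measurable borel_measurable_indicator) auto
  have g_nonneg: "0 \<le> g w" for w using band_nonneg \<epsilon> by (simp add: g_def)
  have len: "1 \<le> ennreal (2 * R) * (\<integral>\<^sup>+t\<in>{0<..<1}. ennreal (g ((1 - t) *\<^sub>R y (z \<bullet> e) + t *\<^sub>R z)) \<partial>lborel)"
    if z: "z \<in> F" for z
  proof -
    let ?p = "y (z \<bullet> e)"
    have P: "?p = \<gamma> (s (z \<bullet> e))" "s (z \<bullet> e) \<in> {0..b}" "\<gamma> (s (z \<bullet> e)) \<bullet> e = z \<bullet> e"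
      using ys[of "z \<bullet> e"] ze[OF z] by auto
    \<comment> \<open>At time 0 the curve is at \<omega>, where no bound on \<open>u\<close> is
      given; the strict inequalities for \<open>z \<bullet> e\<close> exclude that time.\<close>
    have "s (z \<bullet> e) \<noteq> 0" using P(3) ze[OF z] g0 by (auto simp: lo_def hi_def)
    then have s01: "0 < s (z \<bullet> e)" "s (z \<bullet> e) < 1" using P(2) b1 by auto
    then have pb: "?p \<in> ball 0 1" using im P(1) by (auto simp: image_subset_iff)
    have pl: "u ?p \<le> \<mu>" using low[OF s01] P(1) by simp
    have pw: "dist ?p \<omega> \<le> R" using b(4) P by auto
    have zb: "z \<in> ball 0 1" using zh[OF z] \<eta>R by simp
    have lin: "linepath ?p z t \<in> ball 0 1" "linepath ?p z t \<in> ball \<omega> (2 * R)" if "t \<in> {0..1}" for t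
    proof -
      show "linepath ?p z t \<in> ball 0 1" by (rule linepath_in_ball[OF pb zb that])
      show "linepath ?p z t \<in> ball \<omega> (2 * R)"
        using convexD[OF convex_ball, of ?p \<omega> "2 * R" z "1 - t" t] that pw z\<omega>[OF z] R
        by (simp add: linepath_def dist_commute)
    qed
    have "ennreal (\<mu> + \<epsilon> - \<mu>) \<le> ennreal (norm (z - ?p)) * (\<integral>\<^sup>+t\<in>{0<..<1}. ennreal (band \<mu> (\<mu> + \<epsilon>) (linepath ?p z t)) \<partial>lborel)"
    proof (rule band_crossing)
      show "u (linepath ?p z 0) \<le> \<mu> \<and> \<mu> + \<epsilon> \<le> u (linepath ?p z 1) \<or> u (linepath ?p z 1) \<le> \<mu> \<and> \<mu> + \<epsilon> \<le> u (linepath ?p z 0)"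
        using pl high[OF z] by (simp add: linepath_def)
    qed (use \<epsilon> lin(1) in auto)
    also have "\<dots> \<le> ennreal (2 * R) * (\<integral>\<^sup>+t\<in>{0<..<1}. ennreal (band \<mu> (\<mu> + \<epsilon>) (linepath ?p z t)) \<partial>lborel)"
    proof (intro mult_right_mono ennreal_leI)
      show "norm (z - ?p) \<le> 2 * R"
        using dist_triangle2[of z ?p \<omega>] z\<omega>[OF z] pw by (simp add: dist_norm)
    qed simp
    also have "(\<integral>\<^sup>+t\<in>{0<..<1}. ennreal (band \<mu> (\<mu> + \<epsilon>) (linepath ?p z t)) \<partial>lborel)
        = (\<integral>\<^sup>+t. ennreal \<epsilon> * (ennreal (g (linepath ?p z t)) * indicator {0<..<1} t) \<partial>lborel)"
    proof (rule nn_integral_cong)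
      fix t :: real
      show "ennreal (band \<mu> (\<mu> + \<epsilon>) (linepath ?p z t)) * indicator {0<..<1} t
        = ennreal \<epsilon> * (ennreal (g (linepath ?p z t)) * indicator {0<..<1} t)"
        using lin(2)[of t] \<epsilon> band_nonneg
        by (cases "t \<in> {0<..<1}") (auto simp: g_def ennreal_mult[symmetric])
    qed
    also have "\<dots> = ennreal \<epsilon> * (\<integral>\<^sup>+t\<in>{0<..<1}. ennreal (g (linepath ?p z t)) \<partial>lborel)"
    proof (intro nn_integral_cmult)
      have "linepath ?p z \<in> borel_measurable borel"
        by (intro borel_measurable_continuous_onI continuous_intros)
      from measurable_compose[OF this g_meas]
      show "(\<lambda>t. ennreal (g (linepath ?p z t)) * indicator {0<..<1} t) \<in> borel_measurable lborel"
        by measurable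
    qed
    finally have "ennreal \<epsilon> \<le> ennreal (2 * R) * (ennreal \<epsilon> * (\<integral>\<^sup>+t\<in>{0<..<1}. ennreal (g (linepath ?p z t)) \<partial>lborel))"
      by simp
    then have "ennreal (1 / \<epsilon>) * ennreal \<epsilon> \<le> ennreal (1 / \<epsilon>) * (ennreal (2 * R) * (ennreal \<epsilon> * (\<integral>\<^sup>+t\<in>{0<..<1}. ennreal (g (linepath ?p z t)) \<partial>lborel)))"
      by (intro mult_left_mono) auto
    also have "\<dots> = (ennreal (1 / \<epsilon>) * ennreal \<epsilon>) * (ennreal (2 * R) * (\<integral>\<^sup>+t\<in>{0<..<1}. ennreal (g (linepath ?p z t)) \<partial>lborel))"
      by (simp only: mult_ac)
    also have "ennreal (1 / \<epsilon>) * ennreal \<epsilon> = 1" using \<epsilon> by (simp add: ennreal_mult[symmetric])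
    finally show ?thesis by (simp add: linepath_def)
  qed
  have "emeasure lborel F \<le> ennreal ((2 * real ?n * (2 * R)) ^ ?n) * (\<integral>\<^sup>+w. ennreal (g w ^ ?n) \<partial>lborel)"
    by (rule slice_pencil_estimate[OF y_meas e(1) ye g_meas g_nonneg _ _ _ len])
      (use R emeasure_bounded_finite[OF bounded_ball, of z0 "\<eta> * R / 2"] in \<open>auto simp: F_def\<close>)
  also have "(\<integral>\<^sup>+w. ennreal (g w ^ ?n) \<partial>lborel)
      = (\<integral>\<^sup>+w. ennreal (1 / \<epsilon> ^ ?n) * (ennreal (band \<mu> (\<mu> + \<epsilon>) w ^ ?n) * indicator (ball \<omega> (2 * R)) w) \<partial>lborel)"
  proof (rule nn_integral_cong)
    fix w
    show "ennreal (g w ^ ?n) = ennreal (1 / \<epsilon> ^ ?n) * (ennreal (band \<mu> (\<mu> + \<epsilon>) w ^ ?n) * indicator (ball \<omega> (2 * R)) w)"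
      using \<epsilon> band_nonneg by (cases "w \<in> ball \<omega> (2 * R)") (auto simp: g_def power_divide ennreal_mult[symmetric] zero_power)
  qed
  also have "\<dots> = ennreal (1 / \<epsilon> ^ ?n) * (\<integral>\<^sup>+w\<in>ball \<omega> (2 * R). ennreal (band \<mu> (\<mu> + \<epsilon>) w ^ ?n) \<partial>lborel)"
  proof (rule nn_integral_cmult)
    have [measurable]: "ball \<omega> (2 * R) \<in> sets borel" by simp
    show "(\<lambda>w. ennreal (band \<mu> (\<mu> + \<epsilon>) w ^ ?n) * indicator (ball \<omega> (2 * R)) w) \<in> borel_measurable lborel"
      by measurable
  qed
  finally have le: "emeasure lborel F \<le> ennreal ((2 * real ?n * (2 * R)) ^ ?n) *
      (ennreal (1 / \<epsilon> ^ ?n) * (\<integral>\<^sup>+w\<in>ball \<omega> (2 * R). ennreal (band \<mu> (\<mu> + \<epsilon>) w ^ ?n) \<partial>lborel))" .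
  let ?V = "unit_ball_vol ?n"
  let ?c = "\<epsilon> ^ ?n * (?V * (1 / (32 * real ?n ^ 2)) ^ ?n)"
  have V: "?V > 0" by simp
  have "emeasure lborel F = ennreal (?V * (\<eta> * R / 2) ^ ?n)"
    unfolding F_def using \<eta>R by (simp add: emeasure_ball)
  moreover have "?V * (\<eta> * R / 2) ^ ?n = (2 * real ?n * (2 * R)) ^ ?n * (1 / \<epsilon> ^ ?n) * ?c"
  proof -
    \<comment> \<open>The radius of \<open>F\<close> and the length bound for the segments are both
      proportional to \<open>R\<close>, so \<open>R\<close> cancels and the energy threshold is the
      same at every scale.\<close>
    have "\<eta> * R / 2 = 2 * real ?n * (2 * R) * (1 / (32 * real ?n ^ 2))"
      using n by (simp add: \<eta>_def power2_eq_square field_simps)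
    then have "(\<eta> * R / 2) ^ ?n = (2 * real ?n * (2 * R)) ^ ?n * (1 / (32 * real ?n ^ 2)) ^ ?n"
      by (metis power_mult_distrib)
    then show ?thesis using \<epsilon> by simp
  qed
  ultimately have F_eq: "emeasure lborel F = ennreal ((2 * real ?n * (2 * R)) ^ ?n * (1 / \<epsilon> ^ ?n)) * ennreal ?c"
    using \<epsilon> R V by (subst ennreal_mult[symmetric]) auto
  let ?k = "(2 * real ?n * (2 * R)) ^ ?n * (1 / \<epsilon> ^ ?n)"
  have k: "0 < ?k" using \<epsilon> R n by simp
  have "ennreal ?k * ennreal ?c \<le> ennreal ?k * (\<integral>\<^sup>+w\<in>ball \<omega> (2 * R). ennreal (band \<mu> (\<mu> + \<epsilon>) w ^ ?n) \<partial>lborel)"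
  proof -
    have "ennreal ?k = ennreal ((2 * real ?n * (2 * R)) ^ ?n) * ennreal (1 / \<epsilon> ^ ?n)"
      by (rule ennreal_mult) (use \<epsilon> R in auto)
    then show ?thesis using le unfolding F_eq by (simp only: mult.assoc)
  qed
  then have "ennreal ?c \<le> (\<integral>\<^sup>+w\<in>ball \<omega> (2 * R). ennreal (band \<mu> (\<mu> + \<epsilon>) w ^ ?n) \<partial>lborel)"
    by (rule ennreal_mult_left_cancel_le[OF k])
  then show False using small by simp
qed

text \<open>On the ball of radius \<open>h / 4\<close> around \<open>z\<close> Harnack keeps the
  density above \<open>\<rho> z / A\<close>, and \<open>u_whitney_le\<close> keeps \<open>u\<close>
  below the upper level of the band. Small energy near \<omega> therefore forces
  \<open>\<rho> z * h\<close> to be small.\<close>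

lemma density_energy_bound:
  assumes z: "norm z < 1" "1/2 \<le> norm z" and uz: "u z \<le> \<nu>" and \<nu>: "0 < \<nu>" and h: "0 < h" "h \<le> 1 - norm z"
    and r: "dist z \<omega> + h / 4 \<le> r"
  shows "ennreal (unit_ball_vol DIM('a) * (\<rho> z * (h / 4) / A) ^ DIM('a))
    \<le> (\<integral>\<^sup>+y\<in>ball \<omega> r. ennreal (band (-1) ((2 + 2 * A * A) * \<nu>) y ^ DIM('a)) \<partial>lborel)"
proof -
  let ?n = "DIM('a)"
  have zb: "z \<in> ball 0 1" using z by simp
  have sub: "y \<in> whitney_ball z" if "y \<in> ball z (h / 4)" for y
    using that h by (simp add: whitney_ball_def)
  have bd: "\<rho> z / A \<le> band (-1) ((2 + 2 * A * A) * \<nu>) y" if "y \<in> ball z (h / 4)" for y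
  proof -
    note W = sub[OF that]
    have yb: "y \<in> ball 0 1" using whitney_ball_subset[OF zb] W by blast
    have "u y \<le> (1 + 2 * A * A) * u z" by (rule u_whitney_le[OF zb z(2) W])
    also have "\<dots> \<le> (1 + 2 * A * A) * \<nu>" using uz A by (intro mult_left_mono) auto
    also have "\<dots> < (2 + 2 * A * A) * \<nu>" using \<nu> by (intro mult_strict_right_mono) auto
    finally have "band (-1) ((2 + 2 * A * A) * \<nu>) y = \<rho> y"
      using yb u_nonneg[of y] by (simp add: band_def)
    moreover have "\<rho> z \<le> A * \<rho> y" by (rule harnack_le[OF zb centre_whitney_ball[OF zb] W])
    ultimately show ?thesis using A by (simp add: divide_le_eq mult.commute)
  qed
  have p: "0 \<le> \<rho> z / A" using positive[OF zb] A by simp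
  have "ennreal (unit_ball_vol ?n * (\<rho> z * (h / 4) / A) ^ ?n) = ennreal ((\<rho> z / A) ^ ?n) * emeasure lborel (ball z (h / 4))"
  proof -
    have "unit_ball_vol ?n * (\<rho> z * (h / 4) / A) ^ ?n = (\<rho> z / A) ^ ?n * (unit_ball_vol ?n * (h / 4) ^ ?n)"
      by (simp add: power_divide power_mult_distrib mult_ac)
    moreover have "0 \<le> (\<rho> z / A) ^ ?n" "0 \<le> unit_ball_vol ?n * (h / 4) ^ ?n" using p h by auto
    moreover have "emeasure lborel (ball z (h / 4)) = ennreal (unit_ball_vol ?n * (h / 4) ^ ?n)"
      using h by (intro emeasure_ball) simp
    ultimately show ?thesis by (simp only: ennreal_mult)
  qed
  also have "\<dots> = (\<integral>\<^sup>+y. ennreal ((\<rho> z / A) ^ ?n) * indicator (ball z (h / 4)) y \<partial>lborel)"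
    by (simp add: nn_integral_cmult_indicator)
  also have "\<dots> \<le> (\<integral>\<^sup>+y\<in>ball \<omega> r. ennreal (band (-1) ((2 + 2 * A * A) * \<nu>) y ^ ?n) \<partial>lborel)"
  proof (rule nn_integral_mono)
    fix y
    show "ennreal ((\<rho> z / A) ^ ?n) * indicator (ball z (h / 4)) y
      \<le> ennreal (band (-1) ((2 + 2 * A * A) * \<nu>) y ^ ?n) * indicator (ball \<omega> r) y"
    proof (cases "y \<in> ball z (h / 4)")
      case True
      then have "y \<in> ball \<omega> r" using r dist_triangle[of \<omega> y z] by (simp add: dist_commute)
      then show ?thesis using bd[OF True] p True by (auto intro!: ennreal_leI power_mono)
    qed simp
  qed
  finally show ?thesis .
qed

text \<open>The low point \<open>z\<close> and \<open>(1 - R) *\<^sub>R \<omega>\<close> both have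
  distance from the sphere at least a fixed multiple of \<open>R\<close> and are at most
  \<open>2 * R\<close> apart, so a Harnack chain of fixed length joins them. Its cost is a multiple
  of \<open>\<rho> z * R\<close>, which \<open>density_energy_bound\<close> makes at most
  \<epsilon>.\<close>

lemma radial_limit_le_curve_bound:
  assumes \<omega>: "norm \<omega> = 1" and \<gamma>: "\<gamma> \<in> ball_curves \<omega> 0" and low: "\<And>s. 0 < s \<Longrightarrow> s < 1 \<Longrightarrow> u (\<gamma> s) \<le> \<mu>"
    and \<epsilon>: "0 < \<epsilon>"
  obtains R0 where "0 < R0" "\<And>R. 0 < R \<Longrightarrow> R < R0 \<Longrightarrow> u ((1 - R) *\<^sub>R \<omega>) \<le> \<mu> + 2 * \<epsilon>"
proof -
  let ?n = "DIM('a)" and ?V = "unit_ball_vol DIM('a)"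
  have n: "1 \<le> real ?n" using DIM_positive[where 'a='a] by linarith
  have \<mu>0: "0 \<le> \<mu>" using low[of "1/2"] u_nonneg[of "\<gamma> (1/2)"] by simp
  \<comment> \<open>The number of steps of length R/(32n) that cover the distance
    \<open>2 * R\<close>.\<close>
  define N where "N = 64 * ?n"
  define \<nu> where "\<nu> = \<mu> + \<epsilon>"
  have \<nu>: "0 < \<nu>" using \<mu>0 \<epsilon> by (simp add: \<nu>_def)
  define L where "L = (2 + 2 * A * A) * \<nu>"
  have L: "0 < L" using \<nu> A by (auto simp: L_def intro!: mult_pos_pos add_pos_pos)
  define d1 where "d1 = \<epsilon> ^ ?n * (?V * (1 / (32 * real ?n ^ 2)) ^ ?n)"
  have d1: "0 < d1" using \<epsilon> n by (simp add: d1_def)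
  \<comment> \<open>Solves \<open>A ^ N * (64 * ?n * A * a) = \<epsilon>\<close>, the bound for the
    cost of the chain reached at the end.\<close>
  define a where "a = \<epsilon> / (64 * ?n * A * A ^ N)"
  have a: "0 < a" using \<epsilon> A n by (simp add: a_def)
  define d2 where "d2 = ?V * a ^ ?n"
  have d2: "0 < d2" using a by (simp add: d2_def)
  obtain R1 where R1: "0 < R1" "\<And>R. R < R1 \<Longrightarrow> (\<integral>\<^sup>+y\<in>ball \<omega> R. ennreal (band \<mu> (\<mu> + \<epsilon>) y ^ ?n) \<partial>lborel) < ennreal d1"
    using band_energy_small[OF \<omega> _ d1, of "\<mu> + \<epsilon>" \<mu>] \<nu> by (auto simp: \<nu>_def)
  obtain R2 where R2: "0 < R2" "\<And>R. R < R2 \<Longrightarrow> (\<integral>\<^sup>+y\<in>ball \<omega> R. ennreal (band (-1) L y ^ ?n) \<partial>lborel) < ennreal d2"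
    using band_energy_small[OF \<omega> L d2, of "-1"] by blast
  define R0 where "R0 = min (1/2) (min (R1 / 2) (R2 / 2))"
  show thesis
  proof (rule that[of R0])
    show "0 < R0" using R1 R2 by (simp add: R0_def)
    fix R assume R: "0 < R" "R < R0"
    then have R': "R < 1/2" "2 * R < R1" "2 * R < R2" by (auto simp: R0_def)
    have R1': "R < 1" using R' by simp
    obtain z where z: "dist z \<omega> < R" "R / (8 * ?n) \<le> 1 - norm z" "u z \<le> \<mu> + \<epsilon>"
      using low_point_near_curve_end[OF \<omega> \<gamma> low \<epsilon> R(1) R1'] R1(2)[OF R'(2)]
      unfolding d1_def by blast
    let ?h = "R / (8 * ?n)"
    let ?p = "(1 - R) *\<^sub>R \<omega>"
    have "1 \<le> real (8 * ?n)" unfolding of_nat_mult of_nat_numeral using n by linarith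
    then have "?h \<le> R / 1" by (rule divide_left_mono) (use R in auto)
    then have h: "0 < ?h" "?h \<le> R" using R n by auto
    have nz: "norm z < 1" using z(2) h by linarith
    have nz2: "1/2 \<le> norm z"
      using norm_triangle_ineq2[of \<omega> z] z(1) \<omega> R' by (simp add: dist_norm norm_minus_commute)
    have np: "norm ?p = 1 - R" using \<omega> R' R by simp
    have zp: "norm (?p - z) \<le> 2 * R"
    proof -
      have "?p - z = (\<omega> - z) - R *\<^sub>R \<omega>" by (simp add: algebra_simps)
      then have "norm (?p - z) \<le> norm (\<omega> - z) + norm (R *\<^sub>R \<omega>)" by (metis norm_triangle_ineq4)
      then show ?thesis using z(1) \<omega> R by (simp add: dist_norm norm_minus_commute)
    qed
    have "ennreal (?V * (\<rho> z * (?h / 4) / A) ^ ?n) \<le> (\<integral>\<^sup>+y\<in>ball \<omega> (2 * R). ennreal (band (-1) ((2 + 2 * A * A) * \<nu>) y ^ ?n) \<partial>lborel)"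
      using z h nz nz2 \<nu> by (intro density_energy_bound) (auto simp: \<nu>_def)
    also have "\<dots> < ennreal d2" using R2(2)[OF R'(3)] by (simp add: L_def)
    finally have "ennreal (?V * (\<rho> z * (?h / 4) / A) ^ ?n) < ennreal (?V * a ^ ?n)"
      by (simp only: d2_def)
    moreover have "0 \<le> ?V * (\<rho> z * (?h / 4) / A) ^ ?n"
      using positive[of z] nz h A by (intro mult_nonneg_nonneg zero_le_power) auto
    ultimately have "?V * (\<rho> z * (?h / 4) / A) ^ ?n < ?V * a ^ ?n"
      by (simp only: ennreal_less_iff)
    then have "(\<rho> z * (?h / 4) / A) ^ ?n < a ^ ?n" by simp
    then have "\<rho> z * (?h / 4) / A < a" using a by (simp add: power_less_imp_less_base)
    then have small: "\<rho> z * (2 * R) \<le> 64 * ?n * A * a"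
      using A n by (simp add: field_simps)
    have N: "norm (?p - z) \<le> real N * (?h / 4)"
    proof -
      have "real N * (?h / 4) = 2 * R" using n by (simp add: N_def)
      then show ?thesis using zp by simp
    qed
    have "u ?p \<le> u z + A ^ N * \<rho> z * norm (?p - z)"
      by (rule harnack_chain_u[OF h(1) z(2) _ N]) (use np h in simp)
    also have "A ^ N * \<rho> z * norm (?p - z) \<le> A ^ N * \<rho> z * (2 * R)"
      using zp A positive[of z] nz by (intro mult_left_mono) auto
    also have "\<dots> = A ^ N * (\<rho> z * (2 * R))" by simp
    also have "\<dots> \<le> A ^ N * (64 * ?n * A * a)" using small A by (intro mult_left_mono) auto
    also have "\<dots> = \<epsilon>" using A n by (simp add: a_def)
    finally show "u ?p \<le> \<mu> + 2 * \<epsilon>" using z(3) by simp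
  qed
qed

text \<open>The gaps are short enough for every point at radius 1/2 or more to lie in the Whitney
  ball of a point on the same ray at some radius \<open>tk k\<close>, so this sequence controls the
  outer half of each radius. The shift by 2 makes it start at 1/2.\<close>

definition tk :: "nat \<Rightarrow> real" where "tk k = 1 - 1 / real (k + 2)"

lemma tk_bounds: "1/2 \<le> tk k" "tk k < 1" "0 < tk k"
  by (auto simp: tk_def field_simps)

lemma tk_tendsto: "tk \<longlonglongrightarrow> 1"
proof -
  have "(\<lambda>k. 1 / real (k + 2)) \<longlonglongrightarrow> 0" by real_asymp
  then have "(\<lambda>k. 1 - 1 / real (k + 2)) \<longlonglongrightarrow> 1 - 0" by (intro tendsto_intros)
  then show ?thesis by (simp add: tk_def[abs_def])
qed

text \<open>The indicator makes \<open>radial_limsup\<close> Borel on the whole space; it equals 1 on the sphere.\<close>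

definition radial_limsup :: "'a \<Rightarrow> ennreal" where
  "radial_limsup \<omega> = limsup (\<lambda>k. ennreal (indicator (ball 0 1) (tk k *\<^sub>R \<omega>) * u (tk k *\<^sub>R \<omega>)))"

lemma u_indicator_measurable: "(\<lambda>y. indicator (ball 0 1) y * u y) \<in> borel_measurable borel"
  using borel_measurable_continuous_on_indicator[OF _ u_continuous] by simp

lemma radial_limsup_measurable[measurable]: "radial_limsup \<in> borel_measurable borel"
proof -
  note [measurable] = u_indicator_measurable
  have "(\<lambda>\<omega>. ennreal (indicator (ball 0 1) (tk k *\<^sub>R \<omega>) * u (tk k *\<^sub>R \<omega>))) \<in> borel_measurable borel" for k
  proof -
    have "(\<lambda>\<omega>. (\<lambda>y. indicator (ball 0 1) y * u y) (tk k *\<^sub>R \<omega>)) \<in> borel_measurable borel"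
      by (rule measurable_compose[OF _ u_indicator_measurable]) measurable
    then show ?thesis by simp
  qed
  then show ?thesis unfolding radial_limsup_def[abs_def] by measurable
qed

lemma radial_limsup_alt:
  assumes "norm \<omega> = 1"
  shows "radial_limsup \<omega> = limsup (\<lambda>k. ennreal (u (tk k *\<^sub>R \<omega>)))"
proof -
  have "tk k *\<^sub>R \<omega> \<in> ball 0 1" for k using assms tk_bounds[of k] by simp
  then show ?thesis by (simp add: radial_limsup_def)
qed

text \<open>On a curve from \<omega> to 0 of \<rho>-length \<mu> every interior point has
  \<open>u\<close> at most \<mu>, by the rest of the curve;
  \<open>radial_limit_le_curve_bound\<close> transfers this to the radius near \<omega>.\<close>

lemma radial_limsup_le_rho_norm:
  assumes \<omega>: "norm \<omega> = 1"
  shows "radial_limsup \<omega> \<le> rho_norm \<rho> \<omega>"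
  unfolding rho_norm_def rho_dist_def
proof (rule INF_greatest)
  fix \<gamma> assume \<gamma>: "\<gamma> \<in> ball_curves \<omega> 0"
  show "radial_limsup \<omega> \<le> rho_length \<rho> \<gamma>"
  proof (cases "rho_length \<rho> \<gamma>" rule: ennreal_cases)
    case (real \<mu>)
    have im: "\<gamma> s \<in> ball 0 1" if "0 < s" "s < 1" for s
      using \<gamma> that by (auto simp: ball_curves_def image_subset_iff)
    have low: "u (\<gamma> s) \<le> \<mu>" if "0 < s" "s < 1" for s
    proof -
      have "ennreal (u (\<gamma> s)) \<le> ennreal \<mu>"
        using rho_length_tail[OF \<gamma> _ that] im[OF that] real by (simp add: rho_norm_u[symmetric] rho_norm_inner)
      then show ?thesis using real(1) by (simp add: ennreal_le_iff)
    qed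
    have "radial_limsup \<omega> \<le> ennreal \<mu> + ennreal e" if e: "0 < e" for e
    proof -
      obtain R0 where R0: "0 < R0" "\<And>R. 0 < R \<Longrightarrow> R < R0 \<Longrightarrow> u ((1 - R) *\<^sub>R \<omega>) \<le> \<mu> + 2 * (e / 2)"
        using radial_limit_le_curve_bound[OF \<omega> \<gamma> low, of "e / 2"] e by auto
      have "eventually (\<lambda>k. 1 - R0 < tk k) sequentially"
        using R0(1) by (intro order_tendstoD(1)[OF tk_tendsto]) simp
      then have "eventually (\<lambda>k. ennreal (u (tk k *\<^sub>R \<omega>)) \<le> ennreal (\<mu> + e)) sequentially"
      proof eventually_elim
        case (elim k)
        then show ?case using R0(2)[of "1 - tk k"] tk_bounds[of k] by (intro ennreal_leI) simp
      qed
      then have "radial_limsup \<omega> \<le> ennreal (\<mu> + e)"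
        unfolding radial_limsup_alt[OF \<omega>] by (rule Limsup_bounded)
      then show ?thesis using real(1) e by (simp add: ennreal_plus)
    qed
    then show ?thesis unfolding real(2) by (rule ennreal_le_epsilon)
  qed simp
qed


text \<open>All but finitely many values along \<open>tk\<close> are below the upper limit plus 1,
  and \<open>u_whitney_le\<close> transfers the bound to the radii in between.\<close>

lemma radial_limsup_bounded:
  assumes \<omega>: "norm \<omega> = 1" and fin: "radial_limsup \<omega> < \<infinity>"
  obtains m :: nat where "\<And>t. 1/2 \<le> t \<Longrightarrow> t < 1 \<Longrightarrow> u (t *\<^sub>R \<omega>) \<le> real m"
proof -
  obtain l where l: "0 \<le> l" "radial_limsup \<omega> = ennreal l"
    using fin by (cases "radial_limsup \<omega>" rule: ennreal_cases) auto
  have "limsup (\<lambda>k. ennreal (u (tk k *\<^sub>R \<omega>))) < ennreal (l + 1)"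
    unfolding radial_limsup_alt[OF \<omega>, symmetric] l(2) using l(1) by (intro ennreal_lessI) auto
  then have "eventually (\<lambda>k. ennreal (u (tk k *\<^sub>R \<omega>)) < ennreal (l + 1)) sequentially"
    by (rule Limsup_lessD)
  then obtain k0 where k0: "\<And>k. k \<ge> k0 \<Longrightarrow> ennreal (u (tk k *\<^sub>R \<omega>)) < ennreal (l + 1)"
    by (auto simp: eventually_sequentially)
  define C where "C = (l + 1) + (\<Sum>k<k0. u (tk k *\<^sub>R \<omega>))"
  have C: "u (tk k *\<^sub>R \<omega>) \<le> C" for k
  proof (cases "k < k0")
    case True
    then have "u (tk k *\<^sub>R \<omega>) \<le> (\<Sum>k<k0. u (tk k *\<^sub>R \<omega>))"
      by (intro member_le_sum) (auto simp: u_nonneg)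
    then show ?thesis using l(1) by (simp add: C_def)
  next
    case False
    then have "u (tk k *\<^sub>R \<omega>) < l + 1" using k0[of k] u_nonneg by (simp add: ennreal_less_iff)
    moreover have "0 \<le> (\<Sum>k<k0. u (tk k *\<^sub>R \<omega>))" by (intro sum_nonneg u_nonneg)
    ultimately show ?thesis by (simp add: C_def)
  qed
  have bound: "u (t *\<^sub>R \<omega>) \<le> (1 + 2 * A * A) * C" if t: "1/2 \<le> t" "t < 1" for t
  proof -
    \<comment> \<open>Then 1 - 1/j <= t < 1 - 1/(j+1). The gap between these radii is at most half
      of 1/j, which puts \<open>t *\<^sub>R \<omega>\<close> into the Whitney ball at radius
      \<open>tk (j - 2)\<close>.\<close>
    define j where "j = nat \<lfloor>1 / (1 - t)\<rfloor>"
    have "2 \<le> 1 / (1 - t)" using t by (simp add: le_divide_eq)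
    then have j2: "2 \<le> j" "real j \<le> 1 / (1 - t)" "1 / (1 - t) < real j + 1"
      unfolding j_def by linarith+
    define k where "k = j - 2"
    have jk: "j = k + 2" using j2 by (simp add: k_def)
    have tkj: "tk k = 1 - 1 / real j" by (simp add: tk_def jk)
    have j0: "0 < real j" using j2 by simp
    have s: "0 < 1 - t" using t by simp
    have le1: "real j * (1 - t) \<le> 1" using j2(2) s by (simp add: le_divide_eq)
    have lt1: "1 < (real j + 1) * (1 - t)" using j2(3) s by (simp add: divide_less_eq)
    have a: "tk k \<le> t" using le1 j0 unfolding tkj by (simp add: field_simps)
    have b: "t - tk k < (1 - tk k) / 2"
    proof -
      have "1 / (real j + 1) < 1 - t" using lt1 j0 by (simp add: divide_less_eq mult.commute)
      moreover have "1 / (2 * real j) \<le> 1 / (real j + 1)" using j2(1) by (intro divide_left_mono) auto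
      ultimately have "1 / real j / 2 < 1 - t" by simp
      moreover have "t - (1 - i) < (1 - (1 - i)) / 2" if "i / 2 < 1 - t" for i :: real
        using that by (simp add: field_simps)
      ultimately show ?thesis unfolding tkj by blast
    qed
    have W: "t *\<^sub>R \<omega> \<in> whitney_ball (tk k *\<^sub>R \<omega>)"
    proof -
      have "dist (tk k *\<^sub>R \<omega>) (t *\<^sub>R \<omega>) = t - tk k"
        using a \<omega> by (simp add: dist_norm flip: scaleR_diff_left)
      moreover have "norm (tk k *\<^sub>R \<omega>) = tk k" using \<omega> tk_bounds[of k] by simp
      ultimately show ?thesis using b by (simp add: whitney_ball_def)
    qed
    have "u (t *\<^sub>R \<omega>) \<le> (1 + 2 * A * A) * u (tk k *\<^sub>R \<omega>)"
      using \<omega> tk_bounds[of k] by (intro u_whitney_le[OF _ _ W]) auto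
    also have "\<dots> \<le> (1 + 2 * A * A) * C" using C A by (intro mult_left_mono) auto
    finally show ?thesis .
  qed
  obtain m :: nat where "(1 + 2 * A * A) * C \<le> real m" using real_arch_simple by blast
  then show thesis using bound by (intro that[of m]) (meson order_trans)
qed

text \<open>Despite the name the first power of the density is integrated: this is the \<rho>-length
  of the part of the outer radius on which \<open>u\<close> is below \<open>m + 1\<close>.\<close>

definition radial_energy :: "nat \<Rightarrow> 'a \<Rightarrow> ennreal" where
  "radial_energy m \<omega> = (\<integral>\<^sup>+r\<in>{1/2<..<1}. ennreal (band (-1) (real m + 1) (r *\<^sub>R \<omega>)) \<partial>lborel)"

text \<open>The first power of \<open>band\<close> is at most 1 plus its n-th power, and this sum
  has a finite integral over the ball; \<open>radial_length_area\<close> with an infinite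
  \<open>c\<close> leaves only measure 0 for the set.\<close>

lemma infinite_radial_energy_null:
  "{\<omega> \<in> sphere 0 1. radial_energy m \<omega> = \<infinity>} \<in> null_sets surface_measure"
proof -
  let ?E = "{\<omega> \<in> sphere 0 1. radial_energy m \<omega> = \<infinity>}"
  let ?b = "band (-1) (real m + 1)"
  let ?H = "\<lambda>y. ennreal (1 + ?b y ^ DIM('a))"
  obtain d where d: "DIM('a) = Suc d" by (metis DIM_positive Suc_pred)
  have [measurable]: "radial_energy m \<in> borel_measurable borel"
    unfolding radial_energy_def[abs_def] by measurable
  have "{\<omega>. radial_energy m \<omega> = \<infinity>} \<in> sets borel" by measurable
  then have "sphere 0 1 \<inter> {\<omega>. radial_energy m \<omega> = \<infinity>} \<in> sets borel"
    by (rule sets.Int[OF borel_closed[OF closed_sphere]])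
  also have "sphere 0 1 \<inter> {\<omega>. radial_energy m \<omega> = \<infinity>} = ?E" by auto
  finally have E: "?E \<in> sets borel" .
  have "\<infinity> * emeasure surface_measure ?E \<le> ennreal (2 ^ (DIM('a) - 1)) * (\<integral>\<^sup>+y\<in>ball 0 1. ?H y \<partial>lborel)"
  proof (rule radial_length_area[where t="1/2"])
    fix \<omega> assume "\<omega> \<in> ?E"
    then have "\<infinity> = radial_energy m \<omega>" by simp
    also have "\<dots> \<le> (\<integral>\<^sup>+r\<in>{1/2<..<1}. ?H (r *\<^sub>R \<omega>) \<partial>lborel)"
      unfolding radial_energy_def
    proof (intro nn_integral_mono mult_right_mono ennreal_leI)
      fix r
      show "?b (r *\<^sub>R \<omega>) \<le> 1 + ?b (r *\<^sub>R \<omega>) ^ DIM('a)"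
        using le_threshold_power[of "?b (r *\<^sub>R \<omega>)" 1 d] band_nonneg by (simp add: d)
    qed simp
    finally show "\<infinity> \<le> (\<integral>\<^sup>+r\<in>{1/2<..<1}. ?H (r *\<^sub>R \<omega>) \<partial>lborel)" .
  next
    show "?H \<in> borel_measurable borel" by measurable
  qed (use E in auto)
  also have "\<dots> < \<infinity>"
  proof -
    have [measurable]: "ball (0::'a) 1 \<in> sets borel" by simp
    have "(\<integral>\<^sup>+y\<in>ball 0 1. ?H y \<partial>lborel) \<le> (\<integral>\<^sup>+y. indicator (ball 0 1) y + ennreal (?b y ^ DIM('a)) \<partial>lborel)"
      using band_nonneg by (intro nn_integral_mono) (auto simp: indicator_def)
    also have "\<dots> = emeasure lborel (ball (0::'a) 1) + (\<integral>\<^sup>+y. ennreal (?b y ^ DIM('a)) \<partial>lborel)"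
      by (subst nn_integral_add) auto
    also have "\<dots> < \<infinity>"
      using emeasure_bounded_finite[OF bounded_ball, of "0::'a" 1] band_integral_le[of "real m + 1" "-1"]
      by (auto simp: ennreal_add_less_top intro: le_less_trans)
    finally show ?thesis by (simp add: ennreal_mult_less_top)
  qed
  finally have "emeasure surface_measure ?E = 0"
    by (auto simp: ennreal_mult_less_top top_unique split: if_splits)
  then show ?thesis using E by (auto intro!: null_setsI sets_surface_measure)
qed

text \<open>If the upper limit is finite, \<open>u\<close> is at most some \<open>m\<close> on the
  outer radius, so \<rho> coincides there with the band of upper level \<open>m + 1\<close> and the
  outer radius has finite \<rho>-length. Its tails tend to 0, and running down the radius to
  \<open>tk (Suc k)\<close> gives the bound.\<close>

lemma rho_norm_le_radial_limsup:
  assumes \<omega>: "norm \<omega> = 1" and fin: "\<And>m. radial_energy m \<omega> < \<infinity>"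
  shows "rho_norm \<rho> \<omega> \<le> radial_limsup \<omega>"
proof (cases "radial_limsup \<omega> < \<infinity>")
  case True
  obtain m :: nat where m: "\<And>t. 1/2 \<le> t \<Longrightarrow> t < 1 \<Longrightarrow> u (t *\<^sub>R \<omega>) \<le> real m"
    using radial_limsup_bounded[OF \<omega> True] by blast
  let ?b = "\<lambda>r. ennreal (band (-1) (real m + 1) (r *\<^sub>R \<omega>))"
  have b: "ennreal (\<rho> (r *\<^sub>R \<omega>)) = ?b r" if "1/2 \<le> r" "r < 1" for r
    using m[OF that] u_nonneg[of "r *\<^sub>R \<omega>"] \<omega> that by (simp add: band_def)
  \<comment> \<open>The shift to \<open>Suc k\<close> skips \<open>tk 0 = 1/2\<close>, so that the
    tails, closed on the left, lie in the open interval used by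
    \<open>radial_energy\<close>.\<close>
  let ?T = "\<lambda>k. \<integral>\<^sup>+r\<in>{tk (Suc k)..<1}. ?b r \<partial>lborel"
  have tk_less: "1/2 < tk (Suc k)" for k by (simp add: tk_def field_simps)
  have "?T \<longlonglongrightarrow> 0"
  proof (rule decreasing_nn_integral_tendsto_0)
    show "decseq (\<lambda>k. {tk (Suc k)..<1})"
      by (auto simp: decseq_def tk_def intro: order_trans[rotated] divide_left_mono)
    have "(\<integral>\<^sup>+r\<in>{tk (Suc 0)..<1}. ?b r \<partial>lborel) \<le> radial_energy m \<omega>"
      unfolding radial_energy_def using tk_less[of 0] by (intro nn_integral_mono) (auto simp: indicator_def)
    then show "(\<integral>\<^sup>+r\<in>{tk (Suc 0)..<1}. ?b r \<partial>lborel) < \<infinity>" using fin[of m] by (rule le_less_trans)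
    fix r assume r: "\<forall>k. r \<in> {tk (Suc k)..<1}"
    have "(\<lambda>k. tk (Suc k)) \<longlonglongrightarrow> 1" by (rule LIMSEQ_Suc[OF tk_tendsto])
    then have "1 \<le> r" by (rule LIMSEQ_le_const2) (use r in auto)
    then show "?b r = 0" using r by auto
  qed auto
  show ?thesis
  proof (rule ennreal_le_epsilon)
    fix e :: real assume e: "0 < e"
    have "eventually (\<lambda>k. ?T k < ennreal e) sequentially"
      using \<open>?T \<longlonglongrightarrow> 0\<close> e by (intro order_tendstoD(2)) auto
    then have "eventually (\<lambda>k. rho_norm \<rho> \<omega> - ennreal e \<le> ennreal (u (tk (Suc k) *\<^sub>R \<omega>))) sequentially"
    proof eventually_elim
      case (elim k)
      let ?t = "tk (Suc k)"
      have tb: "?t *\<^sub>R \<omega> \<in> ball 0 1" using \<omega> tk_bounds[of "Suc k"] by simp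
      have "rho_norm \<rho> \<omega> \<le> (\<integral>\<^sup>+r\<in>{?t..<1}. ennreal (\<rho> (r *\<^sub>R \<omega>)) \<partial>lborel) + rho_norm \<rho> (?t *\<^sub>R \<omega>)"
        using tk_bounds[of "Suc k"] by (intro rho_norm_sphere_le[OF \<omega>]) auto
      also have "(\<integral>\<^sup>+r\<in>{?t..<1}. ennreal (\<rho> (r *\<^sub>R \<omega>)) \<partial>lborel) = ?T k"
        using b tk_bounds[of "Suc k"] by (intro nn_integral_cong) (auto simp: indicator_def)
      also have "?T k \<le> ennreal e" using elim by simp
      finally show ?case using rho_norm_u[OF tb] by (auto simp: ennreal_minus_le_iff add_right_mono)
    qed
    then have "eventually (\<lambda>k. rho_norm \<rho> \<omega> - ennreal e \<le> ennreal (u (tk k *\<^sub>R \<omega>))) sequentially"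
      by (subst (asm) eventually_sequentially_Suc)
    then have "rho_norm \<rho> \<omega> - ennreal e \<le> radial_limsup \<omega>"
      unfolding radial_limsup_alt[OF \<omega>] by (intro le_Limsup) auto
    then show "rho_norm \<rho> \<omega> \<le> radial_limsup \<omega> + ennreal e"
      by (simp add: ennreal_minus_le_iff add.commute)
  qed
qed (simp add: less_top[symmetric])

text \<open>The exceptional set is a union over all \<open>m\<close>, because the bound for
  \<open>u\<close> on a radius depends on the radius.\<close>

lemma rho_norm_AE_radial_limsup: "AE \<omega> in surface_measure. rho_norm \<rho> \<omega> = radial_limsup \<omega>"
proof (rule AE_I')
  show "(\<Union>m. {\<omega> \<in> sphere 0 1. radial_energy m \<omega> = \<infinity>}) \<in> null_sets surface_measure"
    by (intro null_sets_UN infinite_radial_energy_null)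
  show "{\<omega> \<in> space surface_measure. rho_norm \<rho> \<omega> \<noteq> radial_limsup \<omega>} \<subseteq> (\<Union>m. {\<omega> \<in> sphere 0 1. radial_energy m \<omega> = \<infinity>})"
  proof
    fix \<omega> assume "\<omega> \<in> {\<omega> \<in> space surface_measure. rho_norm \<rho> \<omega> \<noteq> radial_limsup \<omega>}"
    then have \<omega>: "norm \<omega> = 1" and ne: "rho_norm \<rho> \<omega> \<noteq> radial_limsup \<omega>" by (auto simp: space_surface_measure)
    then have "\<not> rho_norm \<rho> \<omega> \<le> radial_limsup \<omega>" using radial_limsup_le_rho_norm[OF \<omega>] by auto
    then obtain m where "\<not> radial_energy m \<omega> < \<infinity>" using rho_norm_le_radial_limsup[OF \<omega>] by blast
    then show "\<omega> \<in> (\<Union>m. {\<omega> \<in> sphere 0 1. radial_energy m \<omega> = \<infinity>})" using \<omega> by (auto simp: less_top[symmetric])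
  qed
qed

end

text \<open>This is where completeness of the surface measure enters: the superlevel sets of
  \<open>f\<close> and \<open>g\<close> differ only inside a null set.\<close>

lemma measurable_surface_measure_AE:
  fixes f g :: "'a::euclidean_space \<Rightarrow> ennreal"
  assumes g: "g \<in> borel_measurable borel" and ae: "AE \<omega> in surface_measure. f \<omega> = g \<omega>"
  shows "f \<in> borel_measurable surface_measure"
proof -
  have complete: "S \<in> sets surface_measure" if "S \<subseteq> N" "N \<in> null_sets surface_measure" for S N :: "'a set"
    using that unfolding surface_measure_def by (rule completion.complete)
  have gm: "g \<in> borel_measurable surface_measure" using g by (rule measurable_surface_measure)
  show ?thesis
  proof (rule borel_measurableI_greater)
    fix y :: ennreal
    from ae obtain N where N: "{\<omega> \<in> space surface_measure. f \<omega> \<noteq> g \<omega>} \<subseteq> N"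
      "emeasure surface_measure N = 0" "N \<in> sets surface_measure" by (rule AE_E)
    then have N0: "N \<in> null_sets surface_measure" by (intro null_setsI)
    have fg: "f \<omega> = g \<omega>" if "\<omega> \<in> space surface_measure" "\<omega> \<notin> N" for \<omega>
      using N(1) that by blast
    let ?G = "{\<omega> \<in> space surface_measure. y < g \<omega>}"
    let ?F = "{\<omega> \<in> space surface_measure. y < f \<omega>}"
    have G: "?G \<in> sets surface_measure" using gm by measurable
    have "\<omega> \<in> ?F \<longleftrightarrow> \<omega> \<in> (?G - N) \<union> (?F \<inter> N)" for \<omega>
    proof (cases "\<omega> \<in> space surface_measure \<and> \<omega> \<notin> N")
      case True
      then have "f \<omega> = g \<omega>" using fg by blast
      then show ?thesis using True by simp
    next
      case False
      then show ?thesis by blast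
    qed
    then have eq: "?F = (?G - N) \<union> (?F \<inter> N)" by (rule set_eqI)
    have "?F \<inter> N \<in> sets surface_measure"
      by (rule complete[OF Int_lower2 N0])
    moreover have "?G - N \<in> sets surface_measure" using G N(3) by (rule sets.Diff)
    ultimately have "(?G - N) \<union> (?F \<inter> N) \<in> sets surface_measure" by (intro sets.Un)
    then show "?F \<in> sets surface_measure" unfolding eq[symmetric] .
  qed
qed

section \<open>Comparison of distributions\<close>

lemma emeasure_lborel_below:
  fixes a :: ennreal
  shows "emeasure lborel {s::real. 0 \<le> s \<and> ennreal s < a} = a"
proof (cases a rule: ennreal_cases)
  case (real r)
  then have "{s::real. 0 \<le> s \<and> ennreal s < a} = {0..<r}" by (auto simp: ennreal_less_iff)
  then show ?thesis using real by simp
next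
  case top
  then have eq: "{s::real. 0 \<le> s \<and> ennreal s < a} = {0..}" by auto
  have "ennreal (real n) \<le> emeasure lborel {0::real..}" for n
  proof -
    have "ennreal (real n) = emeasure lborel {0..real n}" by simp
    also have "\<dots> \<le> emeasure lborel {0::real..}" by (intro emeasure_mono) auto
    finally show ?thesis .
  qed
  then have "emeasure lborel {0::real..} = top"
    by (metis ennreal_of_nat_eq_real_of_nat ennreal_Ex_less_of_nat linorder_not_less top.not_eq_extremum)
  then show ?thesis using top eq by simp
qed

text \<open>Tonelli's theorem for the region below the graph. Levels are real numbers;
  \<open>emeasure_lborel_below\<close> recovers \<open>h x\<close> from them also when it is
  infinite.\<close>

lemma nn_integral_layer_cake:
  fixes h :: "'b \<Rightarrow> ennreal"
  assumes M: "sigma_finite_measure M" and h[measurable]: "h \<in> borel_measurable M"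
  shows "(\<integral>\<^sup>+x. h x \<partial>M) = (\<integral>\<^sup>+s. indicator {0..} s * emeasure M {x \<in> space M. ennreal s < h x} \<partial>lborel)"
proof -
  interpret M: sigma_finite_measure M by fact
  interpret pair_sigma_finite M lborel ..
  let ?k = "\<lambda>x s. indicator {0..} s * indicator {x \<in> space M. ennreal s < h x} x :: ennreal"
  have "(\<integral>\<^sup>+x. h x \<partial>M) = (\<integral>\<^sup>+x. (\<integral>\<^sup>+s. ?k x s \<partial>lborel) \<partial>M)"
  proof (rule nn_integral_cong)
    fix x assume x: "x \<in> space M"
    have "{s::real. 0 \<le> s \<and> ennreal s < h x} \<in> sets borel" by measurable
    moreover have "?k x s = indicator {s. 0 \<le> s \<and> ennreal s < h x} s" for s using x by (auto simp: indicator_def)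
    ultimately show "h x = (\<integral>\<^sup>+s. ?k x s \<partial>lborel)"
      by (simp add: emeasure_lborel_below)
  qed
  also have "\<dots> = (\<integral>\<^sup>+s. (\<integral>\<^sup>+x. ?k x s \<partial>M) \<partial>lborel)"
  proof (rule Fubini'[symmetric])
    have "(\<lambda>p. indicator {0..} (snd p) * indicator {p \<in> space (M \<Otimes>\<^sub>M lborel). ennreal (snd p) < h (fst p)} p :: ennreal) \<in> borel_measurable (M \<Otimes>\<^sub>M lborel)"
      by measurable
    also have "?this \<longleftrightarrow> case_prod ?k \<in> borel_measurable (M \<Otimes>\<^sub>M lborel)"
      by (intro measurable_cong) (auto simp: space_pair_measure indicator_def)
    finally show "case_prod ?k \<in> borel_measurable (M \<Otimes>\<^sub>M lborel)" .
  qed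
  also have "\<dots> = (\<integral>\<^sup>+s. indicator {0..} s * emeasure M {x \<in> space M. ennreal s < h x} \<partial>lborel)"
    by (intro nn_integral_cong) (simp add: nn_integral_cmult)
  finally show ?thesis .
qed

text \<open>Superlevel sets of \<psi> applied to a multiple of \<open>g\<close> are superlevel sets
  of \<open>g\<close>, so the layer-cake formula reduces the claim to \<open>compare\<close>. At
  levels below \<open>\<psi> (ennreal (\<delta> * l0))\<close> the superlevel set is bounded by the
  whole space, which gives the first term.\<close>

lemma growth_integral_compare:
  fixes f :: "'b \<Rightarrow> ennreal" and g :: "'c \<Rightarrow> ennreal" and \<psi> :: "ennreal \<Rightarrow> ennreal"
  assumes M: "finite_measure M" and N: "finite_measure N"
    and f: "f \<in> borel_measurable M" and g: "g \<in> borel_measurable N"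
    and \<psi>: "mono \<psi>" "continuous_on UNIV \<psi>" and c: "0 < c" and l0: "0 \<le> l0" and \<delta>: "0 < \<delta>"
    and compare: "\<And>l. l0 \<le> l \<Longrightarrow>
      emeasure M {x \<in> space M. ennreal (c * l) < f x} \<le> C * emeasure N {x \<in> space N. ennreal l < g x}"
  shows "(\<integral>\<^sup>+x. \<psi> (ennreal (\<delta> / c) * f x) \<partial>M)
    \<le> \<psi> (ennreal (\<delta> * l0)) * emeasure M (space M) + C * (\<integral>\<^sup>+x. \<psi> (ennreal \<delta> * g x) \<partial>N)"
proof -
  interpret M: finite_measure M by fact
  interpret N: finite_measure N by fact
  note [measurable] = f g
  have [measurable]: "\<psi> \<in> borel_measurable borel" using \<psi>(2) by (rule borel_measurable_continuous_onI)
  let ?s0 = "\<psi> (ennreal (\<delta> * l0))"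
  let ?F = "\<lambda>s. {x \<in> space M. ennreal s < \<psi> (ennreal (\<delta> / c) * f x)}"
  let ?G = "\<lambda>s. {x \<in> space N. ennreal s < \<psi> (ennreal \<delta> * g x)}"
  have key: "emeasure M (?F s) \<le> C * emeasure N (?G s)" if s: "?s0 \<le> ennreal s" for s
  proof -
    let ?\<phi> = "\<lambda>t. \<psi> (ennreal \<delta> * t)"
    \<comment> \<open>By continuity the supremum of this set belongs to it. Hence a value of
      \<open>?\<phi>\<close> exceeds \<open>s\<close> exactly when its argument exceeds
      \<open>Sup ?T\<close>, and no inverse of \<psi> is involved.\<close>
    let ?T = "{t. ?\<phi> t \<le> ennreal s}"
    have mono: "mono ?\<phi>" by (intro monoI monoD[OF \<psi>(1)] mult_left_mono) auto
    have cont: "continuous_on UNIV ?\<phi>"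
      by (intro continuous_on_compose2[OF \<psi>(2)] ennreal_continuous_on_cmult) (auto intro: continuous_on_id)
    have l0T: "ennreal l0 \<in> ?T" using s \<delta> l0 by (simp add: ennreal_mult)
    have "?\<phi> (Sup ?T) = (SUP t\<in>?T. ?\<phi> t)"
    proof (rule continuous_at_Sup_mono[OF mono])
      have "isCont ?\<phi> (Sup ?T)" using cont by (simp add: continuous_on_eq_continuous_at)
      then show "continuous (at_left (Sup ?T)) ?\<phi>" by (rule continuous_at_imp_continuous_at_within)
      show "?T \<noteq> {}" using l0T by blast
    qed auto
    also have "\<dots> \<le> ennreal s" by (rule SUP_least) auto
    finally have sup: "?\<phi> (Sup ?T) \<le> ennreal s" .
    show ?thesis
    proof (cases "Sup ?T" rule: ennreal_cases)
      case (real l)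
      have "ennreal l0 \<le> ennreal l" using l0T unfolding real(2)[symmetric] by (rule Sup_upper)
      then have l: "l0 \<le> l" using real(1) by (simp add: ennreal_le_iff)
      have "?F s \<subseteq> {x \<in> space M. ennreal (c * l) < f x}"
      proof (intro Collect_mono impI conjI)
        fix x assume x: "x \<in> space M \<and> ennreal s < \<psi> (ennreal (\<delta> / c) * f x)"
        show "ennreal (c * l) < f x"
        proof (rule ccontr)
          assume "\<not> ennreal (c * l) < f x"
          then have "ennreal (\<delta> / c) * f x \<le> ennreal (\<delta> / c) * ennreal (c * l)"
            by (intro mult_left_mono) auto
          also have "\<dots> = ennreal \<delta> * ennreal l"
            using c \<delta> real(1) by (simp add: ennreal_mult[symmetric])
          finally have "\<psi> (ennreal (\<delta> / c) * f x) \<le> ?\<phi> (Sup ?T)"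
            unfolding real(2) by (rule monoD[OF \<psi>(1)])
          then show False using sup x by auto
        qed
      qed auto
      then have "emeasure M (?F s) \<le> emeasure M {x \<in> space M. ennreal (c * l) < f x}"
        by (intro emeasure_mono) measurable
      also have "\<dots> \<le> C * emeasure N {x \<in> space N. ennreal l < g x}" by (rule compare[OF l])
      also have "\<dots> \<le> C * emeasure N (?G s)"
      proof (intro mult_left_mono emeasure_mono Collect_mono impI conjI)
        fix x assume x: "x \<in> space N \<and> ennreal l < g x"
        show "ennreal s < \<psi> (ennreal \<delta> * g x)"
        proof (rule ccontr)
          assume "\<not> ennreal s < \<psi> (ennreal \<delta> * g x)"
          then have "g x \<in> ?T" by simp
          then have "g x \<le> Sup ?T" by (rule Sup_upper)
          then show False using x real by auto
        qed
      qed auto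
      finally show ?thesis .
    next
      \<comment> \<open>Here even the value of \<psi> at infinity is at most \<open>s\<close>, so
        the set on the left is empty.\<close>
      case top
      have "\<psi> (ennreal (\<delta> / c) * f x) \<le> ennreal s" for x
      proof -
        have "ennreal (\<delta> / c) * f x \<le> ennreal \<delta> * Sup ?T"
          using \<delta> unfolding top by (simp add: ennreal_mult_top)
        then show ?thesis using monoD[OF \<psi>(1)] sup by (blast intro: order_trans)
      qed
      then have empty: "?F s = {}" by (auto simp: not_less)
      show ?thesis unfolding empty by simp
    qed
  qed
  have m1: "(\<lambda>s. indicator {s::real. 0 \<le> s \<and> ennreal s < ?s0} s * emeasure M (space M)) \<in> borel_measurable lborel"
    by measurable
  have Gm: "(\<lambda>s. emeasure N (?G s)) \<in> borel_measurable borel"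
  proof -
    have "{p \<in> space (borel \<Otimes>\<^sub>M N). ennreal (fst p) < \<psi> (ennreal \<delta> * g (snd p))} \<in> sets (borel \<Otimes>\<^sub>M N)"
      by measurable
    from N.measurable_emeasure_Pair[OF this]
    show ?thesis by (rule measurable_cong[THEN iffD1, rotated]) (auto simp: space_pair_measure intro!: arg_cong[where f="emeasure N"])
  qed
  have "(\<integral>\<^sup>+x. \<psi> (ennreal (\<delta> / c) * f x) \<partial>M) = (\<integral>\<^sup>+s. indicator {0..} s * emeasure M (?F s) \<partial>lborel)"
    by (rule nn_integral_layer_cake[OF M.sigma_finite_measure_axioms]) measurable
  also have "\<dots> \<le> (\<integral>\<^sup>+s. indicator {s::real. 0 \<le> s \<and> ennreal s < ?s0} s * emeasure M (space M)
      + C * (indicator {0..} s * emeasure N (?G s)) \<partial>lborel)"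
  proof (rule nn_integral_mono)
    fix s :: real
    show "indicator {0..} s * emeasure M (?F s) \<le> indicator {s::real. 0 \<le> s \<and> ennreal s < ?s0} s * emeasure M (space M)
      + C * (indicator {0..} s * emeasure N (?G s))"
    proof (cases "0 \<le> s \<and> ennreal s < ?s0")
      case True
      have "emeasure M (?F s) \<le> emeasure M (space M)" by (rule emeasure_space)
      then show ?thesis using True by (simp add: add_increasing2)
    next
      case False
      then show ?thesis using key[of s] by (auto simp: indicator_def not_less)
    qed
  qed
  also have "\<dots> = (\<integral>\<^sup>+s. indicator {s::real. 0 \<le> s \<and> ennreal s < ?s0} s * emeasure M (space M) \<partial>lborel)
      + (\<integral>\<^sup>+s. C * (indicator {0..} s * emeasure N (?G s)) \<partial>lborel)"
    using m1 Gm by (intro nn_integral_add) measurable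
  also have "(\<integral>\<^sup>+s. indicator {s::real. 0 \<le> s \<and> ennreal s < ?s0} s * emeasure M (space M) \<partial>lborel) = ?s0 * emeasure M (space M)"
    by (subst nn_integral_multc) (auto simp: emeasure_lborel_below)
  also have "(\<integral>\<^sup>+s. C * (indicator {0..} s * emeasure N (?G s)) \<partial>lborel) = C * (\<integral>\<^sup>+s. indicator {0..} s * emeasure N (?G s) \<partial>lborel)"
    using Gm by (intro nn_integral_cmult) measurable
  also have "(\<integral>\<^sup>+s. indicator {0..} s * emeasure N (?G s) \<partial>lborel) = (\<integral>\<^sup>+x. \<psi> (ennreal \<delta> * g x) \<partial>N)"
    by (rule nn_integral_layer_cake[symmetric, OF N.sigma_finite_measure_axioms]) measurable
  finally show ?thesis .
qed

text \<open>With the weight moved into a finite measure, (4) becomes integrability of \<psi> of a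
  function, the form that \<open>growth_integral_compare\<close> handles. In use \<open>m\<close> is
  \<open>DIM('a) - 2\<close>.\<close>

definition weight_measure :: "nat \<Rightarrow> real measure" where
  "weight_measure m = density (lebesgue_on {0<..<1}) (\<lambda>r. ennreal ((1 - r) ^ m))"

lemma weight_measurable[measurable]: "(\<lambda>r. ennreal ((1 - r) ^ m)) \<in> borel_measurable (lebesgue_on {0<..<1::real})"
  by (intro measurable_restrict_space1 measurable_completion) measurable

lemma space_weight_measure: "space (weight_measure m) = {0<..<1}"
  by (simp add: weight_measure_def space_restrict_space)

lemma emeasure_weight_measure:
  assumes "T \<in> sets (weight_measure m)"
  shows "emeasure (weight_measure m) T = (\<integral>\<^sup>+r. ennreal ((1 - r) ^ m) * indicator T r \<partial>lborel)"
proof -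
  have T: "T \<in> sets (lebesgue_on {0<..<1})" using assms by (simp add: weight_measure_def)
  then have sub: "T \<subseteq> {0<..<1}" by (auto simp: sets_restrict_space)
  have "emeasure (weight_measure m) T = (\<integral>\<^sup>+r\<in>T. ennreal ((1 - r) ^ m) \<partial>lebesgue_on {0<..<1})"
    unfolding weight_measure_def using T by (intro emeasure_density) measurable
  also have "\<dots> = (\<integral>\<^sup>+r. ennreal ((1 - r) ^ m) * indicator T r * indicator {0<..<1} r \<partial>lebesgue)"
    by (rule nn_integral_restrict_space) simp
  also have "\<dots> = (\<integral>\<^sup>+r. ennreal ((1 - r) ^ m) * indicator T r * indicator {0<..<1} r \<partial>lborel)"
    by (rule nn_integral_completion)
  also have "\<dots> = (\<integral>\<^sup>+r. ennreal ((1 - r) ^ m) * indicator T r \<partial>lborel)"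
    using sub by (intro nn_integral_cong) (auto simp: indicator_def)
  finally show ?thesis .
qed

text \<open>\<open>T\<close> lies within distance \<open>b\<close> of the endpoint 1, and there the
  density is at most \<open>b ^ m\<close>.\<close>

lemma emeasure_weight_measure_le:
  assumes T: "T \<in> sets (weight_measure m)" and K: "0 \<le> K" "\<And>r. r \<in> T \<Longrightarrow> (1 - r) ^ Suc m \<le> K"
  shows "emeasure (weight_measure m) T \<le> ennreal K"
proof -
  have sub: "T \<subseteq> {0<..<1}" using sets.sets_into_space[OF T] by (simp add: space_weight_measure)
  define b where "b = min 1 (root (Suc m) K)"
  have b: "0 \<le> b" using K by (simp add: b_def)
  have "b ^ Suc m \<le> root (Suc m) K ^ Suc m" using b by (intro power_mono) (auto simp: b_def)
  also have "\<dots> = K" using K by (intro real_root_pow_pos2) auto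
  finally have bK: "b ^ Suc m \<le> K" .
  have rb: "1 - r \<le> b" if "r \<in> T" for r
  proof -
    have "0 \<le> 1 - r" using that sub by auto
    then have "1 - r = root (Suc m) ((1 - r) ^ Suc m)" by (intro real_root_power_cancel[symmetric]) auto
    also have "\<dots> \<le> root (Suc m) K" using K(2)[OF that] by (intro real_root_le_mono) auto
    finally show ?thesis using that sub by (auto simp: b_def)
  qed
  have "emeasure (weight_measure m) T = (\<integral>\<^sup>+r. ennreal ((1 - r) ^ m) * indicator T r \<partial>lborel)"
    by (rule emeasure_weight_measure[OF T])
  also have "\<dots> \<le> (\<integral>\<^sup>+r. ennreal (b ^ m) * indicator {1 - b..1} r \<partial>lborel)"
    using rb sub by (intro nn_integral_mono) (fastforce simp: indicator_def intro!: ennreal_leI power_mono)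
  also have "\<dots> = ennreal (b ^ Suc m)"
    using b by (simp add: nn_integral_cmult_indicator ennreal_mult[symmetric] mult.commute)
  also have "\<dots> \<le> ennreal K" using bK by (rule ennreal_leI)
  finally show ?thesis .
qed

text \<open>Only the left half of \<open>{a<..<1}\<close> is counted, where \<open>1 - r\<close> is
  at least \<open>(1 - a) / 2\<close>.\<close>

lemma emeasure_weight_measure_ge:
  assumes T: "T \<in> sets (weight_measure m)" and a: "0 \<le> a" "a < 1" "{a<..<1} \<subseteq> T"
  shows "ennreal (((1 - a) / 2) ^ Suc m) \<le> emeasure (weight_measure m) T"
proof -
  let ?h = "(1 - a) / 2"
  have "ennreal (?h ^ Suc m) = (\<integral>\<^sup>+r. ennreal (?h ^ m) * indicator {a<..<a + ?h} r \<partial>lborel)"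
    using a by (simp add: nn_integral_cmult_indicator ennreal_mult[symmetric] mult.commute)
  also have "\<dots> \<le> (\<integral>\<^sup>+r. ennreal ((1 - r) ^ m) * indicator T r \<partial>lborel)"
  proof (rule nn_integral_mono)
    fix r
    show "ennreal (?h ^ m) * indicator {a<..<a + ?h} r \<le> ennreal ((1 - r) ^ m) * indicator T r"
    proof (cases "r \<in> {a<..<a + ?h}")
      case True
      have h: "2 * ?h = 1 - a" by simp
      have "r < a + ?h" "a < r" using True by auto
      then have "?h \<le> 1 - r" "r < 1" using h a by linarith+
      moreover have "r \<in> T" using \<open>a < r\<close> \<open>r < 1\<close> a(3) by auto
      ultimately show ?thesis using True a by (auto intro!: ennreal_leI power_mono)
    qed simp
  qed
  also have "\<dots> = emeasure (weight_measure m) T"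
    by (rule emeasure_weight_measure[OF T, symmetric])
  finally show ?thesis .
qed

lemma finite_weight_measure: "finite_measure (weight_measure m)"
proof
  have "emeasure (weight_measure m) (space (weight_measure m)) \<le> ennreal 1"
    by (rule emeasure_weight_measure_le[OF sets.top]) (auto simp: space_weight_measure power_le_one simp del: power_Suc)
  then show "emeasure (weight_measure m) (space (weight_measure m)) \<noteq> \<infinity>" by (auto simp: top_unique)
qed

lemma finite_surface_measure: "finite_measure (surface_measure :: 'a::euclidean_space measure)"
  using emeasure_surface_measure_sphere[where 'a='a]
  by (intro finite_measureI) (simp add: space_surface_measure less_top)

lemma max_modulus_mono: "r \<le> s \<Longrightarrow> max_modulus r \<rho> \<le> max_modulus s \<rho>"
  unfolding max_modulus_def by (intro SUP_subset_mono) auto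

lemma max_modulus_measurable[measurable]: "(\<lambda>r. max_modulus r \<rho>) \<in> borel_measurable borel"
proof (rule borel_measurableI_greater)
  fix y :: ennreal
  have "is_interval {r. y < max_modulus r \<rho>}"
    using max_modulus_mono by (auto simp: is_interval_1 intro: less_le_trans)
  then show "{r \<in> space borel. y < max_modulus r \<rho>} \<in> sets borel"
    by (simp add: real_interval_borel_measurable)
qed

text \<open>On the sphere the radius of the Whitney ball at \<open>t *\<^sub>R \<omega>\<close>
  depends on \<open>t\<close> alone, so for fixed \<open>t\<close> and \<open>x\<close> it is an
  open condition on \<omega> that this ball contains \<open>x\<close>. Superlevel sets are unions of
  such sets.\<close>

lemma nt_maximal_measurable:
  fixes \<rho> :: "'a::euclidean_space \<Rightarrow> real"
  shows "nt_maximal \<rho> \<in> borel_measurable surface_measure"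
proof (rule borel_measurableI_greater)
  fix y :: ennreal
  let ?U = "\<Union>t\<in>{0..<1}. \<Union>x\<in>{x. y < rho_norm \<rho> x}. {\<omega>::'a. dist (t *\<^sub>R \<omega>) x < (1 - t) / 2}"
  have "open {\<omega>::'a. dist (t *\<^sub>R \<omega>) x < (1 - t) / 2}" for t x
    by (intro open_Collect_less continuous_intros)
  then have U: "open ?U" by blast
  have key: "y < nt_maximal \<rho> \<omega> \<longleftrightarrow> \<omega> \<in> ?U" if "norm \<omega> = 1" for \<omega> :: 'a
  proof -
    have "x \<in> approach_region \<omega> \<longleftrightarrow> (\<exists>t\<in>{0..<1}. dist (t *\<^sub>R \<omega>) x < (1 - t) / 2)" for x
      using that by (auto simp: approach_region_def whitney_ball_def)
    then show ?thesis unfolding nt_maximal_def less_SUP_iff by blast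
  qed
  have "{\<omega> \<in> space surface_measure. y < nt_maximal \<rho> \<omega>} = {\<omega> \<in> sphere 0 1. \<omega> \<in> ?U}"
    unfolding space_surface_measure by (intro Collect_cong conj_cong refl key) (simp only: mem_sphere_0)
  also have "\<dots> = sphere 0 1 \<inter> ?U" by blast
  also have "\<dots> \<in> sets surface_measure"
    using U by (intro sets_surface_measure sets.Int borel_open borel_closed closed_sphere) auto
  finally show "{\<omega> \<in> space surface_measure. y < nt_maximal \<rho> \<omega>} \<in> sets surface_measure" .
qed

section \<open>The two distributional inequalities in terms of the weighted measure\<close>

context conformal begin

lemma max_modulus_finite:
  assumes "r < 1"
  shows "max_modulus r \<rho> < \<infinity>"
proof -
  have sub: "cball 0 r \<subseteq> ball (0::'a) 1" using assms by auto
  have "compact (u ` cball 0 r)"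
    by (intro compact_continuous_image continuous_on_subset[OF u_continuous sub] compact_cball)
  then have "bounded (u ` cball 0 r)" by (rule compact_imp_bounded)
  then obtain m where m: "\<And>x. x \<in> cball 0 r \<Longrightarrow> \<bar>u x\<bar> \<le> m" by (force simp: bounded_iff)
  have "max_modulus r \<rho> \<le> ennreal m"
    unfolding max_modulus_def
  proof (rule SUP_least)
    fix x assume x: "x \<in> cball (0::'a) r"
    then have "rho_norm \<rho> x = ennreal (u x)" using sub by (intro rho_norm_u) blast
    then show "rho_norm \<rho> x \<le> ennreal m" using m[OF x] by (auto intro: ennreal_leI)
  qed
  then show ?thesis by (simp add: le_less_trans)
qed

lemma u_le_max_modulus:
  assumes "norm x \<le> r" "norm x < 1"
  shows "ennreal (u x) \<le> max_modulus r \<rho>"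
  using rho_norm_u[of x] assms unfolding max_modulus_def by (auto intro!: SUP_upper2[of x])

lemma rho_norm_le_nt_maximal:
  assumes "norm \<omega> = 1" "0 \<le> t" "t < 1"
  shows "rho_norm \<rho> (t *\<^sub>R \<omega>) \<le> nt_maximal \<rho> \<omega>"
  unfolding nt_maximal_def
  using assms centre_whitney_ball[of "t *\<^sub>R \<omega>"] by (intro SUP_upper) (auto simp: approach_region_def)

lemma radial_limsup_le_nt_maximal:
  assumes "norm \<omega> = 1"
  shows "radial_limsup \<omega> \<le> nt_maximal \<rho> \<omega>"
  unfolding radial_limsup_alt[OF assms]
proof (intro Limsup_bounded always_eventually allI)
  fix k
  have "tk k *\<^sub>R \<omega> \<in> ball 0 1" using assms tk_bounds[of k] by simp
  then show "ennreal (u (tk k *\<^sub>R \<omega>)) \<le> nt_maximal \<rho> \<omega>"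
    using rho_norm_le_nt_maximal[OF assms, of "tk k"] tk_bounds[of k] by (simp add: rho_norm_u)
qed

text \<open>If the modulus at \<open>r\<close> exceeds the level, so does \<open>u\<close> at some
  \<open>x\<close> with \<open>norm x \<le> r\<close>, and the set given by
  \<open>shadow_measure\<close> lies in the superlevel set of \<open>g\<close>. Hence the measure of
  that superlevel set bounds (1 - r)^(n-1), and \<open>emeasure_weight_measure_le\<close> applies.
  \<open>g\<close> and the cutoff \<open>R\<close> are left free to serve both the radial upper
  limit, with \<open>R = 1\<close>, and the values of \<open>u\<close> on the sphere of radius
  \<open>R\<close>.\<close>

lemma max_modulus_distribution:
  assumes dim: "DIM('a) \<ge> 2"
  obtains c l0 C where "0 < c" "0 < l0" "0 < C"
    "\<And>g R l. g \<in> borel_measurable borel \<Longrightarrow>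
      (\<And>\<omega> a v. norm \<omega> = 1 \<Longrightarrow> 0 < a \<Longrightarrow> a < R \<Longrightarrow> a < 1 \<Longrightarrow> (\<And>t. a \<le> t \<Longrightarrow> t < 1 \<Longrightarrow> v \<le> u (t *\<^sub>R \<omega>)) \<Longrightarrow> ennreal v \<le> g \<omega>) \<Longrightarrow>
      l0 \<le> l \<Longrightarrow>
      emeasure (weight_measure (DIM('a) - 2)) {r \<in> space (weight_measure (DIM('a) - 2)). ennreal (1 / c * l) < max_modulus r \<rho> * indicator {..<R} r}
        \<le> ennreal C * emeasure surface_measure {\<omega> \<in> space surface_measure. ennreal l < g \<omega>}"
proof -
  let ?m = "DIM('a) - 2"
  have m: "DIM('a) - 1 = Suc ?m" using dim by simp
  obtain c c' where c: "0 < c" "0 < c'"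
    "\<And>x. x \<in> ball 0 1 \<Longrightarrow> 1/2 \<le> norm x \<Longrightarrow> 0 < u x \<Longrightarrow>
      \<exists>G\<in>sets borel. G \<subseteq> sphere 0 1 \<and> (\<forall>\<omega>\<in>G. \<forall>R\<in>{norm x..<1}. c * u x \<le> u (R *\<^sub>R \<omega>)) \<and>
        ennreal (c' * (1 - norm x) ^ (DIM('a) - 1)) \<le> emeasure surface_measure G"
    using shadow_measure[OF dim] by blast
  \<comment> \<open>Above this level a point must have norm greater than 1/2, as
    \<open>shadow_measure\<close> requires; the maximum with 1 keeps the level positive.\<close>
  define h where "h = max 1 (enn2real (max_modulus (1/2) \<rho>))"
  have h: "max_modulus (1/2) \<rho> \<le> ennreal h" "0 < h"
  proof -
    have "max_modulus (1/2) \<rho> = ennreal (enn2real (max_modulus (1/2) \<rho>))"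
      using max_modulus_finite[of "1/2"] by simp
    also have "\<dots> \<le> ennreal h" by (intro ennreal_leI) (simp add: h_def)
    finally show "max_modulus (1/2) \<rho> \<le> ennreal h" .
  qed (simp add: h_def)
  show thesis
  proof (rule that[of c "c * h" "1 / c'"])
    fix g :: "'a \<Rightarrow> ennreal" and R l :: real
    assume g[measurable]: "g \<in> borel_measurable borel"
      and dom: "\<And>\<omega> a v. norm \<omega> = 1 \<Longrightarrow> 0 < a \<Longrightarrow> a < R \<Longrightarrow> a < 1 \<Longrightarrow> (\<And>t. a \<le> t \<Longrightarrow> t < 1 \<Longrightarrow> v \<le> u (t *\<^sub>R \<omega>)) \<Longrightarrow> ennreal v \<le> g \<omega>"
      and l: "c * h \<le> l"
    let ?W = "{\<omega> \<in> space surface_measure. ennreal l < g \<omega>}"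
    let ?T = "{r \<in> space (weight_measure ?m). ennreal (1 / c * l) < max_modulus r \<rho> * indicator {..<R} r}"
    have l': "h \<le> 1 / c * l" using l c(1) by (simp add: le_divide_eq mult.commute)
    have [measurable]: "g \<in> borel_measurable surface_measure" using g by (rule measurable_surface_measure)
    have W: "?W \<in> sets surface_measure" by measurable
    interpret S: finite_measure "surface_measure :: 'a measure" by (rule finite_surface_measure)
    define K where "K = measure surface_measure ?W"
    have K: "emeasure surface_measure ?W = ennreal K" by (simp add: K_def S.emeasure_eq_measure)
    have "emeasure (weight_measure ?m) ?T \<le> ennreal (1 / c' * K)"
    proof (rule emeasure_weight_measure_le)
      have "{r. ennreal (1 / c * l) < max_modulus r \<rho> * indicator {..<R} r} \<in> sets borel" by measurable
      then have "{0<..<1} \<inter> {r. ennreal (1 / c * l) < max_modulus r \<rho> * indicator {..<R} r} \<in> sets (lebesgue_on {0<..<1})"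
        by (auto simp: sets_restrict_space)
      moreover have "?T = {0<..<1} \<inter> {r. ennreal (1 / c * l) < max_modulus r \<rho> * indicator {..<R} r}"
        by (auto simp: space_weight_measure)
      ultimately show "?T \<in> sets (weight_measure ?m)" by (simp add: weight_measure_def)
      show "0 \<le> 1 / c' * K" using c by (simp add: K_def)
      fix r assume "r \<in> ?T"
      then have r0: "0 < r" "r < 1" "ennreal (1 / c * l) < max_modulus r \<rho> * indicator {..<R} r"
        by (auto simp: space_weight_measure)
      have "r < R"
      proof (rule ccontr)
        assume "\<not> r < R"
        then have "indicator {..<R} r = (0::ennreal)" by simp
        then show False using r0(3) by simp
      qed
      then have r: "0 < r" "r < 1" "r < R" "ennreal (1 / c * l) < max_modulus r \<rho>"
        using r0 by auto
      then obtain x where x: "norm x \<le> r" "ennreal (1 / c * l) < rho_norm \<rho> x"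
        by (auto simp: max_modulus_def less_SUP_iff)
      have xb: "x \<in> ball 0 1" using x r by simp
      have "ennreal (1 / c * l) < ennreal (u x)" using x(2) rho_norm_u[OF xb] by simp
      moreover have "0 \<le> 1 / c * l" using l' h(2) by linarith
      ultimately have ux: "1 / c * l < u x" by (simp only: ennreal_less_iff)
      have nx: "1/2 < norm x"
      proof (rule ccontr)
        assume "\<not> 1/2 < norm x"
        then have "ennreal (u x) \<le> max_modulus (1/2) \<rho>" by (intro u_le_max_modulus) auto
        also have "\<dots> \<le> ennreal h" by (rule h(1))
        finally have "u x \<le> h" using h(2) by (simp add: ennreal_le_iff)
        then show False using ux l' by simp
      qed
      have ux0: "0 < u x" using ux l' h(2) by linarith
      have nx': "1/2 \<le> norm x" using nx by simp
      obtain G where G: "G \<in> sets borel" "G \<subseteq> sphere 0 1" "\<forall>\<omega>\<in>G. \<forall>R\<in>{norm x..<1}. c * u x \<le> u (R *\<^sub>R \<omega>)"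
        "ennreal (c' * (1 - norm x) ^ (DIM('a) - 1)) \<le> emeasure surface_measure G"
        using c(3)[OF xb nx' ux0] by blast
      have "G \<subseteq> ?W"
      proof
        fix \<omega> assume \<omega>: "\<omega> \<in> G"
        then have n1: "norm \<omega> = 1" using G(2) by auto
        have "ennreal (c * u x) \<le> g \<omega>"
          using G(3) \<omega> nx x r by (intro dom[OF n1, of "norm x"]) auto
        moreover have "ennreal l < ennreal (c * u x)"
        proof (rule ennreal_lessI)
          show "0 < c * u x" using c ux0 by simp
          show "l < c * u x" using ux c by (simp add: divide_less_eq mult.commute)
        qed
        ultimately show "\<omega> \<in> ?W" using n1 by (auto simp: space_surface_measure)
      qed
      then have "emeasure surface_measure G \<le> ennreal K" unfolding K[symmetric] using W by (rule emeasure_mono)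
      then have "ennreal (c' * (1 - norm x) ^ Suc ?m) \<le> ennreal K" using G(4) unfolding m by (rule order_trans[rotated])
      then have "c' * (1 - norm x) ^ Suc ?m \<le> K" by (subst (asm) ennreal_le_iff) (auto simp: K_def)
      then have "(1 - norm x) ^ Suc ?m \<le> 1 / c' * K" using c(2) by (simp add: le_divide_eq mult.commute)
      moreover have "(1 - r) ^ Suc ?m \<le> (1 - norm x) ^ Suc ?m" using x r by (intro power_mono) auto
      ultimately show "(1 - r) ^ Suc ?m \<le> 1 / c' * K" by (rule order_trans[rotated])
    qed
    also have "\<dots> = ennreal (1 / c') * emeasure surface_measure ?W"
      unfolding K using c by (intro ennreal_mult) (auto simp: K_def)
    finally show "emeasure (weight_measure ?m) ?T \<le> ennreal (1 / c') * emeasure surface_measure ?W" .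
  qed (use c h in auto)
qed

text \<open>Let \<open>K\<close> be the measure of the superlevel set on the sphere divided by
  \<open>D\<close>. By \<open>radial_high_measure\<close>, a modulus of at most \<open>l\<close> at
  \<open>r \<ge> 1/2\<close> forces \<open>K\<close> to be at most (1 - r)^(n-1). So the modulus
  exceeds \<open>l\<close> on the whole interval where (1 - r)^(n-1) is below \<open>K\<close>, and
  the weight of this interval is at least a multiple of \<open>K\<close>.\<close>

lemma nt_maximal_distribution:
  assumes dim: "DIM('a) \<ge> 2"
  obtains c l0 C where "0 < c" "0 < l0" "0 < C"
    "\<And>l. l0 \<le> l \<Longrightarrow>
      emeasure surface_measure {\<omega> \<in> space surface_measure. ennreal (c * l) < nt_maximal \<rho> \<omega>}
        \<le> ennreal C * emeasure (weight_measure (DIM('a) - 2)) {r \<in> space (weight_measure (DIM('a) - 2)). ennreal l < max_modulus r \<rho>}"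
proof -
  let ?m = "DIM('a) - 2"
  have m: "DIM('a) - 1 = Suc ?m" using dim by simp
  \<comment> \<open>A point of the approach region with value above \<open>c * l\<close> yields, by
    \<open>u_whitney_le\<close>, a point of the radius with value above
    \<open>2 * l\<close>.\<close>
  define c where "c = 2 * (1 + 2 * A * A)"
  have c: "2 \<le> c" using A by (simp add: c_def)
  \<comment> \<open>Whitney balls centred at \<open>t *\<^sub>R \<omega>\<close> with
    \<open>t < 1/2\<close> lie in the ball of radius 3/4, so values of \<open>u\<close> above this
    level come only from \<open>t \<ge> 1/2\<close>.\<close>
  define l0 where "l0 = max 1 (enn2real (max_modulus (3/4) \<rho>))"
  have l0: "max_modulus (3/4) \<rho> \<le> ennreal l0" "0 < l0"
  proof -
    have "max_modulus (3/4) \<rho> = ennreal (enn2real (max_modulus (3/4) \<rho>))"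
      using max_modulus_finite[of "3/4"] by simp
    also have "\<dots> \<le> ennreal l0" by (intro ennreal_leI) (simp add: l0_def)
    finally show "max_modulus (3/4) \<rho> \<le> ennreal l0" .
  qed (simp add: l0_def)
  define D where "D = 8 ^ DIM('a) * B"
  have D: "0 < D" using B by (simp add: D_def)
  show thesis
  proof (rule that[of c l0 "D * 2 ^ Suc ?m"])
    fix l assume l: "l0 \<le> l"
    let ?W = "{\<omega> \<in> space surface_measure. ennreal (c * l) < nt_maximal \<rho> \<omega>}"
    let ?T = "{r \<in> space (weight_measure ?m). ennreal l < max_modulus r \<rho>}"
    have T: "?T \<in> sets (weight_measure ?m)"
    proof -
      have "{r. ennreal l < max_modulus r \<rho>} \<in> sets borel" by measurable
      then have "{0<..<1} \<inter> {r. ennreal l < max_modulus r \<rho>} \<in> sets (lebesgue_on {0<..<1})"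
        by (auto simp: sets_restrict_space)
      moreover have "?T = {0<..<1} \<inter> {r. ennreal l < max_modulus r \<rho>}" by (auto simp: space_weight_measure)
      ultimately show ?thesis by (simp add: weight_measure_def)
    qed
    have l_pos: "0 < l" using l l0 by simp
    have cross: "\<exists>t\<in>{1/2..<1}. 2 * l < u (t *\<^sub>R \<omega>)" if \<omega>: "\<omega> \<in> ?W" for \<omega>
    proof -
      have n1: "norm \<omega> = 1" using \<omega> by (simp add: space_surface_measure)
      obtain t x where t: "0 \<le> t" "t < 1" "x \<in> whitney_ball (t *\<^sub>R \<omega>)" "ennreal (c * l) < rho_norm \<rho> x"
        using \<omega> by (auto simp: nt_maximal_def less_SUP_iff approach_region_def)
      have tb: "t *\<^sub>R \<omega> \<in> ball 0 1" using n1 t by simp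
      have xb: "x \<in> ball 0 1" using whitney_ball_subset[OF tb] t(3) by blast
      have ux: "c * l < u x" using t(4) c l_pos by (simp add: rho_norm_u[OF xb] ennreal_less_iff)
      have t2: "1/2 \<le> t"
      proof (rule ccontr)
        assume "\<not> 1/2 \<le> t"
        have "norm (x - t *\<^sub>R \<omega>) < (1 - t) / 2"
          using t n1 by (simp add: whitney_ball_def dist_norm norm_minus_commute)
        then have "2 * norm (x - t *\<^sub>R \<omega>) < 1 - t" by simp
        moreover have "norm x \<le> norm (x - t *\<^sub>R \<omega>) + t"
          using norm_triangle_ineq[of "x - t *\<^sub>R \<omega>" "t *\<^sub>R \<omega>"] t n1 by simp
        ultimately have "norm x \<le> 3/4" using \<open>\<not> 1/2 \<le> t\<close> by linarith
        then have "ennreal (u x) \<le> max_modulus (3/4) \<rho>" by (intro u_le_max_modulus) auto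
        also have "\<dots> \<le> ennreal l" using l0(1) ennreal_leI[OF l] by (rule order_trans)
        finally have "u x \<le> l" using l_pos by (simp add: ennreal_le_iff)
        moreover have "1 * l \<le> c * l" using c l_pos by (intro mult_right_mono) auto
        ultimately show False using ux by simp
      qed
      have "c * l < (1 + 2 * A * A) * u (t *\<^sub>R \<omega>)"
        using ux u_whitney_le[OF tb _ t(3)] n1 t t2 by simp
      then have "(1 + 2 * A * A) * (2 * l) < (1 + 2 * A * A) * u (t *\<^sub>R \<omega>)"
        by (simp add: c_def mult_ac)
      moreover have "0 < 1 + 2 * A * A" using A by (simp add: add_pos_nonneg)
      ultimately have "2 * l < u (t *\<^sub>R \<omega>)" by (simp only: mult_less_cancel_left_pos)
      then show ?thesis using t2 t by auto
    qed
    interpret S: finite_measure "surface_measure :: 'a measure" by (rule finite_surface_measure)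
    define K where "K = measure surface_measure ?W / D"
    have K0: "0 \<le> K" using D by (simp add: K_def)
    have WK: "emeasure surface_measure ?W = ennreal (D * K)"
      using D by (simp add: K_def S.emeasure_eq_measure)
    have up: "K \<le> (1 - r) ^ Suc ?m" if r: "1/2 \<le> r" "r < 1" and Mr: "max_modulus r \<rho> \<le> ennreal l" for r
    proof -
      let ?E = "{\<omega> \<in> sphere 0 1. \<exists>t\<in>{r..<1}. 2 * l < u (t *\<^sub>R \<omega>)}"
      have ul: "u x \<le> l" if "norm x \<le> r" for x
      proof -
        have "ennreal (u x) \<le> ennreal l" using u_le_max_modulus[of x r] that r Mr by auto
        then show ?thesis using l_pos by (simp add: ennreal_le_iff)
      qed
      have "?W \<subseteq> ?E"
      proof
        fix \<omega> assume \<omega>: "\<omega> \<in> ?W"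
        then have n1: "norm \<omega> = 1" by (simp add: space_surface_measure)
        obtain t where t: "t \<in> {1/2..<1}" "2 * l < u (t *\<^sub>R \<omega>)" using cross[OF \<omega>] by blast
        have "r < t"
        proof (rule ccontr)
          assume "\<not> r < t"
          then have "u (t *\<^sub>R \<omega>) \<le> l" using t n1 by (intro ul) auto
          then show False using t l_pos by simp
        qed
        then show "\<omega> \<in> ?E" using t n1 by (auto intro!: bexI[of _ t])
      qed
      moreover have "?E \<in> sets surface_measure"
        using r by (intro sets_surface_measure radial_low_sets) auto
      ultimately have "ennreal (D * K) \<le> emeasure surface_measure ?E"
        unfolding WK[symmetric] by (rule emeasure_mono)
      also have "\<dots> \<le> ennreal (8 ^ DIM('a) * B * (1 - r) ^ (DIM('a) - 1))"
        using r l_pos by (intro radial_high_measure ul) auto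
      finally have "D * K \<le> D * (1 - r) ^ Suc ?m"
        unfolding m D_def using r B by (subst (asm) ennreal_le_iff) auto
      then show ?thesis using D by simp
    qed
    have "ennreal ((1/2) ^ Suc ?m * K) \<le> emeasure (weight_measure ?m) ?T"
    proof (cases "K = 0")
      case False
      define a where "a = 1 - root (Suc ?m) K"
      have rK: "0 < root (Suc ?m) K" "root (Suc ?m) K ^ Suc ?m = K"
        using False K0 by (auto intro: real_root_gt_zero real_root_pow_pos2 simp del: power_Suc)
      have "max_modulus (1/2) \<rho> \<le> ennreal l"
      proof -
        have "max_modulus (1/2) \<rho> \<le> max_modulus (3/4) \<rho>" by (rule max_modulus_mono) simp
        also have "\<dots> \<le> ennreal l0" by (rule l0(1))
        also have "\<dots> \<le> ennreal l" by (rule ennreal_leI[OF l])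
        finally show ?thesis .
      qed
      \<comment> \<open>The modulus at 1/2 is at most \<open>l\<close>, so \<open>up\<close> applies
        at 1/2. This places \<open>a\<close> at 1/2 or beyond, where \<open>up\<close> remains
        available on all of \<open>{a<..<1}\<close>.\<close>
      then have "K \<le> (1 - 1/2) ^ Suc ?m" by (intro up) auto
      then have "root (Suc ?m) K \<le> root (Suc ?m) ((1/2) ^ Suc ?m)" by (intro real_root_le_mono) auto
      also have "\<dots> = 1/2" by (intro real_root_power_cancel) auto
      finally have a: "1/2 \<le> a" "a < 1" using rK by (auto simp: a_def)
      have "{a<..<1} \<subseteq> ?T"
      proof
        fix r assume r: "r \<in> {a<..<1}"
        have "(1 - r) ^ Suc ?m < root (Suc ?m) K ^ Suc ?m"
          using r by (intro power_strict_mono) (auto simp: a_def)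
        then have "\<not> K \<le> (1 - r) ^ Suc ?m" using rK by simp
        then have "\<not> max_modulus r \<rho> \<le> ennreal l" using up[of r] r a by auto
        then show "r \<in> ?T" using r a by (auto simp: space_weight_measure)
      qed
      then have "ennreal (((1 - a) / 2) ^ Suc ?m) \<le> emeasure (weight_measure ?m) ?T"
        using a by (intro emeasure_weight_measure_ge[OF T]) auto
      moreover have "((1 - a) / 2) ^ Suc ?m = (1/2) ^ Suc ?m * K"
      proof -
        have "((1 - a) / 2) = 1/2 * root (Suc ?m) K" by (simp add: a_def)
        then show ?thesis using rK(2) by (simp only: power_mult_distrib)
      qed
      ultimately show ?thesis by simp
    qed simp
    then have "ennreal (D * 2 ^ Suc ?m) * ennreal ((1/2) ^ Suc ?m * K) \<le> ennreal (D * 2 ^ Suc ?m) * emeasure (weight_measure ?m) ?T"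
      by (rule mult_left_mono) simp
    moreover have "ennreal (D * 2 ^ Suc ?m) * ennreal ((1/2) ^ Suc ?m * K) = ennreal (D * K)"
    proof -
      have "(2::real) ^ Suc ?m * (1/2) ^ Suc ?m = 1" unfolding power_mult_distrib[symmetric] by simp
      then have "D * 2 ^ Suc ?m * ((1/2) ^ Suc ?m * K) = D * K" by (metis mult.assoc mult.right_neutral)
      moreover have "0 \<le> D * 2 ^ Suc ?m" "0 \<le> (1/2) ^ Suc ?m * K" using D K0 by auto
      ultimately show ?thesis by (metis ennreal_mult)
    qed
    ultimately show "emeasure surface_measure ?W \<le> ennreal (D * 2 ^ Suc ?m) * emeasure (weight_measure ?m) ?T"
      unfolding WK by simp
  qed (use c l0 D in auto)
qed

end

text \<open>Strict monotonicity up to infinity leaves room above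
  \<open>\<psi> (ennreal x)\<close>.\<close>

lemma growth_function_finite:
  assumes "strict_mono \<psi>"
  shows "\<psi> (ennreal x) < (\<infinity>::ennreal)"
proof -
  have "\<psi> (ennreal x) < \<psi> top" using assms by (rule strict_monoD) simp
  then show ?thesis using less_le_trans top_greatest by fastforce
qed

lemma finite_growth_bound:
  assumes M: "finite_measure M" and ab: "a < \<infinity>" "b < \<infinity>"
  shows "a * emeasure M (space M) + ennreal C * b < \<infinity>"
proof -
  have "emeasure M (space M) < \<infinity>"
    using finite_measure.emeasure_finite[OF M, of "space M"] by (simp add: less_top)
  then show ?thesis using ab by (simp add: ennreal_add_less_top ennreal_mult_less_top)
qed

section \<open>The implications between the four conditions\<close>

context conformal begin

lemma hardy_if_nt_maximal:
  assumes \<psi>: "mono \<psi>" and \<delta>: "0 < \<delta>" and nt: "L1 surface_measure (\<lambda>\<omega>. \<psi> (ennreal \<delta> * nt_maximal \<rho> \<omega>))"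
  shows "\<rho> \<in> hardy \<psi>"
proof -
  have "(SUP r\<in>{0<..<1}. \<integral>\<^sup>+\<omega>. \<psi> (ennreal \<delta> * rho_norm \<rho> (r *\<^sub>R \<omega>)) \<partial>surface_measure)
      \<le> (\<integral>\<^sup>+\<omega>. \<psi> (ennreal \<delta> * nt_maximal \<rho> \<omega>) \<partial>surface_measure)"
  proof (rule SUP_least, rule nn_integral_mono)
    fix r and \<omega> :: 'a assume "r \<in> {0<..<1::real}" "\<omega> \<in> space surface_measure"
    then have "rho_norm \<rho> (r *\<^sub>R \<omega>) \<le> nt_maximal \<rho> \<omega>"
      by (intro rho_norm_le_nt_maximal) (auto simp: space_surface_measure)
    then show "\<psi> (ennreal \<delta> * rho_norm \<rho> (r *\<^sub>R \<omega>)) \<le> \<psi> (ennreal \<delta> * nt_maximal \<rho> \<omega>)"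
      by (intro monoD[OF \<psi>] mult_left_mono) auto
  qed
  also have "\<dots> < \<infinity>" using nt by (simp add: L1_def)
  finally show ?thesis using \<delta> unfolding hardy_def by blast
qed

text \<open>The comparison goes through \<open>radial_limsup\<close>, which is Borel, equals the
  boundary norm almost everywhere, and is at most \<open>nt_maximal\<close> at every point of the
  sphere.\<close>

lemma boundary_norm_if_nt_maximal:
  assumes \<psi>: "mono \<psi>" "\<psi> \<in> borel_measurable borel"
    and nt: "L1 surface_measure (\<lambda>\<omega>. \<psi> (ennreal \<delta> * nt_maximal \<rho> \<omega>))"
  shows "L1 surface_measure (\<lambda>\<omega>. \<psi> (ennreal \<delta> * rho_norm \<rho> \<omega>))"
  unfolding L1_def
proof
  note [measurable] = \<psi>(2)
  have [measurable]: "rho_norm \<rho> \<in> borel_measurable surface_measure"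
    by (rule measurable_surface_measure_AE[OF radial_limsup_measurable rho_norm_AE_radial_limsup])
  show "(\<lambda>\<omega>. \<psi> (ennreal \<delta> * rho_norm \<rho> \<omega>)) \<in> borel_measurable surface_measure" by measurable
  have "(\<integral>\<^sup>+\<omega>. \<psi> (ennreal \<delta> * rho_norm \<rho> \<omega>) \<partial>surface_measure)
      = (\<integral>\<^sup>+\<omega>. \<psi> (ennreal \<delta> * radial_limsup \<omega>) \<partial>surface_measure)"
    by (rule nn_integral_cong_AE) (use rho_norm_AE_radial_limsup in \<open>eventually_elim, simp\<close>)
  also have "\<dots> \<le> (\<integral>\<^sup>+\<omega>. \<psi> (ennreal \<delta> * nt_maximal \<rho> \<omega>) \<partial>surface_measure)"
  proof (rule nn_integral_mono)
    fix \<omega> :: 'a assume "\<omega> \<in> space surface_measure"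
    then have "radial_limsup \<omega> \<le> nt_maximal \<rho> \<omega>"
      by (intro radial_limsup_le_nt_maximal) (simp add: space_surface_measure)
    then show "\<psi> (ennreal \<delta> * radial_limsup \<omega>) \<le> \<psi> (ennreal \<delta> * nt_maximal \<rho> \<omega>)"
      by (intro monoD[OF \<psi>(1)] mult_left_mono) auto
  qed
  also have "\<dots> < \<infinity>" using nt by (simp add: L1_def)
  finally show "(\<integral>\<^sup>+\<omega>. \<psi> (ennreal \<delta> * rho_norm \<rho> \<omega>) \<partial>surface_measure) < \<infinity>" .
qed

lemma weighted_max_modulus_measurable:
  assumes "\<psi> \<in> borel_measurable borel"
  shows "(\<lambda>r. \<psi> (ennreal \<delta> * max_modulus r \<rho>)) \<in> borel_measurable (lebesgue_on {0<..<1})"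
    and "(\<lambda>r. \<psi> (ennreal \<delta> * max_modulus r \<rho>)) \<in> borel_measurable (weight_measure m)"
proof -
  note [measurable] = assms
  show "(\<lambda>r. \<psi> (ennreal \<delta> * max_modulus r \<rho>)) \<in> borel_measurable (lebesgue_on {0<..<1})"
    by (intro measurable_restrict_space1 measurable_completion) measurable
  then show "(\<lambda>r. \<psi> (ennreal \<delta> * max_modulus r \<rho>)) \<in> borel_measurable (weight_measure m)"
    by (simp add: weight_measure_def)
qed

lemma L1_max_modulus_iff:
  assumes "\<psi> \<in> borel_measurable borel"
  shows "L1 (lebesgue_on {0<..<1}) (\<lambda>r. ennreal ((1 - r) ^ m) * \<psi> (ennreal \<delta> * max_modulus r \<rho>))
    \<longleftrightarrow> (\<integral>\<^sup>+r. \<psi> (ennreal \<delta> * max_modulus r \<rho>) \<partial>weight_measure m) < \<infinity>"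
proof -
  note [measurable] = weighted_max_modulus_measurable(1)[OF assms, of \<delta>]
  have "(\<integral>\<^sup>+r. \<psi> (ennreal \<delta> * max_modulus r \<rho>) \<partial>weight_measure m)
      = (\<integral>\<^sup>+r. ennreal ((1 - r) ^ m) * \<psi> (ennreal \<delta> * max_modulus r \<rho>) \<partial>lebesgue_on {0<..<1})"
    unfolding weight_measure_def by (rule nn_integral_density) measurable
  moreover have "(\<lambda>r. ennreal ((1 - r) ^ m) * \<psi> (ennreal \<delta> * max_modulus r \<rho>)) \<in> borel_measurable (lebesgue_on {0<..<1})"
    by measurable
  ultimately show ?thesis by (simp add: L1_def)
qed

lemma weight_measure_measurable:
  assumes "f \<in> borel_measurable borel"
  shows "f \<in> borel_measurable (weight_measure m)"
proof -
  have "f \<in> borel_measurable (lebesgue_on {0<..<1})"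
    using assms by (intro measurable_restrict_space1 measurable_completion) simp
  then show ?thesis by (simp add: weight_measure_def)
qed

text \<open>The scale \<open>\<delta> / (1 / c)\<close> is the one that
  \<open>growth_integral_compare\<close> produces for the level factor \<open>1 / c\<close> of
  \<open>max_modulus_distribution\<close>.\<close>

lemma max_modulus_integral_bound:
  assumes dim: "DIM('a) \<ge> 2" and \<psi>: "mono \<psi>" "continuous_on UNIV \<psi>" and \<delta>: "0 < \<delta>"
  obtains c l0 C where "0 < c"
    "\<And>g R. g \<in> borel_measurable borel \<Longrightarrow>
      (\<And>\<omega> a v. norm \<omega> = 1 \<Longrightarrow> 0 < a \<Longrightarrow> a < R \<Longrightarrow> a < 1 \<Longrightarrow> (\<And>t. a \<le> t \<Longrightarrow> t < 1 \<Longrightarrow> v \<le> u (t *\<^sub>R \<omega>)) \<Longrightarrow> ennreal v \<le> g \<omega>) \<Longrightarrow>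
      (\<integral>\<^sup>+r. \<psi> (ennreal (\<delta> / (1 / c)) * (max_modulus r \<rho> * indicator {..<R} r)) \<partial>weight_measure (DIM('a) - 2))
        \<le> \<psi> (ennreal (\<delta> * l0)) * emeasure (weight_measure (DIM('a) - 2)) (space (weight_measure (DIM('a) - 2)))
          + ennreal C * (\<integral>\<^sup>+\<omega>. \<psi> (ennreal \<delta> * g \<omega>) \<partial>surface_measure)"
proof -
  let ?W = "weight_measure (DIM('a) - 2)"
  obtain c l0 C where c: "0 < c" "0 < l0" "0 < C"
    "\<And>g R l. g \<in> borel_measurable borel \<Longrightarrow>
      (\<And>\<omega> a v. norm \<omega> = 1 \<Longrightarrow> 0 < a \<Longrightarrow> a < R \<Longrightarrow> a < 1 \<Longrightarrow> (\<And>t. a \<le> t \<Longrightarrow> t < 1 \<Longrightarrow> v \<le> u (t *\<^sub>R \<omega>)) \<Longrightarrow> ennreal v \<le> g \<omega>) \<Longrightarrow>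
      l0 \<le> l \<Longrightarrow>
      emeasure ?W {r \<in> space ?W. ennreal (1 / c * l) < max_modulus r \<rho> * indicator {..<R} r}
        \<le> ennreal C * emeasure surface_measure {\<omega> \<in> space surface_measure. ennreal l < g \<omega>}"
    using max_modulus_distribution[OF dim] by blast
  show thesis
  proof (rule that[OF c(1), of l0 C])
    fix g :: "'a \<Rightarrow> ennreal" and R :: real
    assume g: "g \<in> borel_measurable borel"
      and dom: "\<And>\<omega> a v. norm \<omega> = 1 \<Longrightarrow> 0 < a \<Longrightarrow> a < R \<Longrightarrow> a < 1 \<Longrightarrow> (\<And>t. a \<le> t \<Longrightarrow> t < 1 \<Longrightarrow> v \<le> u (t *\<^sub>R \<omega>)) \<Longrightarrow> ennreal v \<le> g \<omega>"
    have f: "(\<lambda>r. max_modulus r \<rho> * indicator {..<R} r) \<in> borel_measurable ?W"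
      by (rule weight_measure_measurable) measurable
    show "(\<integral>\<^sup>+r. \<psi> (ennreal (\<delta> / (1 / c)) * (max_modulus r \<rho> * indicator {..<R} r)) \<partial>?W)
        \<le> \<psi> (ennreal (\<delta> * l0)) * emeasure ?W (space ?W) + ennreal C * (\<integral>\<^sup>+\<omega>. \<psi> (ennreal \<delta> * g \<omega>) \<partial>surface_measure)"
    proof (rule growth_integral_compare[OF finite_weight_measure finite_surface_measure f measurable_surface_measure[OF g] \<psi>])
      fix l assume l: "l0 \<le> l"
      show "emeasure ?W {r \<in> space ?W. ennreal (1 / c * l) < max_modulus r \<rho> * indicator {..<R} r}
          \<le> ennreal C * emeasure surface_measure {\<omega> \<in> space surface_measure. ennreal l < g \<omega>}"
        by (rule c(4)[OF g dom l])
    qed (use c \<delta> in auto)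
  qed
qed

lemma max_modulus_if_boundary_norm:
  assumes dim: "DIM('a) \<ge> 2" and \<psi>: "strict_mono \<psi>" "continuous_on UNIV \<psi>" and \<delta>: "0 < \<delta>"
    and L: "L1 surface_measure (\<lambda>\<omega>. \<psi> (ennreal \<delta> * rho_norm \<rho> \<omega>))"
  shows "\<exists>\<delta>'>0. L1 (lebesgue_on {0<..<1}) (\<lambda>r. ennreal ((1 - r) ^ (DIM('a) - 2)) * \<psi> (ennreal \<delta>' * max_modulus r \<rho>))"
proof -
  let ?W = "weight_measure (DIM('a) - 2)"
  note mono = strict_mono_mono[OF \<psi>(1)]
  have \<psi>b: "\<psi> \<in> borel_measurable borel" using \<psi>(2) by (rule borel_measurable_continuous_onI)
  obtain c l0 C where c: "0 < c" and bound: "\<And>g R. g \<in> borel_measurable borel \<Longrightarrow>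
      (\<And>\<omega> a v. norm \<omega> = 1 \<Longrightarrow> 0 < a \<Longrightarrow> a < R \<Longrightarrow> a < 1 \<Longrightarrow> (\<And>t. a \<le> t \<Longrightarrow> t < 1 \<Longrightarrow> v \<le> u (t *\<^sub>R \<omega>)) \<Longrightarrow> ennreal v \<le> g \<omega>) \<Longrightarrow>
      (\<integral>\<^sup>+r. \<psi> (ennreal (\<delta> / (1 / c)) * (max_modulus r \<rho> * indicator {..<R} r)) \<partial>?W)
        \<le> \<psi> (ennreal (\<delta> * l0)) * emeasure ?W (space ?W) + ennreal C * (\<integral>\<^sup>+\<omega>. \<psi> (ennreal \<delta> * g \<omega>) \<partial>surface_measure)"
    using max_modulus_integral_bound[OF dim mono \<psi>(2) \<delta>] by blast
  have "(\<integral>\<^sup>+r. \<psi> (ennreal (\<delta> / (1 / c)) * max_modulus r \<rho>) \<partial>?W)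
      = (\<integral>\<^sup>+r. \<psi> (ennreal (\<delta> / (1 / c)) * (max_modulus r \<rho> * indicator {..<1} r)) \<partial>?W)"
    by (intro nn_integral_cong) (simp add: space_weight_measure)
  also have "\<dots> \<le> \<psi> (ennreal (\<delta> * l0)) * emeasure ?W (space ?W) + ennreal C * (\<integral>\<^sup>+\<omega>. \<psi> (ennreal \<delta> * radial_limsup \<omega>) \<partial>surface_measure)"
  proof (rule bound[OF radial_limsup_measurable])
    fix \<omega> :: 'a and a v :: real
    assume \<omega>: "norm \<omega> = 1" and a: "a < 1" and v: "\<And>t. a \<le> t \<Longrightarrow> t < 1 \<Longrightarrow> v \<le> u (t *\<^sub>R \<omega>)"
    \<comment> \<open>A lower bound on the whole outer part of a radius holds along
      \<open>tk\<close> from some index on, hence also for the upper limit.\<close>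
    have "eventually (\<lambda>k. a < tk k) sequentially" using order_tendstoD(1)[OF tk_tendsto a] .
    then have "eventually (\<lambda>k. ennreal v \<le> ennreal (u (tk k *\<^sub>R \<omega>))) sequentially"
      by eventually_elim (use v tk_bounds in \<open>auto intro!: ennreal_leI\<close>)
    then show "ennreal v \<le> radial_limsup \<omega>"
      unfolding radial_limsup_alt[OF \<omega>] by (intro le_Limsup) auto
  qed
  also have "(\<integral>\<^sup>+\<omega>. \<psi> (ennreal \<delta> * radial_limsup \<omega>) \<partial>surface_measure) \<le> (\<integral>\<^sup>+\<omega>. \<psi> (ennreal \<delta> * rho_norm \<rho> \<omega>) \<partial>surface_measure)"
    by (intro nn_integral_mono monoD[OF mono] mult_left_mono radial_limsup_le_rho_norm) (auto simp: space_surface_measure)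
  finally have "(\<integral>\<^sup>+r. \<psi> (ennreal (\<delta> / (1 / c)) * max_modulus r \<rho>) \<partial>?W)
      \<le> \<psi> (ennreal (\<delta> * l0)) * emeasure ?W (space ?W) + ennreal C * (\<integral>\<^sup>+\<omega>. \<psi> (ennreal \<delta> * rho_norm \<rho> \<omega>) \<partial>surface_measure)"
    by (simp add: add_left_mono mult_left_mono)
  also have "\<dots> < \<infinity>"
    using L growth_function_finite[OF \<psi>(1), of "\<delta> * l0"]
    unfolding L1_def by (intro finite_growth_bound finite_weight_measure) auto
  finally have "L1 (lebesgue_on {0<..<1}) (\<lambda>r. ennreal ((1 - r) ^ (DIM('a) - 2)) * \<psi> (ennreal (\<delta> / (1 / c)) * max_modulus r \<rho>))"
    unfolding L1_max_modulus_iff[OF \<psi>b] .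
  moreover have "0 < \<delta> / (1 / c)" using \<delta> c by simp
  ultimately show ?thesis by blast
qed

text \<open>A shadow gives lower bounds for \<open>u\<close> only at radii beyond
  \<open>norm x\<close>, while the Hardy condition speaks of one sphere at a time. With the sphere
  of radius \<open>tk k\<close> the modulus is therefore cut off at \<open>tk k\<close>; the bounds
  are uniform in \<open>k\<close>, and Fatou's lemma removes the cutoff.\<close>

lemma max_modulus_if_hardy:
  assumes dim: "DIM('a) \<ge> 2" and \<psi>: "strict_mono \<psi>" "continuous_on UNIV \<psi>" and H: "\<rho> \<in> hardy \<psi>"
  shows "\<exists>\<delta>'>0. L1 (lebesgue_on {0<..<1}) (\<lambda>r. ennreal ((1 - r) ^ (DIM('a) - 2)) * \<psi> (ennreal \<delta>' * max_modulus r \<rho>))"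
proof -
  let ?W = "weight_measure (DIM('a) - 2)"
  note mono = strict_mono_mono[OF \<psi>(1)]
  have \<psi>b[measurable]: "\<psi> \<in> borel_measurable borel" using \<psi>(2) by (rule borel_measurable_continuous_onI)
  obtain \<delta> where \<delta>: "0 < \<delta>" and S: "(SUP r\<in>{0<..<1}.
      \<integral>\<^sup>+\<omega>. \<psi> (ennreal \<delta> * rho_norm \<rho> (r *\<^sub>R \<omega>)) \<partial>surface_measure) < \<infinity>" (is "?S < _")
    using H by (auto simp: hardy_def)
  obtain c l0 C where c: "0 < c" and bound: "\<And>g R. g \<in> borel_measurable borel \<Longrightarrow>
      (\<And>\<omega> a v. norm \<omega> = 1 \<Longrightarrow> 0 < a \<Longrightarrow> a < R \<Longrightarrow> a < 1 \<Longrightarrow> (\<And>t. a \<le> t \<Longrightarrow> t < 1 \<Longrightarrow> v \<le> u (t *\<^sub>R \<omega>)) \<Longrightarrow> ennreal v \<le> g \<omega>) \<Longrightarrow>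
      (\<integral>\<^sup>+r. \<psi> (ennreal (\<delta> / (1 / c)) * (max_modulus r \<rho> * indicator {..<R} r)) \<partial>?W)
        \<le> \<psi> (ennreal (\<delta> * l0)) * emeasure ?W (space ?W) + ennreal C * (\<integral>\<^sup>+\<omega>. \<psi> (ennreal \<delta> * g \<omega>) \<partial>surface_measure)"
    using max_modulus_integral_bound[OF dim mono \<psi>(2) \<delta>] by blast
  let ?b = "\<psi> (ennreal (\<delta> * l0)) * emeasure ?W (space ?W) + ennreal C * ?S"
  let ?f = "\<lambda>k r. \<psi> (ennreal (\<delta> / (1 / c)) * (max_modulus r \<rho> * indicator {..<tk k} r))"
  have k: "(\<integral>\<^sup>+r. ?f k r \<partial>?W) \<le> ?b" for k
  proof -
    let ?g = "\<lambda>\<omega>. ennreal (indicator (ball 0 1) (tk k *\<^sub>R \<omega>) * u (tk k *\<^sub>R \<omega>))"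
    have g: "?g \<in> borel_measurable borel"
    proof -
      have "(\<lambda>\<omega>. (\<lambda>y. indicator (ball 0 1) y * u y) (tk k *\<^sub>R \<omega>)) \<in> borel_measurable borel"
        by (rule measurable_compose[OF _ u_indicator_measurable]) measurable
      then show ?thesis by simp
    qed
    have g_eq: "?g \<omega> = ennreal (u (tk k *\<^sub>R \<omega>))" "?g \<omega> = rho_norm \<rho> (tk k *\<^sub>R \<omega>)" if "norm \<omega> = 1" for \<omega>
    proof -
      have "tk k *\<^sub>R \<omega> \<in> ball 0 1" using that tk_bounds[of k] by simp
      then show "?g \<omega> = ennreal (u (tk k *\<^sub>R \<omega>))" "?g \<omega> = rho_norm \<rho> (tk k *\<^sub>R \<omega>)"
        by (simp_all add: rho_norm_u)
    qed
    have "(\<integral>\<^sup>+r. ?f k r \<partial>?W) \<le> \<psi> (ennreal (\<delta> * l0)) * emeasure ?W (space ?W) + ennreal C * (\<integral>\<^sup>+\<omega>. \<psi> (ennreal \<delta> * ?g \<omega>) \<partial>surface_measure)"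
    proof (rule bound[OF g])
      fix \<omega> :: 'a and a v :: real
      assume "norm \<omega> = 1" "a < tk k" and v: "\<And>t. a \<le> t \<Longrightarrow> t < 1 \<Longrightarrow> v \<le> u (t *\<^sub>R \<omega>)"
      then show "ennreal v \<le> ?g \<omega>"
        unfolding g_eq(1)[OF \<open>norm \<omega> = 1\<close>] using tk_bounds[of k] by (intro ennreal_leI v) auto
    qed
    also have "(\<integral>\<^sup>+\<omega>. \<psi> (ennreal \<delta> * ?g \<omega>) \<partial>surface_measure)
        = (\<integral>\<^sup>+\<omega>. \<psi> (ennreal \<delta> * rho_norm \<rho> (tk k *\<^sub>R \<omega>)) \<partial>surface_measure)"
      by (intro nn_integral_cong) (simp only: space_surface_measure mem_sphere_0 g_eq(2))
    also have "\<dots> \<le> ?S" using tk_bounds[of k] by (intro SUP_upper) auto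
    finally show ?thesis by (simp add: add_left_mono mult_left_mono)
  qed
  have "(\<integral>\<^sup>+r. \<psi> (ennreal (\<delta> / (1 / c)) * max_modulus r \<rho>) \<partial>?W) \<le> (\<integral>\<^sup>+r. liminf (\<lambda>k. ?f k r) \<partial>?W)"
  proof (rule nn_integral_mono)
    fix r assume "r \<in> space ?W"
    then have "r < 1" by (simp add: space_weight_measure)
    then have "eventually (\<lambda>k. r < tk k) sequentially" by (rule order_tendstoD(1)[OF tk_tendsto])
    then have "eventually (\<lambda>k. \<psi> (ennreal (\<delta> / (1 / c)) * max_modulus r \<rho>) \<le> ?f k r) sequentially"
      by eventually_elim simp
    then show "\<psi> (ennreal (\<delta> / (1 / c)) * max_modulus r \<rho>) \<le> liminf (\<lambda>k. ?f k r)"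
      by (rule Liminf_bounded)
  qed
  also have "\<dots> \<le> liminf (\<lambda>k. \<integral>\<^sup>+r. ?f k r \<partial>?W)"
    by (rule nn_integral_liminf, rule weight_measure_measurable) measurable
  also have "\<dots> \<le> limsup (\<lambda>k. \<integral>\<^sup>+r. ?f k r \<partial>?W)" by (intro Liminf_le_Limsup) auto
  also have "\<dots> \<le> ?b" using k by (intro Limsup_bounded always_eventually) auto
  also have "\<dots> < \<infinity>"
    using S growth_function_finite[OF \<psi>(1), of "\<delta> * l0"]
    by (intro finite_growth_bound finite_weight_measure) auto
  finally have "L1 (lebesgue_on {0<..<1}) (\<lambda>r. ennreal ((1 - r) ^ (DIM('a) - 2)) * \<psi> (ennreal (\<delta> / (1 / c)) * max_modulus r \<rho>))"
    unfolding L1_max_modulus_iff[OF \<psi>b] .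
  moreover have "0 < \<delta> / (1 / c)" using \<delta> c by simp
  ultimately show ?thesis by blast
qed

lemma nt_maximal_if_max_modulus:
  assumes dim: "DIM('a) \<ge> 2" and \<psi>: "strict_mono \<psi>" "continuous_on UNIV \<psi>" and \<delta>: "0 < \<delta>"
    and L: "L1 (lebesgue_on {0<..<1}) (\<lambda>r. ennreal ((1 - r) ^ (DIM('a) - 2)) * \<psi> (ennreal \<delta> * max_modulus r \<rho>))"
  shows "\<exists>\<delta>'>0. L1 surface_measure (\<lambda>\<omega>. \<psi> (ennreal \<delta>' * nt_maximal \<rho> \<omega>))"
proof -
  let ?W = "weight_measure (DIM('a) - 2)"
  note mono = strict_mono_mono[OF \<psi>(1)]
  have \<psi>b[measurable]: "\<psi> \<in> borel_measurable borel" using \<psi>(2) by (rule borel_measurable_continuous_onI)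
  note [measurable] = nt_maximal_measurable[of \<rho>]
  obtain c l0 C where c: "0 < c" "0 < l0" "0 < C"
    "\<And>l. l0 \<le> l \<Longrightarrow>
      emeasure surface_measure {\<omega> \<in> space surface_measure. ennreal (c * l) < nt_maximal \<rho> \<omega>}
        \<le> ennreal C * emeasure ?W {r \<in> space ?W. ennreal l < max_modulus r \<rho>}"
    using nt_maximal_distribution[OF dim] by blast
  have M: "(\<lambda>r. max_modulus r \<rho>) \<in> borel_measurable ?W"
    by (rule weight_measure_measurable) measurable
  have "(\<integral>\<^sup>+\<omega>. \<psi> (ennreal (\<delta> / c) * nt_maximal \<rho> \<omega>) \<partial>surface_measure)
      \<le> \<psi> (ennreal (\<delta> * l0)) * emeasure surface_measure (space (surface_measure :: 'a measure))
        + ennreal C * (\<integral>\<^sup>+r. \<psi> (ennreal \<delta> * max_modulus r \<rho>) \<partial>?W)"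
    by (rule growth_integral_compare[OF finite_surface_measure finite_weight_measure nt_maximal_measurable M mono \<psi>(2)])
      (use c \<delta> in auto)
  also have "\<dots> < \<infinity>"
    using L growth_function_finite[OF \<psi>(1), of "\<delta> * l0"]
    unfolding L1_max_modulus_iff[OF \<psi>b] by (intro finite_growth_bound finite_surface_measure) auto
  finally have "(\<integral>\<^sup>+\<omega>. \<psi> (ennreal (\<delta> / c) * nt_maximal \<rho> \<omega>) \<partial>surface_measure) < \<infinity>" .
  moreover have "(\<lambda>\<omega>. \<psi> (ennreal (\<delta> / c) * nt_maximal \<rho> \<omega>)) \<in> borel_measurable surface_measure" by measurable
  ultimately show ?thesis using \<delta> c by (intro exI[of _ "\<delta> / c"]) (simp add: L1_def)
qed

end

theorem theorem1p1:
  fixes \<rho> :: "'a::euclidean_space \<Rightarrow> real" and \<psi> :: "ennreal \<Rightarrow> ennreal"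
  assumes "DIM('a) \<ge> 2"
    and "conformal_density \<rho>"
    and "growth_function \<psi>"
  shows "(\<rho> \<in> hardy \<psi> \<longleftrightarrow>
           (\<exists>\<delta>\<^sub>1::real. \<delta>\<^sub>1 > 0 \<and> L1 surface_measure (\<lambda>\<omega>::'a. \<psi> (ennreal \<delta>\<^sub>1 * rho_norm \<rho> \<omega>))))
       \<and> ((\<exists>\<delta>\<^sub>1::real. \<delta>\<^sub>1 > 0 \<and> L1 surface_measure (\<lambda>\<omega>::'a. \<psi> (ennreal \<delta>\<^sub>1 * rho_norm \<rho> \<omega>))) \<longleftrightarrow>
          (\<exists>\<delta>\<^sub>2::real. \<delta>\<^sub>2 > 0 \<and> L1 surface_measure (\<lambda>\<omega>::'a. \<psi> (ennreal \<delta>\<^sub>2 * nt_maximal \<rho> \<omega>))))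
       \<and> ((\<exists>\<delta>\<^sub>2::real. \<delta>\<^sub>2 > 0 \<and> L1 surface_measure (\<lambda>\<omega>::'a. \<psi> (ennreal \<delta>\<^sub>2 * nt_maximal \<rho> \<omega>))) \<longleftrightarrow>
          (\<exists>\<delta>\<^sub>3::real. \<delta>\<^sub>3 > 0 \<and> L1 (lebesgue_on {0<..<1})
             (\<lambda>r. ennreal ((1 - r) ^ (DIM('a) - 2)) * \<psi> (ennreal \<delta>\<^sub>3 * max_modulus r \<rho>))))"
proof -
  obtain A B where "continuous_on (ball 0 1) \<rho>" "\<forall>x\<in>ball 0 1. 0 < \<rho> x"
    "1 \<le> A" "harnack A \<rho>" "0 < B" "volume_growth B \<rho>"
    using assms(2) unfolding conformal_density_def by blast
  then interpret conformal \<rho> A B by unfold_locales auto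
  have \<psi>: "strict_mono \<psi>" "continuous_on UNIV \<psi>" using assms(3) by (auto simp: growth_function_def)
  have mono: "mono \<psi>" and meas: "\<psi> \<in> borel_measurable borel"
    using \<psi> by (auto intro: strict_mono_mono borel_measurable_continuous_onI)
  let ?P1 = "\<rho> \<in> hardy \<psi>"
  let ?P2 = "\<exists>\<delta>\<^sub>1::real. \<delta>\<^sub>1 > 0 \<and> L1 surface_measure (\<lambda>\<omega>::'a. \<psi> (ennreal \<delta>\<^sub>1 * rho_norm \<rho> \<omega>))"
  let ?P3 = "\<exists>\<delta>\<^sub>2::real. \<delta>\<^sub>2 > 0 \<and> L1 surface_measure (\<lambda>\<omega>::'a. \<psi> (ennreal \<delta>\<^sub>2 * nt_maximal \<rho> \<omega>))"
  let ?P4 = "\<exists>\<delta>\<^sub>3::real. \<delta>\<^sub>3 > 0 \<and> L1 (lebesgue_on {0<..<1})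
             (\<lambda>r. ennreal ((1 - r) ^ (DIM('a) - 2)) * \<psi> (ennreal \<delta>\<^sub>3 * max_modulus r \<rho>))"
  \<comment> \<open>Condition (3) gives both (1) and (2), each of these gives (4), and (4) leads
    back to (3).\<close>
  have "?P3 \<Longrightarrow> ?P1" using hardy_if_nt_maximal[OF mono] by blast
  moreover have "?P3 \<Longrightarrow> ?P2" using boundary_norm_if_nt_maximal[OF mono meas] by blast
  moreover have "?P1 \<Longrightarrow> ?P4" using max_modulus_if_hardy[OF assms(1) \<psi>] by blast
  moreover have "?P2 \<Longrightarrow> ?P4" using max_modulus_if_boundary_norm[OF assms(1) \<psi>] by blast
  moreover have "?P4 \<Longrightarrow> ?P3" using nt_maximal_if_max_modulus[OF assms(1) \<psi>] by blast
  ultimately show ?thesis by blast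
qed

end
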